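(* Let $V$ be a $C^3$ function on $[-2,2]$ and $A\in\mathbb{R}$ a constant. Then there is a unique signed measure $\mu$ on $[-2,2]$ of finite total variation which, for some constant $C\in\mathbb{R}$, solves $$2\int\log|x-y|\,\mu(dy)=V(x)+C\ \text{ for Lebesgue-almost every }x\in[-2,2],\qquad \mu([-2,2])=A.$$ The solution $\mu$ is given by $\mu(dx)=u(x)\beta(dx)$, where $$u(x)=A-\frac12\int_{-2}^2yV'(y)\beta(dy)-\frac x2\int_{-2}^2V'(y)\beta(dy)+\frac{4-x^2}{2}\int_{-2}^2\frac{V'(x)-V'(y)}{x-y}\beta(dy).$$ In addition, the constant $C$ must be given by $C=-\int_{-2}^2V(x)\beta(dx)$. Moreover, for any $C^1$ function $\phi$ on $[-2,2]$, $$\int\phi(x)\mu(dx)=A\int\phi(x)\beta(dx)-\iint\frac{(V(x)-V(y))(\phi(x)-\phi(y))}{(x-y)^2}\,\omega(dx\,dy).$$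
   Context: $\beta(dx)=\frac{dx}{\pi\sqrt{4-x^2}}$ is the arcsine law on $[-2,2]$, and $\omega(dx\,dy)=\frac{(4-xy)\,dx\,dy}{4\pi^2\sqrt{(4-x^2)(4-y^2)}}$ on $[-2,2]\times[-2,2]$. *)

theory Defs
  imports "HOL-Analysis.Analysis"
begin

text \<open>Derivatives are taken within \<open>S\<close>, hence one-sided at the endpoints of a closed interval.
  Intended for sets without isolated points, where the derivative within \<open>S\<close> is unique.\<close>

abbreviation deriv_within :: "real set \<Rightarrow> (real \<Rightarrow> real) \<Rightarrow> real \<Rightarrow> real" where
  "deriv_within S f x \<equiv> vector_derivative f (at x within S)"

fun Ck_on :: "nat \<Rightarrow> (real \<Rightarrow> real) \<Rightarrow> real set \<Rightarrow> bool" where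
  "Ck_on 0 f S \<longleftrightarrow> continuous_on S f"
| "Ck_on (Suc k) f S \<longleftrightarrow> f differentiable_on S \<and> Ck_on k (deriv_within S f) S"

text \<open>A signed measure is a set function on the measurable sets of \<open>M\<close>. As for \<^const>\<open>measure\<close>,
  its value on non-measurable sets is fixed to be 0, so that equality of
  signed measures is equality of functions.\<close>

definition signed_measure :: "'a measure \<Rightarrow> ('a set \<Rightarrow> real) \<Rightarrow> bool" where
  "signed_measure M \<mu> \<longleftrightarrow>
     \<mu> {} = 0 \<and>
     (\<forall>F :: nat \<Rightarrow> 'a set. range F \<subseteq> sets M \<longrightarrow> disjoint_family F \<longrightarrow>
        (\<lambda>i. \<mu> (F i)) sums \<mu> (\<Union>i. F i)) \<and>
     (\<forall>B. B \<notin> sets M \<longrightarrow> \<mu> B = 0)"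

definition variation :: "'a measure \<Rightarrow> ('a set \<Rightarrow> real) \<Rightarrow> 'a set \<Rightarrow> ennreal" where
  "variation M \<mu> B =
     (SUP P \<in> {P. finite P \<and> disjoint P \<and> P \<subseteq> sets M \<and> \<Union>P = B}. \<Sum>E\<in>P. ennreal \<bar>\<mu> E\<bar>)"

definition finite_signed_measure :: "'a measure \<Rightarrow> ('a set \<Rightarrow> real) \<Rightarrow> bool" where
  "finite_signed_measure M \<mu> \<longleftrightarrow> signed_measure M \<mu> \<and> variation M \<mu> (space M) < \<infinity>"

definition variation_measure :: "'a measure \<Rightarrow> ('a set \<Rightarrow> real) \<Rightarrow> 'a measure" where
  "variation_measure M \<mu> = measure_of (space M) (sets M) (variation M \<mu>)"

text \<open>Jordan decomposition: the positive and negative parts are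
  \<open>(\<bar>\<mu>\<bar> + \<mu>) / 2\<close> and \<open>(\<bar>\<mu>\<bar> - \<mu>) / 2\<close>, where \<open>\<bar>\<mu>\<bar>\<close> is the variation.\<close>

definition pos_part_measure :: "'a measure \<Rightarrow> ('a set \<Rightarrow> real) \<Rightarrow> 'a measure" where
  "pos_part_measure M \<mu> =
     measure_of (space M) (sets M) (\<lambda>B. ennreal ((enn2real (variation M \<mu> B) + \<mu> B) / 2))"

definition neg_part_measure :: "'a measure \<Rightarrow> ('a set \<Rightarrow> real) \<Rightarrow> 'a measure" where
  "neg_part_measure M \<mu> =
     measure_of (space M) (sets M) (\<lambda>B. ennreal ((enn2real (variation M \<mu> B) - \<mu> B) / 2))"

definition signed_integrable :: "'a measure \<Rightarrow> ('a set \<Rightarrow> real) \<Rightarrow> ('a \<Rightarrow> real) \<Rightarrow> bool" where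
  "signed_integrable M \<mu> f \<longleftrightarrow> integrable (variation_measure M \<mu>) f"

definition signed_integral :: "'a measure \<Rightarrow> ('a set \<Rightarrow> real) \<Rightarrow> ('a \<Rightarrow> real) \<Rightarrow> real" where
  "signed_integral M \<mu> f =
     integral\<^sup>L (pos_part_measure M \<mu>) f - integral\<^sup>L (neg_part_measure M \<mu>) f"

abbreviation I :: "real set" where
  "I \<equiv> {-2..2}"

abbreviation borel_I :: "real measure" where
  "borel_I \<equiv> restrict_space borel I"

text \<open>Both measures live on the compact sets themselves rather than on the whole line or plane:
  functions are only controlled on \<open>I\<close>, so they need not be measurable outside it.\<close>

definition arcsine :: "real measure" where
  "arcsine = density (restrict_space lborel I) (\<lambda>x. ennreal (1 / (pi * sqrt (4 - x\<^sup>2))))"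

definition omega :: "(real \<times> real) measure" where
  "omega = density (restrict_space lborel (I \<times> I))
     (\<lambda>(x, y). ennreal ((4 - x * y) / (4 * pi\<^sup>2 * sqrt ((4 - x\<^sup>2) * (4 - y\<^sup>2)))))"

text \<open>The equation contains the requirement that the integral exists for almost every \<open>x\<close>.
  The value \<open>ln 0 = 0\<close> on the diagonal is harmless: it matters only if \<open>\<mu>\<close> has
  an atom at \<open>x\<close>, and a finite signed measure has at most countably many atoms.\<close>

definition solves :: "(real \<Rightarrow> real) \<Rightarrow> real \<Rightarrow> real \<Rightarrow> (real set \<Rightarrow> real) \<Rightarrow> bool" where
  "solves V A C \<mu> \<longleftrightarrow>
     (AE x in lborel. x \<in> I \<longrightarrow>
        signed_integrable borel_I \<mu> (\<lambda>y. ln \<bar>x - y\<bar>) \<and>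
        2 * signed_integral borel_I \<mu> (\<lambda>y. ln \<bar>x - y\<bar>) = V x + C) \<and>
     \<mu> I = A"

text \<open>Difference quotients have value 0 on the diagonal, which is null
  for \<^const>\<open>arcsine\<close> in \<open>y\<close> and for \<^const>\<open>omega\<close>.\<close>

definition sol_density :: "(real \<Rightarrow> real) \<Rightarrow> real \<Rightarrow> real \<Rightarrow> real" where
  "sol_density V A x =
     A - 1/2 * (\<integral>y. y * deriv_within I V y \<partial>arcsine)
       - x/2 * (\<integral>y. deriv_within I V y \<partial>arcsine)
       + (4 - x\<^sup>2)/2 * (\<integral>y. (deriv_within I V x - deriv_within I V y) / (x - y) \<partial>arcsine)"

end

theory Submission
  imports Defs
begin

text \<open>
  Substituting \<open>x = 2 cos t\<close>, the arcsine law \<open>\<beta>\<close> becomes the uniform distribution of the angle \<open>t\<close>,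
  and the functions \<open>T n x = cos (n t)\<close>, which are Chebyshev polynomials, form an orthogonal system.
  The logarithmic kernel is diagonal in it, \<open>ln \<bar>x - y\<bar> = - (\<Sum>n\<ge>1. 2 / n * T n x * T n y)\<close>, and this
  expansion carries the whole proof.

  Integrating the equation against \<open>T n\<close> and \<open>\<beta>\<close> gives, by Fubini's theorem, the moments of any
  solution: \<open>\<integral>T n d\<mu> = - n / 2 * \<integral>V * T n d\<beta>\<close> for \<open>n \<ge> 1\<close>, while \<open>n = 0\<close> yields the value of \<open>C\<close>
  (\<open>solution_moments\<close>). A difference of finite measures on \<open>I\<close> is determined by these moments
  (\<open>measure_eqI_moments\<close>), which proves uniqueness. The same principle proves existence: once the
  density \<open>u\<close> of the statement is known to have the right moments (\<open>sol_op_moment\<close>), its potential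
  minus \<open>V + C\<close> has vanishing moments, hence vanishes almost everywhere. That \<open>u\<close> has these moments is
  an algebraic identity for \<open>V = T n\<close> (\<open>sol_op_cheb\<close>), proved by the three-term recursion of the
  Chebyshev polynomials, and it extends to smooth \<open>V\<close> by approximation of \<open>V''\<close>.

  The formula for \<open>\<integral>\<phi> d\<mu>\<close> comes from the expansion obtained by differentiating the
  logarithmic kernel twice in one of the two angles, \<open>(\<Sum>n. n * T n x * T n y) = - (4 - x * y) / (2 * (x - y)\<^sup>2)\<close>.
  It shows that the bilinear form of \<open>\<omega>\<close> sends \<open>V\<close> and \<open>T n\<close> to \<open>n / 2 * \<integral>V * T n d\<beta>\<close>
  (\<open>dquot_T_integral\<close>), which are the moments of the solution again; general \<open>\<phi>\<close> follow by
  approximation in \<open>C\<^sup>1\<close>.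

  The first expansion converges only conditionally and the second one diverges. Both are therefore
  used through their Abel means, the kernels with coefficients multiplied by \<open>r ^ n\<close>, which have closed
  forms in \<open>1 - r cis (t - s)\<close> and \<open>1 - r cis (t + s)\<close>; the limit \<open>r \<longlonglongrightarrow> 1\<close> is taken under the integral
  by Fatou's lemma and dominated convergence. Signed measures are handled through their Jordan
  decomposition, which requires that the variation is a measure.
\<close>

section \<open>Signed measures and their Jordan decomposition\<close>

text \<open>With sums of measures, an identity \<open>P - N = P' - N'\<close> between differences of finite
  measures becomes the equality \<open>P + N' = P' + N\<close> of two measures.\<close>

definition add_measure :: "'a measure \<Rightarrow> 'a measure \<Rightarrow> 'a measure" where
  "add_measure M N = measure_of (space M) (sets M) (\<lambda>A. emeasure M A + emeasure N A)"

lemma sets_add_measure [simp, measurable_cong]: "sets (add_measure M N) = sets M"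
  by (simp add: add_measure_def)

lemma space_add_measure [simp]: "space (add_measure M N) = space M"
  by (simp add: add_measure_def)

lemma emeasure_add_measure:
  assumes "sets N = sets M" "A \<in> sets M"
  shows "emeasure (add_measure M N) A = emeasure M A + emeasure N A"
  unfolding add_measure_def
proof (rule emeasure_measure_of_sigma)
  show "countably_additive (sets M) (\<lambda>A. emeasure M A + emeasure N A)"
  proof (rule countably_additiveI)
    fix F :: "nat \<Rightarrow> 'a set"
    assume "range F \<subseteq> sets M" "disjoint_family F" "\<Union> (range F) \<in> sets M"
    then show "(\<Sum>i. emeasure M (F i) + emeasure N (F i)) = emeasure M (\<Union> (range F)) + emeasure N (\<Union> (range F))"
      using assms by (simp add: suminf_add[symmetric] suminf_emeasure)
  qed
qed (use assms in \<open>auto simp: positive_def sets.sigma_algebra_axioms\<close>)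

lemma nn_integral_add_measure:
  assumes N: "sets N = sets M" and f: "f \<in> borel_measurable M"
  shows "(\<integral>\<^sup>+x. f x \<partial>add_measure M N) = (\<integral>\<^sup>+x. f x \<partial>M) + (\<integral>\<^sup>+x. f x \<partial>N)"
  using f
proof (induction rule: borel_measurable_induct)
  case (cong f g)
  have "space N = space M" using N by (rule sets_eq_imp_space_eq)
  have "integral\<^sup>N (add_measure M N) f = integral\<^sup>N (add_measure M N) g"
    by (rule nn_integral_cong) (simp add: cong(3))
  moreover have "integral\<^sup>N M f = integral\<^sup>N M g"
    by (rule nn_integral_cong) (simp add: cong(3))
  moreover have "integral\<^sup>N N f = integral\<^sup>N N g"
    by (rule nn_integral_cong) (simp add: cong(3) \<open>space N = space M\<close>)
  ultimately show ?case using cong(4) by simp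
next
  case (set A)
  then show ?case using N by (simp add: emeasure_add_measure)
next
  case (mult u c)
  then have "u \<in> borel_measurable N" "u \<in> borel_measurable (add_measure M N)"
    using N by (simp_all cong: measurable_cong_sets)
  with mult show ?case by (simp add: nn_integral_cmult distrib_left)
next
  case (add u v)
  then have "u \<in> borel_measurable N" "u \<in> borel_measurable (add_measure M N)"
     "v \<in> borel_measurable N" "v \<in> borel_measurable (add_measure M N)"
    using N by (simp_all cong: measurable_cong_sets)
  with add show ?case by (simp add: nn_integral_add algebra_simps)
next
  case (seq U)
  then have m: "U i \<in> borel_measurable N" "U i \<in> borel_measurable (add_measure M N)" for i
    using N by (simp_all cong: measurable_cong_sets)
  have s: "space N = space M" using N by (rule sets_eq_imp_space_eq)
  have inc: "incseq (\<lambda>i. integral\<^sup>N M (U i))" "incseq (\<lambda>i. integral\<^sup>N N (U i))"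
    using incseq_SucD[OF seq(3)] by (auto intro!: incseq_SucI nn_integral_mono simp: le_fun_def)
  have "(\<integral>\<^sup>+x. (SUP i. U i x) \<partial>add_measure M N) = (SUP i. integral\<^sup>N M (U i) + integral\<^sup>N N (U i))"
    using seq m by (subst nn_integral_monotone_convergence_SUP) (auto)
  also have "\<dots> = (SUP i. integral\<^sup>N M (U i)) + (SUP i. integral\<^sup>N N (U i))"
    by (rule ennreal_SUP_add[OF inc])
  also have "\<dots> = (\<integral>\<^sup>+x. (SUP i. U i x) \<partial>M) + (\<integral>\<^sup>+x. (SUP i. U i x) \<partial>N)"
    using seq m by (simp add: nn_integral_monotone_convergence_SUP)
  finally show ?case by (simp add: image_comp)
qed

lemma integral_add_measure:
  fixes f :: "'a \<Rightarrow> real"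
  assumes N: "sets N = sets M" and f: "integrable M f" "integrable N f"
  shows "integrable (add_measure M N) f"
    and "integral\<^sup>L (add_measure M N) f = integral\<^sup>L M f + integral\<^sup>L N f"
proof -
  have m: "f \<in> borel_measurable M" using f(1) by auto
  then have m': "f \<in> borel_measurable (add_measure M N)" by (simp cong: measurable_cong_sets)
  have fin: "(\<integral>\<^sup>+x. ennreal (f x) \<partial>M) < \<infinity>" "(\<integral>\<^sup>+x. ennreal (- f x) \<partial>M) < \<infinity>"
    "(\<integral>\<^sup>+x. ennreal (f x) \<partial>N) < \<infinity>" "(\<integral>\<^sup>+x. ennreal (- f x) \<partial>N) < \<infinity>"
    using f unfolding real_integrable_def by (auto simp: top.not_eq_extremum)
  note fin' = fin[THEN less_imp_neq, unfolded infinity_ennreal_def]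
  have eq: "(\<integral>\<^sup>+x. ennreal (f x) \<partial>add_measure M N) = (\<integral>\<^sup>+x. ennreal (f x) \<partial>M) + (\<integral>\<^sup>+x. ennreal (f x) \<partial>N)"
    "(\<integral>\<^sup>+x. ennreal (- f x) \<partial>add_measure M N) = (\<integral>\<^sup>+x. ennreal (- f x) \<partial>M) + (\<integral>\<^sup>+x. ennreal (- f x) \<partial>N)"
    using m by (auto intro!: nn_integral_add_measure[OF N])
  show i: "integrable (add_measure M N) f"
    unfolding real_integrable_def eq infinity_ennreal_def ennreal_add_eq_top
    using fin' m' by blast
  show "integral\<^sup>L (add_measure M N) f = integral\<^sup>L M f + integral\<^sup>L N f"
    unfolding real_lebesgue_integral_def[OF i] real_lebesgue_integral_def[OF f(1)]
      real_lebesgue_integral_def[OF f(2)] eq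
      enn2real_plus[OF fin(1)[unfolded infinity_ennreal_def] fin(3)[unfolded infinity_ennreal_def]]
      enn2real_plus[OF fin(2)[unfolded infinity_ennreal_def] fin(4)[unfolded infinity_ennreal_def]]
    by simp
qed

lemma integrable_mono_measure:
  fixes f :: "'a \<Rightarrow> real"
  assumes "sets N = sets M" and "\<And>A. A \<in> sets M \<Longrightarrow> emeasure M A \<le> emeasure N A"
    and "integrable N f"
  shows "integrable M f"
proof -
  have "M \<le> N" using assms by (simp add: le_measure)
  then have "(\<integral>\<^sup>+x. ennreal (norm (f x)) \<partial>M) \<le> (\<integral>\<^sup>+x. ennreal (norm (f x)) \<partial>N)"
    using assms by (intro nn_integral_mono_measure) auto
  then show ?thesis
    using assms unfolding integrable_iff_bounded
    by (auto cong: measurable_cong_sets intro: order.strict_trans1)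
qed

lemma ennreal_abs_sums_le:
  fixes x :: "nat \<Rightarrow> real"
  assumes "x sums s"
  shows "ennreal \<bar>s\<bar> \<le> (\<Sum>i. ennreal \<bar>x i\<bar>)"
proof (rule LIMSEQ_le_const2)
  show "(\<lambda>n. ennreal \<bar>\<Sum>i<n. x i\<bar>) \<longlonglongrightarrow> ennreal \<bar>s\<bar>"
    using assms unfolding sums_def by (intro tendsto_ennrealI tendsto_rabs)
  have "ennreal \<bar>\<Sum>i<n. x i\<bar> \<le> (\<Sum>i. ennreal \<bar>x i\<bar>)" for n
  proof -
    have "ennreal \<bar>\<Sum>i<n. x i\<bar> \<le> (\<Sum>i<n. ennreal \<bar>x i\<bar>)"
      by (subst sum_ennreal) (auto intro!: ennreal_leI sum_abs)
    also have "\<dots> \<le> (\<Sum>i. ennreal \<bar>x i\<bar>)"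
      by (intro sum_le_suminf) auto
    finally show ?thesis .
  qed
  then show "\<exists>N. \<forall>n\<ge>N. ennreal \<bar>\<Sum>i<n. x i\<bar> \<le> (\<Sum>i. ennreal \<bar>x i\<bar>)" by auto
qed

lemma variation_upper:
  assumes "finite P" "disjoint P" "P \<subseteq> sets M" "\<Union>P = B"
  shows "(\<Sum>E\<in>P. ennreal \<bar>\<mu> E\<bar>) \<le> variation M \<mu> B"
  unfolding variation_def using assms by (intro SUP_upper) auto

lemma abs_le_variation: "B \<in> sets M \<Longrightarrow> ennreal \<bar>\<mu> B\<bar> \<le> variation M \<mu> B"
  using variation_upper[of "{B}" M B \<mu>] by auto

text \<open>A partition of \<open>A\<close> and a partition of \<open>B\<close> together form a partition of \<open>A \<union> B\<close>. The two can
  only share the empty set, whose measure is 0.\<close>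

lemma variation_Un_ge:
  assumes \<mu>: "\<mu> {} = 0" and AB: "A \<inter> B = {}" "A \<in> sets M" "B \<in> sets M"
  shows "variation M \<mu> A + variation M \<mu> B \<le> variation M \<mu> (A \<union> B)"
proof -
  let ?S = "\<lambda>B. {P. finite P \<and> disjoint P \<and> P \<subseteq> sets M \<and> \<Union>P = B}"
  let ?v = "\<lambda>P. \<Sum>E\<in>P. ennreal \<bar>\<mu> E\<bar>"
  have ne: "?S B \<noteq> {}" if "B \<in> sets M" for B
    using that by (auto intro!: exI[of _ "{B}"])
  have *: "?v P + ?v Q \<le> variation M \<mu> (A \<union> B)" if P: "P \<in> ?S A" and Q: "Q \<in> ?S B" for P Q
  proof -
    have "?v P + ?v Q = ?v (P \<union> Q)"
    proof (rule sum.union_inter_neutral[symmetric])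
      show "\<forall>E\<in>P \<inter> Q. ennreal \<bar>\<mu> E\<bar> = 0"
      proof
        fix E assume "E \<in> P \<inter> Q"
        then have "E \<subseteq> A \<inter> B" using P Q by auto
        then show "ennreal \<bar>\<mu> E\<bar> = 0" using AB \<mu> by auto
      qed
    qed (use P Q in auto)
    also have "\<dots> \<le> variation M \<mu> (A \<union> B)"
      using P Q AB by (intro variation_upper disjoint_union) auto
    finally show ?thesis .
  qed
  have "variation M \<mu> A + variation M \<mu> B = (SUP P\<in>?S A. ?v P + variation M \<mu> B)"
    unfolding variation_def using ne[OF AB(2)] by (subst ennreal_SUP_add_left) auto
  also have "\<dots> \<le> variation M \<mu> (A \<union> B)"
  proof (rule SUP_least)
    fix P assume P: "P \<in> ?S A"
    have "?v P + variation M \<mu> B = (SUP Q\<in>?S B. ?v P + ?v Q)"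
      unfolding variation_def using ne[OF AB(3)] by (subst ennreal_SUP_add_right) auto
    also have "\<dots> \<le> variation M \<mu> (A \<union> B)"
      using *[OF P] by (rule SUP_least)
    finally show "?v P + variation M \<mu> B \<le> variation M \<mu> (A \<union> B)" .
  qed
  finally show ?thesis .
qed

text \<open>One inequality is superadditivity on finitely many of the sets \<open>F i\<close>. For the other, a
  partition of the union is cut along the \<open>F i\<close>: by the triangle inequality each piece \<open>E\<close> has
  \<open>\<bar>\<mu> E\<bar> \<le> (\<Sum>i. \<bar>\<mu> (E \<inter> F i)\<bar>)\<close>, and the traces on a fixed \<open>F i\<close> form a partition of it.\<close>

lemma countably_additive_variation:
  assumes \<mu>: "signed_measure M \<mu>"
  shows "countably_additive (sets M) (variation M \<mu>)"
proof (rule countably_additiveI)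
  fix F :: "nat \<Rightarrow> 'a set"
  assume F: "range F \<subseteq> sets M" "disjoint_family F" and U: "\<Union> (range F) \<in> sets M"
  have \<mu>0: "\<mu> {} = 0" using \<mu> by (simp add: signed_measure_def)
  have le_Un: "(\<Sum>i<n. variation M \<mu> (F i)) \<le> variation M \<mu> (\<Union>i<n. F i)" for n
  proof (induction n)
    case (Suc n)
    have "(\<Sum>i<Suc n. variation M \<mu> (F i)) \<le> variation M \<mu> (\<Union>i<n. F i) + variation M \<mu> (F n)"
      using Suc by (simp add: add_right_mono)
    also have "\<dots> \<le> variation M \<mu> ((\<Union>i<n. F i) \<union> F n)"
    proof (rule variation_Un_ge[of \<mu>, OF \<mu>0])
      have "F i \<inter> F n = {}" if "i < n" for i
        by (rule disjoint_family_onD[OF F(2)]) (use that in auto)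
      then show "(\<Union>i<n. F i) \<inter> F n = {}" by auto
    qed (use F in auto)
    finally show ?case by (simp add: lessThan_Suc Un_commute)
  qed simp
  have "(\<Sum>i<n. variation M \<mu> (F i)) \<le> variation M \<mu> (\<Union> (range F))" for n
  proof -
    have "(\<Sum>i<n. variation M \<mu> (F i)) \<le> variation M \<mu> (\<Union>i<n. F i) + variation M \<mu> (\<Union> (range F) - (\<Union>i<n. F i))"
      using le_Un[of n] by (rule order_trans) simp
    also have "\<dots> \<le> variation M \<mu> ((\<Union>i<n. F i) \<union> (\<Union> (range F) - (\<Union>i<n. F i)))"
      using F U by (intro variation_Un_ge[of \<mu>, OF \<mu>0]) auto
    also have "(\<Union>i<n. F i) \<union> (\<Union> (range F) - (\<Union>i<n. F i)) = \<Union> (range F)" by auto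
    finally show ?thesis .
  qed
  then have ge: "(\<Sum>i. variation M \<mu> (F i)) \<le> variation M \<mu> (\<Union> (range F))"
    by (simp add: suminf_eq_SUP SUP_least)
  have "variation M \<mu> (\<Union> (range F)) \<le> (\<Sum>i. variation M \<mu> (F i))"
    unfolding variation_def[of M \<mu> "\<Union> (range F)"]
  proof (rule SUP_least, clarify)
    fix P assume P: "finite P" "disjoint P" "P \<subseteq> sets M" "\<Union>P = \<Union> (range F)"
    have sum: "(\<lambda>i. \<mu> (E \<inter> F i)) sums \<mu> E" if "E \<in> P" for E
    proof -
      have "(\<Union>i. E \<inter> F i) = E" using P(4) that by auto
      moreover have "range (\<lambda>i. E \<inter> F i) \<subseteq> sets M" "disjoint_family (\<lambda>i. E \<inter> F i)"
        using F P that by (auto simp: disjoint_family_on_def)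
      ultimately show ?thesis using \<mu> unfolding signed_measure_def by metis
    qed
    have "(\<Sum>E\<in>P. ennreal \<bar>\<mu> E\<bar>) \<le> (\<Sum>E\<in>P. \<Sum>i. ennreal \<bar>\<mu> (E \<inter> F i)\<bar>)"
      by (intro sum_mono ennreal_abs_sums_le sum)
    also have "\<dots> = (\<Sum>i. \<Sum>E\<in>P. ennreal \<bar>\<mu> (E \<inter> F i)\<bar>)"
      by (rule suminf_sum[symmetric]) auto
    also have "\<dots> \<le> (\<Sum>i. variation M \<mu> (F i))"
    proof (intro suminf_le allI)
      fix i
      have "(\<Sum>E\<in>P. ennreal \<bar>\<mu> (E \<inter> F i)\<bar>) = (\<Sum>E\<in>(\<lambda>E. E \<inter> F i) ` P. ennreal \<bar>\<mu> E\<bar>)"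
      proof (subst sum.reindex_nontrivial)
        fix E E' assume E: "E \<in> P" "E' \<in> P" "E \<noteq> E'" "E \<inter> F i = E' \<inter> F i"
        then have "E \<inter> F i = {}" using P(2) by (auto simp: disjoint_def)
        then show "ennreal \<bar>\<mu> (E \<inter> F i)\<bar> = 0" using \<mu>0 by simp
      qed (use P in auto)
      also have "\<dots> \<le> variation M \<mu> (F i)"
      proof (rule variation_upper)
        show "disjoint ((\<lambda>E. E \<inter> F i) ` P)"
          using P(2) unfolding disjoint_def by blast
      qed (use P F in auto)
      finally show "(\<Sum>E\<in>P. ennreal \<bar>\<mu> (E \<inter> F i)\<bar>) \<le> variation M \<mu> (F i)" .
    qed auto
    finally show "(\<Sum>E\<in>P. ennreal \<bar>\<mu> E\<bar>) \<le> (\<Sum>i. variation M \<mu> (F i))" .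
  qed
  with ge show "(\<Sum>i. variation M \<mu> (F i)) = variation M \<mu> (\<Union> (range F))" by (rule antisym)
qed

lemma variation_empty:
  assumes "\<mu> {} = 0"
  shows "variation M \<mu> {} = 0"
  unfolding variation_def
proof (rule antisym[OF SUP_least])
  fix P assume "P \<in> {P. finite P \<and> disjoint P \<and> P \<subseteq> sets M \<and> \<Union>P = {}}"
  then have "P \<subseteq> {{}}" by auto
  then have "\<forall>E\<in>P. ennreal \<bar>\<mu> E\<bar> = 0" using assms by auto
  then show "(\<Sum>E\<in>P. ennreal \<bar>\<mu> E\<bar>) \<le> 0" by simp
qed auto

lemma sets_signed_parts [simp, measurable_cong]:
  "sets (variation_measure M \<mu>) = sets M"
  "sets (pos_part_measure M \<mu>) = sets M"
  "sets (neg_part_measure M \<mu>) = sets M"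
  by (simp_all add: variation_measure_def pos_part_measure_def neg_part_measure_def)

lemma space_signed_parts [simp]:
  "space (variation_measure M \<mu>) = space M"
  "space (pos_part_measure M \<mu>) = space M"
  "space (neg_part_measure M \<mu>) = space M"
  by (simp_all add: variation_measure_def pos_part_measure_def neg_part_measure_def)

lemma emeasure_variation_measure:
  assumes "signed_measure M \<mu>" "B \<in> sets M"
  shows "emeasure (variation_measure M \<mu>) B = variation M \<mu> B"
  unfolding variation_measure_def using assms
  by (intro emeasure_measure_of_sigma countably_additive_variation)
     (auto simp: positive_def sets.sigma_algebra_axioms signed_measure_def variation_empty)

lemma finite_variation_measure:
  assumes "finite_signed_measure M \<mu>"
  shows "finite_measure (variation_measure M \<mu>)"
  using assms by (intro finite_measureI)
     (auto simp: finite_signed_measure_def emeasure_variation_measure)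

lemma abs_le_variation_real:
  assumes "finite_signed_measure M \<mu>" "B \<in> sets M"
  shows "\<bar>\<mu> B\<bar> \<le> enn2real (variation M \<mu> B)"
proof -
  interpret finite_measure "variation_measure M \<mu>" by (rule finite_variation_measure) fact
  have "variation M \<mu> B < \<infinity>"
    using assms emeasure_finite[of B]
    by (simp add: finite_signed_measure_def emeasure_variation_measure top.not_eq_extremum)
  with abs_le_variation[OF assms(2), of \<mu>] show ?thesis
    by (metis abs_ge_zero enn2real_ennreal enn2real_mono infinity_ennreal_def)
qed

text \<open>Stated for a sign \<open>s\<close>, so that it covers the positive and the negative part at once. The set
  function is nonnegative because \<open>\<mu>\<close> is dominated by its variation.\<close>

lemma emeasure_signed_part:
  assumes \<mu>: "finite_signed_measure M \<mu>" and B: "B \<in> sets M" and s: "\<bar>s\<bar> = (1::real)"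
  shows "emeasure (measure_of (space M) (sets M) (\<lambda>B. ennreal ((enn2real (variation M \<mu> B) + s * \<mu> B) / 2))) B
    = ennreal ((enn2real (variation M \<mu> B) + s * \<mu> B) / 2)"
proof (rule emeasure_measure_of_sigma[OF _ _ _ B])
  interpret finite_measure "variation_measure M \<mu>" by (rule finite_variation_measure) fact
  have sm: "signed_measure M \<mu>" using \<mu> by (simp add: finite_signed_measure_def)
  show "sigma_algebra (space M) (sets M)" by (rule sets.sigma_algebra_axioms)
  show "positive (sets M) (\<lambda>B. ennreal ((enn2real (variation M \<mu> B) + s * \<mu> B) / 2))"
    using sm by (simp add: positive_def signed_measure_def variation_empty)
  have m: "enn2real (variation M \<mu> B) = measure (variation_measure M \<mu>) B" if "B \<in> sets M" for B
    using emeasure_variation_measure[OF sm that] by (simp add: measure_def)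
  show "countably_additive (sets M) (\<lambda>B. ennreal ((enn2real (variation M \<mu> B) + s * \<mu> B) / 2))"
  proof (rule countably_additiveI)
    fix F :: "nat \<Rightarrow> 'a set"
    assume F: "range F \<subseteq> sets M" "disjoint_family F" and U: "\<Union> (range F) \<in> sets M"
    have "(\<lambda>i. enn2real (variation M \<mu> (F i))) sums enn2real (variation M \<mu> (\<Union> (range F)))"
      using finite_measure_UNION[of F] F U by (simp add: m range_subsetD)
    moreover have "(\<lambda>i. \<mu> (F i)) sums \<mu> (\<Union> (range F))"
      using sm F by (auto simp: signed_measure_def)
    ultimately have "(\<lambda>i. (enn2real (variation M \<mu> (F i)) + s * \<mu> (F i)) / 2) sums
        ((enn2real (variation M \<mu> (\<Union> (range F))) + s * \<mu> (\<Union> (range F))) / 2)"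
      by (intro sums_divide sums_add sums_mult)
    moreover have "0 \<le> (enn2real (variation M \<mu> (F i)) + s * \<mu> (F i)) / 2" for i
    proof -
      have "\<bar>s * \<mu> (F i)\<bar> \<le> enn2real (variation M \<mu> (F i))"
        using abs_le_variation_real[OF \<mu>, of "F i"] F s by (simp add: abs_mult range_subsetD)
      then have "0 \<le> enn2real (variation M \<mu> (F i)) + s * \<mu> (F i)" by linarith
      then show ?thesis by simp
    qed
    ultimately show "(\<Sum>i. ennreal ((enn2real (variation M \<mu> (F i)) + s * \<mu> (F i)) / 2))
      = ennreal ((enn2real (variation M \<mu> (\<Union> (range F))) + s * \<mu> (\<Union> (range F))) / 2)"
      by (intro suminf_ennreal_eq) auto
  qed
qed

lemma Jordan_decomposition:
  assumes \<mu>: "finite_signed_measure M \<mu>"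
  shows "finite_measure (pos_part_measure M \<mu>)" "finite_measure (neg_part_measure M \<mu>)"
    and "\<And>B. B \<in> sets M \<Longrightarrow> \<mu> B = measure (pos_part_measure M \<mu>) B - measure (neg_part_measure M \<mu>) B"
    and "\<And>B. B \<in> sets M \<Longrightarrow>
      variation M \<mu> B = emeasure (pos_part_measure M \<mu>) B + emeasure (neg_part_measure M \<mu>) B"
proof -
  interpret finite_measure "variation_measure M \<mu>" by (rule finite_variation_measure) fact
  have fin: "variation M \<mu> B < \<infinity>" if "B \<in> sets M" for B
    using \<mu> that emeasure_finite[of B]
    by (simp add: finite_signed_measure_def emeasure_variation_measure top.not_eq_extremum)
  have ep: "emeasure (pos_part_measure M \<mu>) B = ennreal ((enn2real (variation M \<mu> B) + \<mu> B) / 2)"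
    and en: "emeasure (neg_part_measure M \<mu>) B = ennreal ((enn2real (variation M \<mu> B) - \<mu> B) / 2)"
    if "B \<in> sets M" for B
    using emeasure_signed_part[OF \<mu> that, of 1] emeasure_signed_part[OF \<mu> that, of "-1"]
    by (simp_all add: pos_part_measure_def neg_part_measure_def)
  have nn: "0 \<le> (enn2real (variation M \<mu> B) + \<mu> B) / 2" "0 \<le> (enn2real (variation M \<mu> B) - \<mu> B) / 2"
    if "B \<in> sets M" for B
    using abs_le_variation_real[OF \<mu> that] by auto
  show "finite_measure (pos_part_measure M \<mu>)" "finite_measure (neg_part_measure M \<mu>)"
    by (auto intro!: finite_measureI simp: ep en)
  show "\<mu> B = measure (pos_part_measure M \<mu>) B - measure (neg_part_measure M \<mu>) B" if "B \<in> sets M" for B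
    using nn[OF that] that by (simp add: measure_def ep en field_simps)
  show "variation M \<mu> B = emeasure (pos_part_measure M \<mu>) B + emeasure (neg_part_measure M \<mu>) B"
    if "B \<in> sets M" for B
    using nn[OF that] fin[OF that] that
    by (simp add: ep en ennreal_plus[symmetric] add_divide_distrib[symmetric] del: ennreal_plus)
qed

lemma integrable_parts:
  assumes \<mu>: "finite_signed_measure M \<mu>" and "signed_integrable M \<mu> f"
  shows "integrable (pos_part_measure M \<mu>) f" "integrable (neg_part_measure M \<mu>) f"
proof -
  have i: "integrable (variation_measure M \<mu>) f"
    using assms(2) unfolding signed_integrable_def .
  have var: "emeasure (variation_measure M \<mu>) B =
      emeasure (pos_part_measure M \<mu>) B + emeasure (neg_part_measure M \<mu>) B" if "B \<in> sets M" for B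
    using \<mu> Jordan_decomposition(4)[OF \<mu> that] emeasure_variation_measure[of M \<mu> B] that
    unfolding finite_signed_measure_def by metis
  show "integrable (pos_part_measure M \<mu>) f"
  proof (rule integrable_mono_measure[OF _ _ i])
    fix B assume "B \<in> sets (pos_part_measure M \<mu>)"
    then have "B \<in> sets M" unfolding sets_signed_parts .
    from var[OF this] show "emeasure (pos_part_measure M \<mu>) B \<le> emeasure (variation_measure M \<mu>) B"
      by (metis add_increasing2 order_refl zero_le)
  qed (unfold sets_signed_parts, rule refl)
  show "integrable (neg_part_measure M \<mu>) f"
  proof (rule integrable_mono_measure[OF _ _ i])
    fix B assume "B \<in> sets (neg_part_measure M \<mu>)"
    then have "B \<in> sets M" unfolding sets_signed_parts .
    from var[OF this] show "emeasure (neg_part_measure M \<mu>) B \<le> emeasure (variation_measure M \<mu>) B"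
      by (metis add_increasing order_refl zero_le)
  qed (unfold sets_signed_parts, rule refl)
qed

text \<open>The Jordan decomposition is the smallest of all decompositions into a difference of finite
  measures.\<close>

lemma variation_le_add_measure:
  assumes P: "finite_measure P" "sets P = sets M" and N: "finite_measure N" "sets N = sets M"
    and eq: "\<And>B. B \<in> sets M \<Longrightarrow> \<mu> B = measure P B - measure N B"
    and B: "B \<in> sets M"
  shows "variation M \<mu> B \<le> emeasure (add_measure P N) B"
  unfolding variation_def
proof (rule SUP_least, clarify)
  interpret P: finite_measure P by fact
  interpret N: finite_measure N by fact
  let ?S = "add_measure P N"
  have S: "emeasure ?S B = emeasure P B + emeasure N B" if "B \<in> sets M" for B
    using that P N by (simp add: emeasure_add_measure)
  have le: "ennreal \<bar>\<mu> B\<bar> \<le> emeasure ?S B" if "B \<in> sets M" for B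
  proof -
    have "\<bar>\<mu> B\<bar> \<le> measure P B + measure N B"
      unfolding eq[OF that] using measure_nonneg[of P B] measure_nonneg[of N B] by linarith
    then show ?thesis
      unfolding S[OF that] P.emeasure_eq_measure N.emeasure_eq_measure
      using ennreal_plus[of "measure P B" "measure N B"] ennreal_leI by (metis measure_nonneg)
  qed
  fix Q assume Q: "finite Q" "disjoint Q" "Q \<subseteq> sets M" "B = \<Union>Q"
  have "(\<Sum>E\<in>Q. ennreal \<bar>\<mu> E\<bar>) \<le> (\<Sum>E\<in>Q. emeasure ?S E)"
    using Q by (intro sum_mono le) auto
  also have "\<dots> = emeasure ?S (\<Union>Q)"
    using Q P sum_emeasure[of "\<lambda>x. x" Q ?S] by (simp add: disjoint_family_on_def disjoint_def)
  finally show "(\<Sum>E\<in>Q. ennreal \<bar>\<mu> E\<bar>) \<le> emeasure ?S (\<Union>Q)" .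
qed

lemma finite_signed_measure_diff:
  assumes P: "finite_measure P" "sets P = sets M" and N: "finite_measure N" "sets N = sets M"
    and eq: "\<And>B. B \<in> sets M \<Longrightarrow> \<mu> B = measure P B - measure N B"
    and outside: "\<And>B. B \<notin> sets M \<Longrightarrow> \<mu> B = 0"
  shows "finite_signed_measure M \<mu>"
proof -
  interpret P: finite_measure P by fact
  interpret N: finite_measure N by fact
  have "(\<lambda>i. \<mu> (F i)) sums \<mu> (\<Union> (range F))"
    if F: "range F \<subseteq> sets M" "disjoint_family F" for F :: "nat \<Rightarrow> 'a set"
  proof -
    have "(\<lambda>i. measure P (F i) - measure N (F i)) sums (measure P (\<Union> (range F)) - measure N (\<Union> (range F)))"
      using F P(2) N(2) by (intro sums_diff P.finite_measure_UNION N.finite_measure_UNION) auto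
    moreover have "\<Union> (range F) \<in> sets M" using F(1) by blast
    ultimately show ?thesis using F(1) by (simp add: eq range_subsetD)
  qed
  moreover have "variation M \<mu> (space M) < \<infinity>"
  proof -
    have "variation M \<mu> (space M) \<le> emeasure P (space M) + emeasure N (space M)"
      using variation_le_add_measure[OF P N eq sets.top] P N by (simp add: emeasure_add_measure)
    also have "\<dots> < \<infinity>"
      using P.emeasure_finite N.emeasure_finite by (simp add: less_top[symmetric])
    finally show ?thesis .
  qed
  ultimately show ?thesis
    using eq[of "{}"] outside by (simp add: finite_signed_measure_def signed_measure_def)
qed

text \<open>Adding the positive part of one decomposition to the negative part of the other gives the same
  measure both ways round, so the integral does not depend on the decomposition. This frees later
  computations from the variation.\<close>

lemma signed_integral_eqI:
  assumes \<mu>: "finite_signed_measure M \<mu>"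
    and P: "finite_measure P" "sets P = sets M" and N: "finite_measure N" "sets N = sets M"
    and eq: "\<And>B. B \<in> sets M \<Longrightarrow> \<mu> B = measure P B - measure N B"
    and f: "integrable P f" "integrable N f"
  shows "signed_integrable M \<mu> f" "signed_integral M \<mu> f = integral\<^sup>L P f - integral\<^sup>L N f"
proof -
  interpret P: finite_measure P by fact
  interpret N: finite_measure N by fact
  let ?S = "add_measure P N" and ?p = "pos_part_measure M \<mu>" and ?n = "neg_part_measure M \<mu>"
  interpret p: finite_measure ?p by (rule Jordan_decomposition) fact
  interpret n: finite_measure ?n by (rule Jordan_decomposition) fact
  have "variation M \<mu> B \<le> emeasure ?S B" if "B \<in> sets M" for B
    using P N eq that by (rule variation_le_add_measure)
  then have "emeasure (variation_measure M \<mu>) B \<le> emeasure ?S B"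
    if B: "B \<in> sets (variation_measure M \<mu>)" for B
    using that \<mu> by (simp add: emeasure_variation_measure finite_signed_measure_def)
  moreover have "integrable ?S f"
    using P N f by (intro integral_add_measure) simp_all
  ultimately show si: "signed_integrable M \<mu> f"
    unfolding signed_integrable_def using integrable_mono_measure[of ?S "variation_measure M \<mu>" f] P(2) by simp
  have "add_measure ?p N = add_measure ?n P"
  proof (rule measure_eqI)
    fix B assume "B \<in> sets (add_measure ?p N)"
    then have B: "B \<in> sets M" by simp
    have "measure ?p B + measure N B = measure ?n B + measure P B"
      using eq[OF B] Jordan_decomposition(3)[OF \<mu> B] by simp
    then have "ennreal (measure ?p B) + ennreal (measure N B) = ennreal (measure ?n B) + ennreal (measure P B)"
      by (metis ennreal_plus measure_nonneg)
    then show "emeasure (add_measure ?p N) B = emeasure (add_measure ?n P) B"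
      using B P N unfolding p.emeasure_eq_measure[symmetric] n.emeasure_eq_measure[symmetric]
        P.emeasure_eq_measure[symmetric] N.emeasure_eq_measure[symmetric]
      by (simp add: emeasure_add_measure)
  qed simp
  then have "integral\<^sup>L ?p f + integral\<^sup>L N f = integral\<^sup>L ?n f + integral\<^sup>L P f"
    using integrable_parts[OF \<mu> si] f P N
    by (simp add: integral_add_measure(2)[symmetric])
  then show "signed_integral M \<mu> f = integral\<^sup>L P f - integral\<^sup>L N f"
    by (simp add: signed_integral_def)
qed

section \<open>Chebyshev polynomials and the arcsine law\<close>

text \<open>The Chebyshev polynomials of the first kind, rescaled from \<open>[-1, 1]\<close> to \<open>[-2, 2]\<close>.\<close>

fun cheb :: "nat \<Rightarrow> real poly" where
  "cheb 0 = 1"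
| "cheb (Suc 0) = [:0, 1/2:]"
| "cheb (Suc (Suc n)) = [:0, 1:] * cheb (Suc n) - cheb n"

abbreviation T :: "nat \<Rightarrow> real \<Rightarrow> real" where
  "T n \<equiv> poly (cheb n)"

lemma T_cos: "T n (2 * cos t) = cos (n * t)"
proof (induction n rule: cheb.induct)
  case (3 n)
  have "cos (real (Suc (Suc n)) * t) + cos (real n * t) = 2 * cos t * cos (real (Suc n) * t)"
    using cos_add[of "real (Suc n) * t" t] cos_diff[of "real (Suc n) * t" t]
    by (simp add: algebra_simps)
  with 3 show ?case by simp
qed simp_all

lemma I_cos:
  assumes "x \<in> I"
  obtains t where "x = 2 * cos t" "0 \<le> t" "t \<le> pi"
proof (rule that[of "arccos (x / 2)"])
  show "x = 2 * cos (arccos (x / 2))" "0 \<le> arccos (x / 2)" "arccos (x / 2) \<le> pi"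
    using assms by (auto intro: arccos_lbound arccos_ubound)
qed

lemma abs_T_le: "x \<in> I \<Longrightarrow> \<bar>T n x\<bar> \<le> 1"
  by (erule I_cos) (simp add: T_cos)

lemma T_mult:
  assumes "x \<in> I"
  shows "T m x * T n x = (T (m + n) x + T (if m \<le> n then n - m else m - n) x) / 2"
proof -
  obtain t where t: "x = 2 * cos t" using assms by (rule I_cos)
  have "cos (real (if m \<le> n then n - m else m - n) * t) = cos (real m * t - real n * t)"
    by (auto simp: of_nat_diff left_diff_distrib cos_diff)
  then show ?thesis unfolding t T_cos
    by (simp add: cos_diff cos_add distrib_right)
qed

inductive_set cheb_span :: "real poly set" where
  cheb: "cheb n \<in> cheb_span"
| add: "p \<in> cheb_span \<Longrightarrow> q \<in> cheb_span \<Longrightarrow> p + q \<in> cheb_span"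
| smult: "p \<in> cheb_span \<Longrightarrow> smult c p \<in> cheb_span"

lemma cheb_span_mult_X: "p \<in> cheb_span \<Longrightarrow> [:0, 1:] * p \<in> cheb_span"
proof (induction rule: cheb_span.induct)
  case (cheb n)
  show ?case
  proof (cases n)
    case 0
    have "[:0, 1:] * cheb n = smult 2 (cheb 1)" by (simp add: 0)
    then show ?thesis by (metis cheb_span.intros)
  next
    case (Suc k)
    have "[:0, 1:] * cheb n = cheb (Suc n) + cheb k" by (simp add: Suc)
    then show ?thesis by (metis cheb_span.intros)
  qed
next
  case (add p q)
  then show ?case unfolding distrib_left by (intro cheb_span.add)
next
  case (smult p c)
  then show ?case unfolding mult_smult_right by (intro cheb_span.smult)
qed

lemma cheb_span_UNIV: "p \<in> cheb_span"
proof (induction p)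
  case 0
  have "0 = smult 0 (cheb 0)" by simp
  then show ?case by (metis cheb_span.intros)
next
  case (pCons a p)
  have "pCons a p = smult a (cheb 0) + [:0, 1:] * p" by simp
  then show ?case using cheb_span_mult_X[OF pCons(2)] by (metis cheb_span.intros)
qed

text \<open>A statement that is linear in a polynomial only has to be checked on the \<open>cheb n\<close>.\<close>

lemma cheb_induct [case_names cheb add smult]:
  assumes "\<And>n. P (cheb n)" and "\<And>p q. P p \<Longrightarrow> P q \<Longrightarrow> P (p + q)"
    and "\<And>c p. P p \<Longrightarrow> P (smult c p)"
  shows "P (p :: real poly)"
  using cheb_span_UNIV[of p] by (induction rule: cheb_span.induct) (auto intro: assms)

lemma sets_arcsine [simp, measurable_cong]: "sets arcsine = sets borel_I"
  by (simp add: arcsine_def sets_restrict_space)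

lemma space_arcsine [simp]: "space arcsine = I"
  by (simp add: arcsine_def space_restrict_space)

lemma borel_measurable_borel_I_continuous:
  fixes f :: "real \<Rightarrow> real"
  shows "continuous_on I f \<Longrightarrow> f \<in> borel_measurable borel_I"
  by (rule borel_measurable_continuous_on_restrict)

lemma borel_measurable_T [measurable]: "T n \<in> borel_measurable borel"
  by (intro borel_measurable_continuous_onI continuous_intros)

lemma measurable_borel_I [measurable (raw)]: "f \<in> borel_measurable borel \<Longrightarrow> f \<in> borel_measurable borel_I"
  by (rule measurable_restrict_space1)

lemma square_less_4: "x \<in> {-2<..<2} \<Longrightarrow> x\<^sup>2 < (4::real)"
  using power_strict_mono[of "\<bar>x\<bar>" 2 2] by auto

lemma measurable_borel_I_pair:
  assumes "f \<in> borel_measurable (borel \<Otimes>\<^sub>M borel)"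
  shows "f \<in> borel_measurable (borel_I \<Otimes>\<^sub>M borel_I)"
proof -
  have id: "(\<lambda>x. x) \<in> borel_I \<rightarrow>\<^sub>M borel" by (rule measurable_restrict_space1) simp
  have "(\<lambda>p. (fst p, snd p)) \<in> borel_I \<Otimes>\<^sub>M borel_I \<rightarrow>\<^sub>M borel \<Otimes>\<^sub>M borel"
    by (intro measurable_Pair measurable_compose[OF measurable_fst id] measurable_compose[OF measurable_snd id])
  from measurable_compose[OF this assms] show ?thesis by simp
qed

text \<open>The substitution \<open>x = 2 cos t\<close> turns the weighted integrand into \<open>cos (n t) / pi\<close>; the function
  \<open>F\<close> below is its antiderivative in terms of \<open>x\<close>, continuous up to the endpoints where the
  weight is singular.\<close>

lemma T_weight_has_integral:
  "((\<lambda>x. T n x / (pi * sqrt (4 - x\<^sup>2))) has_integral (if n = 0 then 1 else 0)) I"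
proof -
  define F where "F x = (if n = 0 then - arccos (x / 2) / pi else - sin (n * arccos (x / 2)) / (n * pi))" for x :: real
  have "((\<lambda>x. T n x / (pi * sqrt (4 - x\<^sup>2))) has_integral (F 2 - F (-2))) I"
  proof (rule fundamental_theorem_of_calculus_interior)
    show "continuous_on I F"
      unfolding F_def by (cases "n = 0") (auto intro!: continuous_intros)
    fix x :: real assume x: "x \<in> {-2<..<2}"
    define t where "t = arccos (x / 2)"
    have xt: "x = 2 * cos t" using x by (simp add: t_def)
    have "sqrt (1 - (x / 2)\<^sup>2) = sqrt ((4 - x\<^sup>2) / 4)"
      by (simp add: field_simps power2_eq_square)
    also have "\<dots> = sqrt (4 - x\<^sup>2) / 2" by (simp add: real_sqrt_divide)
    finally have sq: "sqrt (1 - (x / 2)\<^sup>2) = sqrt (4 - x\<^sup>2) / 2" .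
    have "x\<^sup>2 < 4" using x by (rule square_less_4)
    then have pos: "sqrt (4 - x\<^sup>2) > 0" by simp
    have d: "((\<lambda>x. arccos (x / 2)) has_field_derivative (- inverse (sqrt (4 - x\<^sup>2)))) (at x)"
      using x pos by (auto intro!: derivative_eq_intros simp: sq real_sqrt_divide field_simps)
    have "(F has_field_derivative T n x / (pi * sqrt (4 - x\<^sup>2))) (at x)"
    proof (cases "n = 0")
      case True
      then show ?thesis unfolding F_def
        using DERIV_cdivide[OF DERIV_minus[OF d], of pi] pos by (simp add: field_simps)
    next
      case False
      have "T n x = cos (n * arccos (x / 2))" by (metis T_cos xt t_def)
      then show ?thesis unfolding F_def
        using DERIV_cdivide[OF DERIV_minus[OF DERIV_fun_sin[OF DERIV_cmult[OF d, of n]]], of "n * pi"] pos False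
        by (simp add: field_simps)
    qed
    then show "(F has_vector_derivative T n x / (pi * sqrt (4 - x\<^sup>2))) (at x)"
      by (simp add: has_real_derivative_iff_has_vector_derivative)
  qed auto
  moreover have "F 2 - F (-2) = (if n = 0 then 1 else 0)"
    by (simp add: F_def)
  ultimately show ?thesis by simp
qed

lemma weight_nonneg: "x \<in> I \<Longrightarrow> 0 \<le> 1 / (pi * sqrt (4 - x\<^sup>2))"
  using abs_square_le_1[of "x/2"] by (auto simp: field_simps power2_eq_square)

lemma emeasure_arcsine: "emeasure arcsine I = 1"
proof -
  let ?w = "\<lambda>x::real. if x \<in> I then 1 / (pi * sqrt (4 - x\<^sup>2)) else 0"
  have "emeasure arcsine I = (\<integral>\<^sup>+x. ennreal (1 / (pi * sqrt (4 - x\<^sup>2))) * indicator I x \<partial>restrict_space lborel I)"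
    unfolding arcsine_def by (subst emeasure_density) (auto simp: sets_restrict_space)
  also have "\<dots> = (\<integral>\<^sup>+x. ennreal (?w x) \<partial>lborel)"
    by (subst nn_integral_restrict_space) (auto intro!: nn_integral_cong split: split_indicator)
  also have "\<dots> = ennreal 1"
  proof (rule nn_integral_has_integral_lborel)
    have "((\<lambda>x. if x \<in> I then T 0 x / (pi * sqrt (4 - x\<^sup>2)) else 0) has_integral 1) UNIV"
      using T_weight_has_integral[of 0] by (subst has_integral_restrict_UNIV) simp
    then show "(?w has_integral 1) UNIV" by (simp cong: if_cong)
  qed (use weight_nonneg in auto)
  finally show ?thesis by simp
qed

interpretation arcsine: finite_measure arcsine
  by (rule finite_measureI) (simp add: emeasure_arcsine)

lemma measure_arcsine: "measure arcsine I = 1"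
  by (simp add: measure_def emeasure_arcsine)

lemma integrable_finite_bounded:
  fixes f :: "real \<Rightarrow> real"
  assumes "finite_measure M" "sets M = sets borel_I"
    and "f \<in> borel_measurable borel_I" "\<And>x. x \<in> I \<Longrightarrow> \<bar>f x\<bar> \<le> B"
  shows "integrable M f"
proof -
  have "space M = I" using sets_eq_imp_space_eq[OF assms(2)] by (simp add: space_restrict_space)
  then show ?thesis using assms
    by (intro finite_measure.integrable_const_bound[where B=B]) (auto cong: measurable_cong_sets)
qed

lemma integrable_finite_continuous:
  fixes f :: "real \<Rightarrow> real"
  assumes "finite_measure M" "sets M = sets borel_I" "continuous_on I f"
  shows "integrable M f"
proof -
  have "bounded (f ` I)" by (intro compact_imp_bounded compact_continuous_image assms) auto
  then obtain B where "\<forall>x\<in>I. \<bar>f x\<bar> \<le> B" by (auto simp: bounded_iff)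
  then show ?thesis
    using assms by (intro integrable_finite_bounded[where B=B] borel_measurable_borel_I_continuous) auto
qed

lemma arcsine_integrable_bounded:
  fixes f :: "real \<Rightarrow> real"
  assumes "f \<in> borel_measurable borel_I" "\<And>x. x \<in> I \<Longrightarrow> \<bar>f x\<bar> \<le> B"
  shows "integrable arcsine f"
  using assms by (intro integrable_finite_bounded arcsine.finite_measure_axioms) auto

lemma arcsine_integrable_continuous:
  fixes f :: "real \<Rightarrow> real"
  assumes "continuous_on I f"
  shows "integrable arcsine f"
  using assms by (intro integrable_finite_continuous arcsine.finite_measure_axioms) auto

lemma arcsine_integral_bound:
  assumes "\<And>x. x \<in> I \<Longrightarrow> \<bar>f x\<bar> \<le> (B::real)"
  shows "\<bar>\<integral>x. f x \<partial>arcsine\<bar> \<le> B"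
proof (cases "integrable arcsine f")
  case True
  have "\<bar>\<integral>x. f x \<partial>arcsine\<bar> \<le> (\<integral>x. \<bar>f x\<bar> \<partial>arcsine)"
    by (rule integral_abs_bound)
  also have "\<dots> \<le> (\<integral>x. B \<partial>arcsine)"
    using True assms by (intro integral_mono) auto
  finally show ?thesis by (simp add: measure_arcsine)
next
  case False
  then show ?thesis using assms[of 0] by (simp add: not_integrable_integral_eq)
qed

lemma integral_T: "(\<integral>x. T n x \<partial>arcsine) = (if n = 0 then 1 else 0)"
proof -
  have i: "integrable arcsine (T n)"
    by (intro arcsine_integrable_continuous continuous_intros)
  let ?w = "\<lambda>x. if x \<in> I then T n x / (pi * sqrt (4 - x\<^sup>2)) else 0"
  have w: "AE x in restrict_space lborel I. 0 \<le> 1 / (pi * sqrt (4 - x\<^sup>2))"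
    using weight_nonneg by (intro AE_I2) (auto simp: space_restrict_space)
  have m: "T n \<in> borel_measurable (restrict_space lborel I)"
    by (intro measurable_restrict_space1) simp
  have m': "(\<lambda>x. 1 / (pi * sqrt (4 - x\<^sup>2))) \<in> borel_measurable (restrict_space lborel I)"
    by (intro measurable_restrict_space1) simp
  have eq: "(\<lambda>x. indicator I x *\<^sub>R (1 / (pi * sqrt (4 - x\<^sup>2))) *\<^sub>R T n x) = ?w"
    by (auto simp: fun_eq_iff split: split_indicator)
  have "integrable lborel ?w"
    using i unfolding arcsine_def integrable_density[OF m m' w] 
    by (subst (asm) integrable_restrict_space) (auto simp only: eq, simp)
  moreover have "(\<integral>x. T n x \<partial>arcsine) = (\<integral>x. ?w x \<partial>lborel)"
    unfolding arcsine_def integral_density[OF m m' w]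
    by (subst integral_restrict_space) (auto simp only: eq, simp)
  ultimately have "(?w has_integral (\<integral>x. T n x \<partial>arcsine)) UNIV"
    using has_integral_integral_lborel by metis
  moreover have "(?w has_integral (if n = 0 then 1 else 0)) UNIV"
    using T_weight_has_integral[of n] by (subst has_integral_restrict_UNIV)
  ultimately show ?thesis by (rule has_integral_unique)
qed

lemma integral_T_T:
  "(\<integral>x. T m x * T n x \<partial>arcsine) = (if m = n then if n = 0 then 1 else 1/2 else 0)"
proof -
  have "(\<integral>x. T m x * T n x \<partial>arcsine) =
      (\<integral>x. (T (m + n) x + T (if m \<le> n then n - m else m - n) x) / 2 \<partial>arcsine)"
    by (intro Bochner_Integration.integral_cong) (auto simp: T_mult)
  also have "\<dots> = ((\<integral>x. T (m + n) x \<partial>arcsine) + (\<integral>x. T (if m \<le> n then n - m else m - n) x \<partial>arcsine)) / 2"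
    by (simp add: arcsine_integrable_continuous continuous_intros)
  finally have eq: "(\<integral>x. T m x * T n x \<partial>arcsine) =
    ((if m + n = 0 then 1 else 0) + (if (if m \<le> n then n - m else m - n) = 0 then 1 else 0)) / 2"
    unfolding integral_T .
  show ?thesis unfolding eq by auto
qed

lemma AE_arcsine_neq: "AE y in arcsine. y \<noteq> x"
proof -
  have "AE y in lborel. y \<in> I \<longrightarrow> y \<noteq> x"
    using AE_lborel_singleton[of x] by eventually_elim auto
  then have "AE y in restrict_space lborel I. y \<noteq> x"
    by (subst AE_restrict_space_iff) auto
  then show ?thesis unfolding arcsine_def
    by (subst AE_density) (auto intro!: measurable_restrict_space1 elim: eventually_mono)
qed

text \<open>The formula for the density is positive on \<open>I\<close> except at the two endpoints, where division by 0
  gives 0.\<close>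

lemma AE_arcsine_iff: "(AE x in arcsine. P x) \<longleftrightarrow> (AE x in lborel. x \<in> I \<longrightarrow> P x)"
proof -
  have "(AE x in arcsine. P x) \<longleftrightarrow> (AE x in restrict_space lborel I. 0 < ennreal (1 / (pi * sqrt (4 - x\<^sup>2))) \<longrightarrow> P x)"
    unfolding arcsine_def by (subst AE_density) (auto intro!: measurable_restrict_space1)
  also have "\<dots> \<longleftrightarrow> (AE x in lborel. x \<in> I \<longrightarrow> 0 < ennreal (1 / (pi * sqrt (4 - x\<^sup>2))) \<longrightarrow> P x)"
    by (subst AE_restrict_space_iff) auto
  also have "\<dots> \<longleftrightarrow> (AE x in lborel. x \<in> I \<longrightarrow> P x)"
  proof
    assume "AE x in lborel. x \<in> I \<longrightarrow> 0 < ennreal (1 / (pi * sqrt (4 - x\<^sup>2))) \<longrightarrow> P x"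
    then show "AE x in lborel. x \<in> I \<longrightarrow> P x"
      using AE_lborel_singleton[of 2] AE_lborel_singleton[of "-2"]
    proof eventually_elim
      case (elim x)
      have "x\<^sup>2 < 4" if "x \<in> I"
        using elim that by (intro square_less_4) auto
      with elim show ?case by simp
    qed
  qed (auto elim: eventually_mono)
  finally show ?thesis .
qed

section \<open>Kernels that are diagonal in the Chebyshev basis\<close>

text \<open>Kernels that act on the \<open>T n\<close> diagonally. Both \<open>ln \<bar>x - y\<bar>\<close> and, up to a factor, \<open>(4 - x * y) / (x - y)\<^sup>2\<close>
  are limits of such kernels with summable coefficients, obtained by Abel summation of their
  expansions.\<close>

definition cheb_kernel :: "(nat \<Rightarrow> real) \<Rightarrow> real \<Rightarrow> real \<Rightarrow> real" where
  "cheb_kernel c x y = (\<Sum>n. c n * T n x * T n y)"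

lemma kern_commute: "cheb_kernel c x y = cheb_kernel c y x"
  by (simp add: cheb_kernel_def mult_ac)

lemma measurable_kern [measurable]: "(\<lambda>(x, y). cheb_kernel c x y) \<in> borel_measurable (borel \<Otimes>\<^sub>M borel)"
  unfolding cheb_kernel_def by measurable

lemma abs_kern_term_le: "x \<in> I \<Longrightarrow> y \<in> I \<Longrightarrow> \<bar>c n * T n x * T n y\<bar> \<le> \<bar>c n\<bar>"
  using mult_mono[OF abs_T_le abs_T_le, of x y n n]
  by (simp add: abs_mult mult.assoc mult_left_le)

lemma summable_kern:
  assumes c: "summable (\<lambda>n. \<bar>c n\<bar>)" and "x \<in> I" "y \<in> I"
  shows "summable (\<lambda>n. \<bar>c n * T n x * T n y\<bar>)"
  by (rule summable_comparison_test'[OF c, of 0]) (use abs_kern_term_le[OF assms(2,3)] in auto)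

lemma abs_kern_le:
  assumes c: "summable (\<lambda>n. \<bar>c n\<bar>)" and "x \<in> I" "y \<in> I"
  shows "\<bar>cheb_kernel c x y\<bar> \<le> (\<Sum>n. \<bar>c n\<bar>)"
proof -
  have "\<bar>cheb_kernel c x y\<bar> \<le> (\<Sum>n. \<bar>c n * T n x * T n y\<bar>)"
    unfolding cheb_kernel_def by (rule summable_rabs[OF summable_kern[OF assms]])
  also have "\<dots> \<le> (\<Sum>n. \<bar>c n\<bar>)"
    by (intro suminf_le abs_kern_term_le summable_kern assms)
  finally show ?thesis .
qed

text \<open>Termwise integration; by orthogonality only the term \<open>n = m\<close> remains.\<close>

lemma kern_moment:
  assumes c: "summable (\<lambda>n. \<bar>c n\<bar>)" and y: "y \<in> I"
  shows "(\<integral>x. cheb_kernel c x y * T m x \<partial>arcsine) = (if m = 0 then 1 else 1/2) * c m * T m y"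
proof -
  let ?f = "\<lambda>n x. c n * T n x * T n y * T m x"
  have le: "\<bar>?f n x\<bar> \<le> \<bar>c n\<bar>" if "x \<in> I" for n x
    using mult_mono[OF abs_kern_term_le[OF that y, of c n] abs_T_le[OF that, of m]]
    by (simp add: abs_mult)
  have int: "integrable arcsine (?f n)" for n
    by (intro arcsine_integrable_continuous continuous_intros)
  have "(\<lambda>n. \<integral>x. ?f n x \<partial>arcsine) sums (\<integral>x. (\<Sum>n. ?f n x) \<partial>arcsine)"
  proof (rule sums_integral[OF int])
    show "AE x in arcsine. summable (\<lambda>i. norm (?f i x))"
      by (rule AE_I2, rule summable_comparison_test'[OF c, of 0]) (use le in auto)
    show "summable (\<lambda>i. \<integral>x. norm (?f i x) \<partial>arcsine)"
    proof (rule summable_comparison_test'[OF c, of 0])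
      fix n show "norm (\<integral>x. norm (?f n x) \<partial>arcsine) \<le> \<bar>c n\<bar>"
        unfolding real_norm_def by (rule arcsine_integral_bound) (use le in simp)
    qed
  qed
  moreover have "(\<integral>x. (\<Sum>n. ?f n x) \<partial>arcsine) = (\<integral>x. cheb_kernel c x y * T m x \<partial>arcsine)"
  proof (rule Bochner_Integration.integral_cong)
    fix x assume "x \<in> space arcsine"
    then have "summable (\<lambda>n. c n * T n x * T n y)"
      using summable_kern[OF c _ y, of x] by (auto intro: summable_rabs_cancel)
    then show "(\<Sum>n. ?f n x) = cheb_kernel c x y * T m x"
      unfolding cheb_kernel_def by (rule suminf_mult2[symmetric])
  qed simp
  moreover have "(\<integral>x. ?f n x \<partial>arcsine) = (if n = m then (if m = 0 then 1 else 1/2) * c m * T m y else 0)" for n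
  proof -
    have "(\<integral>x. ?f n x \<partial>arcsine) = (\<integral>x. (c n * T n y) * (T n x * T m x) \<partial>arcsine)"
      by (simp add: mult_ac)
    also have "\<dots> = c n * T n y * (\<integral>x. T n x * T m x \<partial>arcsine)" by (rule integral_mult_right_zero)
    finally show ?thesis by (auto simp: integral_T_T)
  qed
  ultimately have "(\<lambda>n. if n = m then (if m = 0 then 1 else 1/2) * c m * T m y else 0) sums
      (\<integral>x. cheb_kernel c x y * T m x \<partial>arcsine)" by simp
  then show ?thesis using sums_single[of m "\<lambda>_. (if m = 0 then 1 else 1/2) * c m * T m y"] sums_unique2 by blast
qed

lemma norm_one_minus_rcis: "(cmod (1 - rcis r t))\<^sup>2 = 1 - 2 * r * cos t + r\<^sup>2"
proof -
  have "(cmod (1 - rcis r t))\<^sup>2 = (1 - r * cos t)\<^sup>2 + (r * sin t)\<^sup>2"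
    by (simp add: cmod_power2)
  also have "\<dots> = 1 - 2 * r * cos t + r\<^sup>2 * ((cos t)\<^sup>2 + (sin t)\<^sup>2)"
    by algebra
  finally show ?thesis by simp
qed

text \<open>A lower bound that does not depend on \<open>r\<close>: it dominates the Abel means as \<open>r\<close> tends to 1.\<close>

lemma norm_one_minus_rcis_ge:
  assumes "1/2 \<le> r"
  shows "1 - cos t \<le> (cmod (1 - rcis r t))\<^sup>2"
proof -
  have "1 * (1 - cos t) \<le> 2 * r * (1 - cos t)"
    using assms by (intro mult_right_mono) auto
  also have "\<dots> \<le> (1 - r)\<^sup>2 + 2 * r * (1 - cos t)" by simp
  also have "\<dots> = (cmod (1 - rcis r t))\<^sup>2"
    unfolding norm_one_minus_rcis by (simp add: power2_eq_square algebra_simps)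
  finally show ?thesis by simp
qed

text \<open>This factorization links functions of \<open>t - s\<close> and \<open>t + s\<close> to the difference of the points
  \<open>2 cos t\<close> and \<open>2 cos s\<close>.\<close>

lemma one_minus_cos_mult:
  fixes t s :: real
  shows "(1 - cos (t - s)) * (1 - cos (t + s)) = (cos t - cos s)\<^sup>2"
proof -
  have "(1 - cos (t - s)) * (1 - cos (t + s)) = 1 - 2 * cos t * cos s + (cos t * cos s)\<^sup>2 - (sin t)\<^sup>2 * (sin s)\<^sup>2"
    by (simp add: cos_diff cos_add power2_eq_square algebra_simps)
  also have "\<dots> = (cos t - cos s)\<^sup>2"
    using sin_squared_eq[of t] sin_squared_eq[of s] by algebra
  finally show ?thesis .
qed

section \<open>The logarithmic kernel\<close>

text \<open>The Abel regularization of the expansion of \<open>ln \<bar>x - y\<bar>\<close>, whose coefficients are \<open>- 2 / n\<close> for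
  \<open>n > 0\<close>. The coefficient at \<open>n = 0\<close> is 0, as it should be, because division by 0 gives 0.\<close>

definition log_coeff :: "real \<Rightarrow> nat \<Rightarrow> real" where
  "log_coeff r n = - (2 * r ^ n / n)"

lemma log_coeff_0 [simp]: "log_coeff r 0 = 0"
  by (simp add: log_coeff_def)

lemma summable_log_coeff:
  assumes "0 \<le> r" "r < 1"
  shows "summable (\<lambda>n. \<bar>log_coeff r n\<bar>)"
proof (rule summable_comparison_test')
  show "summable (\<lambda>n. 2 * r ^ n)" using assms by (intro summable_mult summable_geometric) auto
  show "norm \<bar>log_coeff r n\<bar> \<le> 2 * r ^ n" for n
    using assms mult_right_mono[of 1 "real n" "r ^ n"]
    by (cases "n = 0") (auto simp: log_coeff_def field_simps)
qed

text \<open>Since \<open>2 cos (n t) cos (n s) = cos (n (t - s)) + cos (n (t + s))\<close>, the kernel is a sum of two real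
  parts of the logarithmic series at \<open>r cis (t - s)\<close> and \<open>r cis (t + s)\<close>.\<close>

lemma log_kern_eq:
  assumes r: "0 \<le> r" "r < 1"
  shows "cheb_kernel (log_coeff r) (2 * cos t) (2 * cos s) =
    ln (cmod (1 - rcis r (t - s)) * cmod (1 - rcis r (t + s)))"
proof -
  have pos: "1 - rcis r t \<noteq> 0" for t
  proof
    assume "1 - rcis r t = 0"
    then have "cmod (rcis r t) = 1" by simp
    then show False using r by simp
  qed
  have s: "(\<lambda>n. - (r ^ n * cos (n * t) / n)) sums ln (cmod (1 - rcis r t))" for t :: real
  proof -
    have "(\<lambda>n. - ((- (- rcis r t)) ^ n) / of_nat n) sums ln (1 + (- rcis r t))"
      using r by (intro Ln_series') simp
    then have "(\<lambda>n. Re (- ((- (- rcis r t)) ^ n) / of_nat n)) sums Re (ln (1 + (- rcis r t)))"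
      by (rule sums_Re)
    moreover have eq: "Re (- ((- (- rcis r t)) ^ n) / of_nat n) = - (r ^ n * cos (n * t) / n)" for n
      by (simp add: DeMoivre2 Re_divide_of_nat)
    ultimately show ?thesis unfolding eq using pos[of t] by simp
  qed
  have "(\<lambda>n. - (r ^ n * cos (n * (t - s)) / n) + - (r ^ n * cos (n * (t + s)) / n)) sums
     (ln (cmod (1 - rcis r (t - s))) + ln (cmod (1 - rcis r (t + s))))"
    by (intro sums_add s)
  moreover have "- (r ^ n * cos (n * (t - s)) / n) + - (r ^ n * cos (n * (t + s)) / n)
    = log_coeff r n * T n (2 * cos t) * T n (2 * cos s)" for n
    unfolding T_cos log_coeff_def
    by (simp add: cos_diff cos_add distrib_left right_diff_distrib add_divide_distrib diff_divide_distrib)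
  ultimately have "cheb_kernel (log_coeff r) (2 * cos t) (2 * cos s) =
     ln (cmod (1 - rcis r (t - s))) + ln (cmod (1 - rcis r (t + s)))"
    unfolding cheb_kernel_def by (simp add: sums_iff)
  then show ?thesis using pos by (simp add: ln_mult)
qed

text \<open>Radii tending to 1 from below. They start at \<open>1/2\<close>, where the uniform lower bound for
  \<open>1 - rcis r t\<close> begins to hold.\<close>

definition radius :: "nat \<Rightarrow> real" where "radius k = 1 - 1 / (k + 2)"

lemma radius: "1/2 \<le> radius k" "0 \<le> radius k" "radius k < 1"
  by (auto simp: radius_def field_simps)

lemma radius_tendsto: "radius \<longlonglongrightarrow> 1"
proof -
  have "(\<lambda>k. 1 - 1 / real (k + 2)) \<longlonglongrightarrow> 1 - 0"
    by (intro tendsto_diff tendsto_const LIMSEQ_ignore_initial_segment[OF lim_1_over_n])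
  then show ?thesis by (simp add: radius_def[abs_def] add.commute)
qed

lemma norm_prod_eq:
  "cmod (1 - rcis 1 (t - s)) * cmod (1 - rcis 1 (t + s)) = \<bar>2 * cos t - 2 * cos s\<bar>"
proof (rule power2_eq_imp_eq)
  have "(cmod (1 - rcis 1 (t - s)) * cmod (1 - rcis 1 (t + s)))\<^sup>2 = 4 * ((1 - cos (t - s)) * (1 - cos (t + s)))"
    unfolding power_mult_distrib norm_one_minus_rcis by (simp add: algebra_simps)
  also have "\<dots> = (2 * cos t - 2 * cos s)\<^sup>2"
    unfolding one_minus_cos_mult by (simp add: power2_eq_square algebra_simps)
  finally show "(cmod (1 - rcis 1 (t - s)) * cmod (1 - rcis 1 (t + s)))\<^sup>2 = \<bar>2 * cos t - 2 * cos s\<bar>\<^sup>2"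
    by simp
qed auto

lemma log_kern_tendsto:
  assumes "x \<in> I" "y \<in> I" "x \<noteq> y"
  shows "(\<lambda>k. cheb_kernel (log_coeff (radius k)) x y) \<longlonglongrightarrow> ln \<bar>x - y\<bar>"
proof -
  obtain t s where ts: "x = 2 * cos t" "y = 2 * cos s" using assms by (metis I_cos)
  have "(\<lambda>k. cmod (1 - rcis (radius k) (t - s)) * cmod (1 - rcis (radius k) (t + s))) \<longlonglongrightarrow>
      cmod (1 - rcis 1 (t - s)) * cmod (1 - rcis 1 (t + s))"
    unfolding rcis_def by (intro tendsto_intros radius_tendsto)
  then have "(\<lambda>k. cmod (1 - rcis (radius k) (t - s)) * cmod (1 - rcis (radius k) (t + s))) \<longlonglongrightarrow> \<bar>x - y\<bar>"
    unfolding norm_prod_eq ts .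
  then have "(\<lambda>k. ln (cmod (1 - rcis (radius k) (t - s)) * cmod (1 - rcis (radius k) (t + s)))) \<longlonglongrightarrow> ln \<bar>x - y\<bar>"
    using assms(3) by (intro tendsto_ln) auto
  then show ?thesis unfolding ts by (subst log_kern_eq) (auto simp: radius)
qed

lemma log_kern_bounds:
  assumes "x \<in> I" "y \<in> I" "x \<noteq> y"
  shows "cheb_kernel (log_coeff (radius k)) x y \<le> ln 4" "ln \<bar>x - y\<bar> - ln 2 \<le> cheb_kernel (log_coeff (radius k)) x y"
proof -
  obtain t s where ts: "x = 2 * cos t" "y = 2 * cos s" using assms by (metis I_cos)
  let ?d = "cmod (1 - rcis (radius k) (t - s))" and ?e = "cmod (1 - rcis (radius k) (t + s))"
  have "1/2 * \<bar>x - y\<bar> = \<bar>cos t - cos s\<bar>"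
    unfolding ts by (simp add: abs_if)
  then have "(1/2 * \<bar>x - y\<bar>)\<^sup>2 = (1 - cos (t - s)) * (1 - cos (t + s))"
    unfolding one_minus_cos_mult by simp
  also have "\<dots> \<le> ?d\<^sup>2 * ?e\<^sup>2"
    by (intro mult_mono norm_one_minus_rcis_ge radius) auto
  finally have ge: "1/2 * \<bar>x - y\<bar> \<le> ?d * ?e"
    unfolding power_mult_distrib[symmetric] by (rule power2_le_imp_le) simp
  then have pos: "0 < ?d * ?e" using assms(3) by (simp add: less_le_trans)
  have le: "cmod (1 - rcis (radius k) u) \<le> 2" for u
    using norm_triangle_ineq4[of 1 "rcis (radius k) u"] radius[of k] by simp
  have le4: "?d * ?e \<le> 4" using mult_mono[OF le le, of "t - s" "t + s"] by (simp add: mult.commute)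
  have eq: "cheb_kernel (log_coeff (radius k)) x y = ln (?d * ?e)"
    unfolding ts by (rule log_kern_eq) (auto simp: radius)
  show "cheb_kernel (log_coeff (radius k)) x y \<le> ln 4" unfolding eq using pos le4 by simp
  have "ln (1/2 * \<bar>x - y\<bar>) \<le> ln (?d * ?e)" using ge assms(3) pos by (subst ln_le_cancel_iff) auto
  then show "ln \<bar>x - y\<bar> - ln 2 \<le> cheb_kernel (log_coeff (radius k)) x y"
    unfolding eq using assms(3) by (simp add: ln_div)
qed

lemma ln_dist_le:
  assumes "x \<in> I" "y \<in> I"
  shows "ln \<bar>x - y\<bar> \<le> ln 4"
  using assms by (cases "x = y") (auto intro!: ln_mono)

lemma measurable_kern1: "(\<lambda>x. cheb_kernel c x y) \<in> borel_measurable borel_I"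
  unfolding cheb_kernel_def by measurable

text \<open>By Fatou's lemma. The regularized kernels have integral 0 and are at most \<open>ln 4\<close>, so \<open>ln 4\<close> minus
  the kernel is nonnegative with integral \<open>ln 4\<close>, uniformly in \<open>y\<close>, and both integrability and a
  bound survive the limit. The bound must be uniform in \<open>y\<close> to apply Fubini's theorem to
  arbitrary measures in \<open>y\<close> later on.\<close>

lemma ln_dist_arcsine:
  assumes y: "y \<in> I"
  shows "integrable arcsine (\<lambda>x. ln \<bar>x - y\<bar>)"
    and "(\<integral>x. \<bar>ln \<bar>x - y\<bar>\<bar> \<partial>arcsine) \<le> 2 * ln 4"
proof -
  let ?u = "\<lambda>k x. ln 4 - cheb_kernel (log_coeff (radius k)) x y"
  have int_u: "integrable arcsine (?u k)" and eq_u: "(\<integral>x. ?u k x \<partial>arcsine) = ln 4" for k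
  proof -
    have i: "integrable arcsine (\<lambda>x. cheb_kernel (log_coeff (radius k)) x y)"
      by (intro arcsine_integrable_bounded[where B="\<Sum>n. \<bar>log_coeff (radius k) n\<bar>"] measurable_kern1 abs_kern_le y summable_log_coeff radius)
    then show "integrable arcsine (?u k)" by simp
    have "(\<integral>x. cheb_kernel (log_coeff (radius k)) x y \<partial>arcsine) = 0"
      using kern_moment[OF summable_log_coeff y, of "radius k" 0] radius[of k] log_coeff_0 by simp
    then show "(\<integral>x. ?u k x \<partial>arcsine) = ln 4" using i by (simp add: measure_arcsine)
  qed
  have nn: "AE x in arcsine. 0 \<le> ?u k x" for k
    using AE_arcsine_neq[of y] AE_space by eventually_elim (use log_kern_bounds(1) y in auto)
  have eq: "(\<integral>\<^sup>+x. ennreal (?u k x) \<partial>arcsine) = ln 4" for k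
    using nn_integral_eq_integral[OF int_u nn] eq_u by simp
  have m: "(\<lambda>x. ennreal (?u k x)) \<in> borel_measurable arcsine" for k
    using int_u by auto
  have "(\<integral>\<^sup>+x. ennreal (ln 4 - ln \<bar>x - y\<bar>) \<partial>arcsine) = (\<integral>\<^sup>+x. liminf (\<lambda>k. ennreal (?u k x)) \<partial>arcsine)"
  proof (rule nn_integral_cong_AE)
    show "AE x in arcsine. ennreal (ln 4 - ln \<bar>x - y\<bar>) = liminf (\<lambda>k. ennreal (?u k x))"
      using AE_arcsine_neq[of y] AE_space
    proof eventually_elim
      case (elim x)
      then have "(\<lambda>k. ennreal (?u k x)) \<longlonglongrightarrow> ennreal (ln 4 - ln \<bar>x - y\<bar>)"
        using y by (intro tendsto_ennrealI tendsto_diff tendsto_const log_kern_tendsto) auto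
      then show ?case by (simp add: lim_imp_Liminf)
    qed
  qed
  also have "\<dots> \<le> liminf (\<lambda>k. \<integral>\<^sup>+x. ennreal (?u k x) \<partial>arcsine)"
    by (rule nn_integral_liminf[OF m])
  also have "\<dots> = ln 4" by (simp add: eq Liminf_const)
  finally have le: "(\<integral>\<^sup>+x. ennreal (ln 4 - ln \<bar>x - y\<bar>) \<partial>arcsine) \<le> ln 4" .
  have nn': "AE x in arcsine. 0 \<le> ln 4 - ln \<bar>x - y\<bar>"
    using ln_dist_le[OF _ y] by (intro AE_I2) auto
  have m': "(\<lambda>x. ln 4 - ln \<bar>x - y\<bar>) \<in> borel_measurable arcsine" by measurable
  have i: "integrable arcsine (\<lambda>x. ln 4 - ln \<bar>x - y\<bar>)"
    using m' nn' by (rule integrableI_nonneg) (use le in \<open>auto simp: less_top[symmetric] top_unique\<close>)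
  have "integrable arcsine (\<lambda>x. ln 4 - (ln 4 - ln \<bar>x - y\<bar>))"
    by (intro Bochner_Integration.integrable_diff i) simp
  then show i': "integrable arcsine (\<lambda>x. ln \<bar>x - y\<bar>)" by simp
  have "ennreal (\<integral>x. ln 4 - ln \<bar>x - y\<bar> \<partial>arcsine) \<le> ennreal (ln 4)"
    using le nn_integral_eq_integral[OF i nn'] by simp
  then have b: "(\<integral>x. ln 4 - ln \<bar>x - y\<bar> \<partial>arcsine) \<le> ln 4"
    by (subst (asm) ennreal_le_iff) auto
  have "(\<integral>x. \<bar>ln \<bar>x - y\<bar>\<bar> \<partial>arcsine) \<le> (\<integral>x. (ln 4 - ln \<bar>x - y\<bar>) + ln 4 \<partial>arcsine)"
  proof (rule integral_mono_AE)
    show "AE x in arcsine. \<bar>ln \<bar>x - y\<bar>\<bar> \<le> ln 4 - ln \<bar>x - y\<bar> + ln 4"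
      using nn' by eventually_elim (auto simp: abs_le_iff)
  qed (use i i' in auto)
  also have "\<dots> = (\<integral>x. (ln 4 - ln \<bar>x - y\<bar>) \<partial>arcsine) + ln 4"
    using i by (subst Bochner_Integration.integral_add) (auto simp: measure_arcsine)
  finally show "(\<integral>x. \<bar>ln \<bar>x - y\<bar>\<bar> \<partial>arcsine) \<le> 2 * ln 4" using b by linarith
qed

text \<open>The \<open>T m\<close> are eigenfunctions of the logarithmic potential of the arcsine law, with eigenvalue
  \<open>- 1 / m\<close>, and 0 for \<open>m = 0\<close>, where \<open>/ m\<close> is a division by 0. The point \<open>y\<close> is arbitrary, not
  just almost every point, because a measure in \<open>y\<close> may have atoms.\<close>

lemma ln_dist_moment:
  assumes y: "y \<in> I"
  shows "(\<integral>x. T m x * ln \<bar>x - y\<bar> \<partial>arcsine) = - T m y / m"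
proof -
  let ?k = "\<lambda>k x. cheb_kernel (log_coeff (radius k)) x y * T m x"
  have "(\<lambda>k. \<integral>x. ?k k x \<partial>arcsine) \<longlonglongrightarrow> (\<integral>x. T m x * ln \<bar>x - y\<bar> \<partial>arcsine)"
  proof (rule integral_dominated_convergence[where w="\<lambda>x. \<bar>ln \<bar>x - y\<bar>\<bar> + (ln 4 + ln 2)"])
    show "integrable arcsine (\<lambda>x. \<bar>ln \<bar>x - y\<bar>\<bar> + (ln 4 + ln 2))"
      using ln_dist_arcsine[OF y] by auto
    show "AE x in arcsine. (\<lambda>k. ?k k x) \<longlonglongrightarrow> T m x * ln \<bar>x - y\<bar>"
      using AE_arcsine_neq[of y] AE_space
    proof eventually_elim
      case (elim x)
      then have "(\<lambda>k. ?k k x) \<longlonglongrightarrow> ln \<bar>x - y\<bar> * T m x"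
        using y by (intro tendsto_mult tendsto_const log_kern_tendsto) auto
      then show ?case by (simp add: mult.commute)
    qed
    show "AE x in arcsine. norm (?k k x) \<le> \<bar>ln \<bar>x - y\<bar>\<bar> + (ln 4 + ln 2)" for k
      using AE_arcsine_neq[of y] AE_space
    proof eventually_elim
      case (elim x)
      have "\<bar>cheb_kernel (log_coeff (radius k)) x y\<bar> \<le> \<bar>ln \<bar>x - y\<bar>\<bar> + (ln 4 + ln 2)"
        using log_kern_bounds[of x y k] elim y ln_ge_zero[of 2] ln_ge_zero[of 4]
        unfolding space_arcsine by linarith
      then have "\<bar>cheb_kernel (log_coeff (radius k)) x y\<bar> * \<bar>T m x\<bar> \<le> (\<bar>ln \<bar>x - y\<bar>\<bar> + (ln 4 + ln 2)) * 1"
        using elim by (intro mult_mono abs_T_le) auto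
      then show ?case by (simp add: abs_mult)
    qed
    show "?k k \<in> borel_measurable arcsine" for k
      using measurable_kern1 by (simp cong: measurable_cong_sets)
    show "(\<lambda>x. T m x * ln \<bar>x - y\<bar>) \<in> borel_measurable arcsine" by measurable
  qed
  moreover have "(\<integral>x. ?k k x \<partial>arcsine) = - (radius k ^ m * T m y / m)" for k
    by (subst kern_moment[OF summable_log_coeff y]) (auto simp: radius log_coeff_def)
  moreover have "(\<lambda>k. - (radius k ^ m * T m y / m)) \<longlonglongrightarrow> - (1 ^ m * T m y / m)"
    unfolding divide_inverse by (intro tendsto_intros radius_tendsto)
  ultimately show ?thesis using LIMSEQ_unique by fastforce
qed

lemma log_potential_moment:
  assumes M: "finite_measure M" "sets M = sets borel_I"
  shows "integrable arcsine (\<lambda>x. \<integral>y. ln \<bar>x - y\<bar> \<partial>M)"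
    and "AE x in arcsine. integrable M (\<lambda>y. ln \<bar>x - y\<bar>)"
    and "(\<integral>x. T m x * (\<integral>y. ln \<bar>x - y\<bar> \<partial>M) \<partial>arcsine) = - (\<integral>y. T m y \<partial>M) / m"
proof -
  interpret M: finite_measure M by fact
  interpret P: pair_sigma_finite M arcsine ..
  have sp: "space M = I" using sets_eq_imp_space_eq[OF M(2)] by (simp add: space_restrict_space)
  note [measurable_cong] = M(2)
  have int: "integrable (M \<Otimes>\<^sub>M arcsine) (\<lambda>(y, x). T n x * ln \<bar>x - y\<bar>)" for n
  proof (rule P.Fubini_integrable)
    have "(\<lambda>(y, x). T n x * ln \<bar>x - y\<bar>) \<in> borel_measurable (borel_I \<Otimes>\<^sub>M borel_I)"
      by (rule measurable_borel_I_pair) measurable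
    then show meas: "(\<lambda>(y, x). T n x * ln \<bar>x - y\<bar>) \<in> borel_measurable (M \<Otimes>\<^sub>M arcsine)"
      by (simp cong: measurable_cong_sets)
    have i: "integrable arcsine (\<lambda>x. T n x * ln \<bar>x - y\<bar>)" if "y \<in> I" for y
    proof (rule Bochner_Integration.integrable_bound[OF ln_dist_arcsine(1)[OF that]])
      show "AE x in arcsine. norm (T n x * ln \<bar>x - y\<bar>) \<le> norm (ln \<bar>x - y\<bar>)"
        using abs_T_le by (intro AE_I2) (auto simp: abs_mult intro: mult_left_le_one_le)
    qed measurable
    then show "AE y in M. integrable arcsine (\<lambda>x. case (y, x) of (y, x) \<Rightarrow> T n x * ln \<bar>x - y\<bar>)"
      by (intro AE_I2) (simp add: sp)
    show "integrable M (\<lambda>y. \<integral>x. norm (case (y, x) of (y, x) \<Rightarrow> T n x * ln \<bar>x - y\<bar>) \<partial>arcsine)"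
    proof (rule M.integrable_const_bound[where B="2 * ln 4"])
      show "(\<lambda>y. \<integral>x. norm (case (y, x) of (y, x) \<Rightarrow> T n x * ln \<bar>x - y\<bar>) \<partial>arcsine) \<in> borel_measurable M"
        using measurable_compose[OF meas borel_measurable_norm]
        by (intro arcsine.borel_measurable_lebesgue_integral) (simp add: case_prod_beta')
      have "\<bar>\<integral>x. \<bar>T n x * ln \<bar>x - y\<bar>\<bar> \<partial>arcsine\<bar> \<le> 2 * ln 4" if y: "y \<in> I" for y
      proof -
        have "(\<integral>x. \<bar>T n x * ln \<bar>x - y\<bar>\<bar> \<partial>arcsine) \<le> (\<integral>x. \<bar>ln \<bar>x - y\<bar>\<bar> \<partial>arcsine)"
        proof (rule integral_mono)
          show "integrable arcsine (\<lambda>x. \<bar>T n x * ln \<bar>x - y\<bar>\<bar>)"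
            by (rule integrable_abs[OF i[OF y]])
          show "integrable arcsine (\<lambda>x. \<bar>ln \<bar>x - y\<bar>\<bar>)"
            by (rule integrable_abs[OF ln_dist_arcsine(1)[OF y]])
        qed (use abs_T_le in \<open>auto simp: abs_mult intro: mult_left_le_one_le\<close>)
        also have "\<dots> \<le> 2 * ln 4" by (rule ln_dist_arcsine(2)[OF y])
        finally show ?thesis by simp
      qed
      then show "AE y in M. norm (\<integral>x. norm (case (y, x) of (y, x) \<Rightarrow> T n x * ln \<bar>x - y\<bar>) \<partial>arcsine) \<le> 2 * ln 4"
        by (intro AE_I2) (simp add: sp)
    qed
  qed
  show "integrable arcsine (\<lambda>x. \<integral>y. ln \<bar>x - y\<bar> \<partial>M)"
    using P.integrable_snd[OF int[of 0]] by simp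
  show "AE x in arcsine. integrable M (\<lambda>y. ln \<bar>x - y\<bar>)"
    using P.AE_integrable_snd[OF int[of 0]] by simp
  have "(\<integral>x. T m x * (\<integral>y. ln \<bar>x - y\<bar> \<partial>M) \<partial>arcsine) = (\<integral>x. \<integral>y. T m x * ln \<bar>x - y\<bar> \<partial>M \<partial>arcsine)"
    by simp
  also have "\<dots> = (\<integral>y. \<integral>x. T m x * ln \<bar>x - y\<bar> \<partial>arcsine \<partial>M)"
    by (rule P.Fubini_integral[OF int])
  also have "\<dots> = (\<integral>y. - T m y / m \<partial>M)"
    by (intro Bochner_Integration.integral_cong) (auto simp: sp ln_dist_moment)
  finally show "(\<integral>x. T m x * (\<integral>y. ln \<bar>x - y\<bar> \<partial>M) \<partial>arcsine) = - (\<integral>y. T m y \<partial>M) / m"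
    by simp
qed

section \<open>The measure \<omega> and its quadratic form\<close>

interpretation arcsine_pair: pair_sigma_finite arcsine arcsine ..

interpretation arcsine_prod: finite_measure "arcsine \<Otimes>\<^sub>M arcsine"
  by (rule finite_measure_pair_measure) (rule arcsine.finite_measure_axioms)+

lemma space_arcsine_prod [simp]: "space (arcsine \<Otimes>\<^sub>M arcsine) = I \<times> I"
  by (simp add: space_pair_measure)

lemma sets_eq_if_id_measurable:
  assumes "(\<lambda>x. x) \<in> M \<rightarrow>\<^sub>M N" "(\<lambda>x. x) \<in> N \<rightarrow>\<^sub>M M"
  shows "sets M = sets N"
proof -
  have sp: "space M = space N"
    using assms[THEN measurable_space] by auto
  have "A \<in> sets N" if "A \<in> sets M" for A
    using measurable_sets[OF assms(2) that] sets.sets_into_space[OF that] sp by (simp add: Int_absorb2)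
  moreover have "A \<in> sets M" if "A \<in> sets N" for A
    using measurable_sets[OF assms(1) that] sets.sets_into_space[OF that] sp by (simp add: Int_absorb2)
  ultimately show ?thesis by blast
qed

lemma sets_restrict_space_pair:
  "sets (restrict_space M A \<Otimes>\<^sub>M restrict_space N B) = sets (restrict_space (M \<Otimes>\<^sub>M N) (A \<times> B))"
proof (rule sets_eq_if_id_measurable)
  have "(\<lambda>x. x) \<in> restrict_space M A \<rightarrow>\<^sub>M M" "(\<lambda>x. x) \<in> restrict_space N B \<rightarrow>\<^sub>M N"
    by (rule measurable_restrict_space1, simp)+
  then have "(\<lambda>p. (fst p, snd p)) \<in> restrict_space M A \<Otimes>\<^sub>M restrict_space N B \<rightarrow>\<^sub>M M \<Otimes>\<^sub>M N"
    by (intro measurable_Pair measurable_compose[OF measurable_fst] measurable_compose[OF measurable_snd])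
  then show "(\<lambda>x. x) \<in> restrict_space M A \<Otimes>\<^sub>M restrict_space N B \<rightarrow>\<^sub>M restrict_space (M \<Otimes>\<^sub>M N) (A \<times> B)"
    by (intro measurable_restrict_space2) (auto simp: space_pair_measure space_restrict_space)
  have "(\<lambda>p. (fst p, snd p)) \<in> restrict_space (M \<Otimes>\<^sub>M N) (A \<times> B) \<rightarrow>\<^sub>M restrict_space M A \<Otimes>\<^sub>M restrict_space N B"
    by (intro measurable_Pair measurable_restrict_space2 measurable_restrict_space1 measurable_fst measurable_snd)
       (auto simp: space_pair_measure space_restrict_space)
  then show "(\<lambda>x. x) \<in> restrict_space (M \<Otimes>\<^sub>M N) (A \<times> B) \<rightarrow>\<^sub>M restrict_space M A \<Otimes>\<^sub>M restrict_space N B"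
    by simp
qed

text \<open>The product of the two arcsine densities contains the factor \<open>1 / (pi\<^sup>2 * sqrt ((4 - x\<^sup>2) * (4 - y\<^sup>2)))\<close>
  of the density of \<open>\<omega>\<close>.\<close>

lemma omega_eq_density:
  "omega = density (arcsine \<Otimes>\<^sub>M arcsine) (\<lambda>(x, y). ennreal ((4 - x * y) / 4))"
proof -
  let ?L = "restrict_space lborel I" and ?w = "\<lambda>x::real. 1 / (pi * sqrt (4 - x\<^sup>2))"
  have sL: "sets ?L = sets borel_I" by (rule sets_restrict_space_cong) simp
  have fin: "finite_measure ?L"
    by (rule finite_measureI) (simp add: space_restrict_space emeasure_restrict_space)
  interpret L: finite_measure ?L by (rule fin)
  have pair: "?L \<Otimes>\<^sub>M ?L = restrict_space lborel (I \<times> I)"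
  proof (rule pair_measure_eqI)
    show "sigma_finite_measure ?L" "sigma_finite_measure ?L" by unfold_locales
    show "sets (?L \<Otimes>\<^sub>M ?L) = sets (restrict_space lborel (I \<times> I))"
      unfolding sets_restrict_space_pair lborel_prod ..
    fix A B assume AB: "A \<in> sets ?L" "B \<in> sets ?L"
    then have AB': "A \<subseteq> I" "B \<subseteq> I" "A \<in> sets lborel" "B \<in> sets lborel"
      by (auto simp: sets_restrict_space_iff)
    have "emeasure (restrict_space lborel (I \<times> I)) (A \<times> B) = emeasure (lborel \<Otimes>\<^sub>M lborel) (A \<times> B)"
      unfolding lborel_prod using AB' by (intro emeasure_restrict_space) (auto intro: borel_closed closed_Times)
    also have "\<dots> = emeasure lborel A * emeasure lborel B"
      using AB' by (intro lborel.emeasure_pair_measure_Times) auto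
    also have "\<dots> = emeasure ?L A * emeasure ?L B"
      using AB' by (simp add: emeasure_restrict_space)
    finally show "emeasure ?L A * emeasure ?L B = emeasure (restrict_space lborel (I \<times> I)) (A \<times> B)" ..
  qed
  have mw: "(\<lambda>x. ennreal (?w x)) \<in> borel_measurable ?L"
    by (intro measurable_restrict_space1) simp
  have sf: "sigma_finite_measure (density ?L (\<lambda>x. ennreal (?w x)))"
    using arcsine.sigma_finite_measure_axioms by (simp add: arcsine_def)
  have "arcsine \<Otimes>\<^sub>M arcsine = density (?L \<Otimes>\<^sub>M ?L) (\<lambda>(x, y). ennreal (?w x) * ennreal (?w y))"
    unfolding arcsine_def using mw mw L.sigma_finite_measure_axioms sf by (rule pair_measure_density)
  moreover have m1: "(\<lambda>(x, y). ennreal (?w x) * ennreal (?w y)) \<in> borel_measurable (?L \<Otimes>\<^sub>M ?L)"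
    using mw by measurable
  moreover have m2: "(\<lambda>(x, y). ennreal ((4 - x * y) / 4)) \<in> borel_measurable (?L \<Otimes>\<^sub>M ?L)"
  proof -
    have "(\<lambda>(x, y). ennreal ((4 - x * y) / 4)) \<in> borel_measurable (borel_I \<Otimes>\<^sub>M borel_I)"
      by (rule measurable_borel_I_pair) measurable
    then show ?thesis by (simp cong: measurable_cong_sets add: sL sets_pair_measure_cong[OF sL sL])
  qed
  ultimately have "density (arcsine \<Otimes>\<^sub>M arcsine) (\<lambda>(x, y). ennreal ((4 - x * y) / 4)) =
     density (?L \<Otimes>\<^sub>M ?L) (\<lambda>p. (case p of (x, y) \<Rightarrow> ennreal (?w x) * ennreal (?w y)) * (case p of (x, y) \<Rightarrow> ennreal ((4 - x * y) / 4)))"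
    by (simp add: density_density_eq)
  also have "\<dots> = density (?L \<Otimes>\<^sub>M ?L) (\<lambda>(x, y). ennreal ((4 - x * y) / (4 * pi\<^sup>2 * sqrt ((4 - x\<^sup>2) * (4 - y\<^sup>2)))))"
  proof (rule density_cong)
    show "AE p in ?L \<Otimes>\<^sub>M ?L. (case p of (x, y) \<Rightarrow> ennreal (?w x) * ennreal (?w y)) * (case p of (x, y) \<Rightarrow> ennreal ((4 - x * y) / 4)) =
      (case p of (x, y) \<Rightarrow> ennreal ((4 - x * y) / (4 * pi\<^sup>2 * sqrt ((4 - x\<^sup>2) * (4 - y\<^sup>2)))))"
    proof (rule AE_I2, clarify)
      fix x y assume "(x, y) \<in> space (?L \<Otimes>\<^sub>M ?L)"
      then have xy: "x \<in> I" "y \<in> I" by (auto simp: space_pair_measure space_restrict_space)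
      show "ennreal (?w x) * ennreal (?w y) * ennreal ((4 - x * y) / 4) =
        ennreal ((4 - x * y) / (4 * pi\<^sup>2 * sqrt ((4 - x\<^sup>2) * (4 - y\<^sup>2))))"
        unfolding ennreal_mult'[OF weight_nonneg[OF xy(1)], symmetric]
          ennreal_mult'[OF mult_nonneg_nonneg[OF weight_nonneg[OF xy(1)] weight_nonneg[OF xy(2)]], symmetric]
        by (simp add: real_sqrt_mult power2_eq_square mult_ac)
    qed
    show "(\<lambda>(x, y). ennreal ((4 - x * y) / (4 * pi\<^sup>2 * sqrt ((4 - x\<^sup>2) * (4 - y\<^sup>2))))) \<in> borel_measurable (?L \<Otimes>\<^sub>M ?L)"
    proof -
      have "(\<lambda>(x, y). ennreal ((4 - x * y) / (4 * pi\<^sup>2 * sqrt ((4 - x\<^sup>2) * (4 - y\<^sup>2))))) \<in> borel_measurable (borel_I \<Otimes>\<^sub>M borel_I)"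
        by (rule measurable_borel_I_pair) measurable
      then show ?thesis by (simp cong: measurable_cong_sets add: sL sets_pair_measure_cong[OF sL sL])
    qed
    show "(\<lambda>p. (case p of (x, y) \<Rightarrow> ennreal (?w x) * ennreal (?w y)) * (case p of (x, y) \<Rightarrow> ennreal ((4 - x * y) / 4))) \<in> borel_measurable (?L \<Otimes>\<^sub>M ?L)"
      using m1 m2 by (rule borel_measurable_times_ennreal)
  qed
  finally show ?thesis unfolding pair omega_def ..
qed

lemma omega_weight_nonneg: "x \<in> I \<Longrightarrow> y \<in> I \<Longrightarrow> 0 \<le> (4 - x * y :: real) \<and> 4 - x * y \<le> 8"
proof -
  assume "x \<in> I" "y \<in> I"
  then have "\<bar>x\<bar> * \<bar>y\<bar> \<le> 2 * 2" by (intro mult_mono) auto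
  then have "\<bar>x * y\<bar> \<le> 4" by (simp add: abs_mult)
  then show "0 \<le> 4 - x * y \<and> 4 - x * y \<le> 8" by linarith
qed

lemma borel_measurable_arcsine_prod:
  "borel_measurable (arcsine \<Otimes>\<^sub>M arcsine) = borel_measurable (borel_I \<Otimes>\<^sub>M borel_I)"
  by (intro measurable_cong_sets sets_pair_measure_cong) auto

lemma omega_integral:
  fixes f :: "real \<times> real \<Rightarrow> real"
  assumes "f \<in> borel_measurable (borel_I \<Otimes>\<^sub>M borel_I)"
  shows "integrable omega f \<longleftrightarrow> integrable (arcsine \<Otimes>\<^sub>M arcsine) (\<lambda>(x, y). (4 - x * y) / 4 * f (x, y))"
    and "(\<integral>p. f p \<partial>omega) = (\<integral>(x, y). (4 - x * y) / 4 * f (x, y) \<partial>(arcsine \<Otimes>\<^sub>M arcsine))"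
proof -
  let ?g = "\<lambda>(x, y). (4 - x * y) / 4 :: real"
  have d: "omega = density (arcsine \<Otimes>\<^sub>M arcsine) (\<lambda>p. ennreal (?g p))"
    unfolding omega_eq_density by (simp add: case_prod_beta')
  have g: "?g \<in> borel_measurable (arcsine \<Otimes>\<^sub>M arcsine)"
    unfolding borel_measurable_arcsine_prod by (rule measurable_borel_I_pair) measurable
  have f: "f \<in> borel_measurable (arcsine \<Otimes>\<^sub>M arcsine)"
    unfolding borel_measurable_arcsine_prod by fact
  have nn: "AE p in arcsine \<Otimes>\<^sub>M arcsine. 0 \<le> ?g p"
    using omega_weight_nonneg by (intro AE_I2) auto
  show "integrable omega f \<longleftrightarrow> integrable (arcsine \<Otimes>\<^sub>M arcsine) (\<lambda>(x, y). (4 - x * y) / 4 * f (x, y))"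
    unfolding d integrable_density[OF f g nn] by (simp add: case_prod_beta')
  show "(\<integral>p. f p \<partial>omega) = (\<integral>(x, y). (4 - x * y) / 4 * f (x, y) \<partial>(arcsine \<Otimes>\<^sub>M arcsine))"
    unfolding d integral_density[OF f g nn] by (simp add: case_prod_beta')
qed

lemma AE_arcsine_prod_neq: "AE p in arcsine \<Otimes>\<^sub>M arcsine. fst p \<noteq> snd p"
proof (rule arcsine_pair.AE_pair_measure)
  have m: "(\<lambda>p. if fst p \<noteq> snd p then 1 else 0::real) \<in> borel_measurable (arcsine \<Otimes>\<^sub>M arcsine)"
    unfolding borel_measurable_arcsine_prod by (rule measurable_borel_I_pair) measurable
  have "{p \<in> space (arcsine \<Otimes>\<^sub>M arcsine). fst p \<noteq> snd p} =
    (\<lambda>p. if fst p \<noteq> snd p then 1 else 0::real) -` {1} \<inter> space (arcsine \<Otimes>\<^sub>M arcsine)" by auto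
  then show "{p \<in> space (arcsine \<Otimes>\<^sub>M arcsine). fst p \<noteq> snd p} \<in> sets (arcsine \<Otimes>\<^sub>M arcsine)"
    using measurable_sets[OF m, of "{1}"] by simp
  show "AE x in arcsine. AE y in arcsine. fst (x, y) \<noteq> snd (x, y)"
  proof (rule AE_I2)
    fix x show "AE y in arcsine. fst (x, y) \<noteq> snd (x, y)"
      using AE_arcsine_neq[of x] by eventually_elim auto
  qed
qed

text \<open>Differentiating the logarithmic kernel twice in one of the two angles produces, up to a factor,
  the divergent expansion with coefficients \<open>n\<close>. Its Abel means converge to \<open>- (4 - x * y) / (2 * (x - y)\<^sup>2)\<close> off the diagonal,
  a multiple of the weight of \<open>\<omega>\<close>, relative to the product of the arcsine laws, divided by
  \<open>(x - y)\<^sup>2\<close>.\<close>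

definition sq_coeff :: "real \<Rightarrow> nat \<Rightarrow> real" where
  "sq_coeff r n = n * r ^ n"

lemma sums_sq_coeff:
  fixes z :: "'a :: {real_normed_field, banach}"
  assumes "norm z < 1"
  shows "(\<lambda>n. of_nat n * z ^ n) sums (z / (1 - z)\<^sup>2)"
proof -
  have "(\<lambda>n. z * (of_nat (Suc n) * z ^ n)) sums (z * (1 / (1 - z)\<^sup>2))"
    by (intro sums_mult geometric_deriv_sums assms)
  then have "(\<lambda>n. of_nat (Suc n) * z ^ Suc n) sums (z / (1 - z)\<^sup>2)"
    by (simp add: mult_ac)
  then show ?thesis by (subst (asm) sums_Suc_iff) simp
qed

lemma summable_sq_coeff:
  assumes "0 \<le> r" "r < 1"
  shows "summable (\<lambda>n. \<bar>sq_coeff r n\<bar>)"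
  using sums_sq_coeff[of r] assms by (auto simp: sq_coeff_def sums_iff abs_mult)

text \<open>The real part of the Koebe function \<open>z / (1 - z)\<^sup>2\<close>, the sum of \<open>n * z ^ n\<close>.\<close>

definition sq_re :: "real \<Rightarrow> real \<Rightarrow> real" where
  "sq_re r t = Re (rcis r t / (1 - rcis r t)\<^sup>2)"

lemma sq_kern_eq:
  assumes r: "0 \<le> r" "r < 1"
  shows "cheb_kernel (sq_coeff r) (2 * cos t) (2 * cos s) = (sq_re r (t - s) + sq_re r (t + s)) / 2"
proof -
  have s: "(\<lambda>n. n * r ^ n * cos (n * t)) sums sq_re r t" for t :: real
  proof -
    have "(\<lambda>n. Re (of_nat n * rcis r t ^ n)) sums sq_re r t"
      unfolding sq_re_def using r by (intro sums_Re sums_sq_coeff) simp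
    moreover have eq: "Re (of_nat n * rcis r t ^ n) = n * r ^ n * cos (n * t)" for n
      by (simp add: DeMoivre2 mult.assoc)
    ultimately show ?thesis unfolding eq by simp
  qed
  have "(\<lambda>n. (n * r ^ n * cos (n * (t - s)) + n * r ^ n * cos (n * (t + s))) / 2) sums
     ((sq_re r (t - s) + sq_re r (t + s)) / 2)"
    by (intro sums_divide sums_add s)
  moreover have "(n * r ^ n * cos (n * (t - s)) + n * r ^ n * cos (n * (t + s))) / 2
    = sq_coeff r n * T n (2 * cos t) * T n (2 * cos s)" for n
    unfolding T_cos sq_coeff_def
    by (simp add: cos_diff cos_add distrib_left right_diff_distrib)
  ultimately show ?thesis
    unfolding cheb_kernel_def by (simp add: sums_iff)
qed

lemma abs_sq_re_le:
  assumes r: "1/2 \<le> r" "r < 1" and t: "cos t \<noteq> 1"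
  shows "\<bar>sq_re r t\<bar> \<le> 1 / (1 - cos t)"
proof -
  have pos: "0 < 1 - cos t" using t cos_le_one[of t] by linarith
  have "\<bar>sq_re r t\<bar> \<le> cmod (rcis r t / (1 - rcis r t)\<^sup>2)"
    unfolding sq_re_def by (rule abs_Re_le_cmod)
  also have "\<dots> = \<bar>r\<bar> / (cmod (1 - rcis r t))\<^sup>2"
    by (simp add: norm_divide norm_power)
  also have "\<dots> \<le> 1 / (1 - cos t)"
    using r pos norm_one_minus_rcis_ge[OF r(1), of t] by (intro frac_le) auto
  finally show ?thesis .
qed

lemma sq_re_1:
  assumes t: "cos t \<noteq> 1"
  shows "sq_re 1 t = - (1 / (2 * (1 - cos t)))"
proof -
  have "(1 - cis t)\<^sup>2 = cis t * complex_of_real (2 * cos t - 2)"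
  proof -
    have "(1 - cis t)\<^sup>2 = cis t * (cis (- t) + cis t - 2)"
      by (simp add: power2_eq_square algebra_simps cis_mult)
    also have "cis (- t) + cis t - 2 = complex_of_real (2 * cos t - 2)"
      by (simp add: complex_eq_iff)
    finally show ?thesis .
  qed
  then have "rcis 1 t / (1 - rcis 1 t)\<^sup>2 = complex_of_real (1 / (2 * cos t - 2))"
    by (simp add: rcis_def)
  then have "sq_re 1 t = 1 / (2 * cos t - 2)" unfolding sq_re_def by (metis Re_complex_of_real)
  also have "\<dots> = - (1 / (2 * (1 - cos t)))" using t by (simp add: field_simps)
  finally show ?thesis .
qed

lemma sum_inverse_one_minus_cos:
  fixes t s :: real
  assumes "2 * cos t \<noteq> 2 * cos s"
  shows "1 / (1 - cos (t - s)) + 1 / (1 - cos (t + s)) =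
     2 * (4 - (2 * cos t) * (2 * cos s)) / (2 * cos t - 2 * cos s)\<^sup>2"
    and "cos (t - s) \<noteq> 1" "cos (t + s) \<noteq> 1"
proof -
  have ne: "(1 - cos (t - s)) * (1 - cos (t + s)) \<noteq> 0"
    unfolding one_minus_cos_mult using assms by simp
  then show "cos (t - s) \<noteq> 1" "cos (t + s) \<noteq> 1" by auto
  then have "1 / (1 - cos (t - s)) + 1 / (1 - cos (t + s)) =
    ((1 - cos (t + s)) + (1 - cos (t - s))) / ((1 - cos (t - s)) * (1 - cos (t + s)))"
    by (simp add: add_divide_distrib[symmetric] field_simps)
  also have "\<dots> = (2 - 2 * cos t * cos s) / (cos t - cos s)\<^sup>2"
    unfolding one_minus_cos_mult by (simp add: cos_add cos_diff)
  also have "\<dots> = (4 * (2 - 2 * cos t * cos s)) / (4 * (cos t - cos s)\<^sup>2)"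
    by (rule mult_divide_mult_cancel_left[symmetric]) simp
  also have "4 * (cos t - cos s)\<^sup>2 = (2 * cos t - 2 * cos s)\<^sup>2" by (simp add: power2_eq_square algebra_simps)
  finally show "1 / (1 - cos (t - s)) + 1 / (1 - cos (t + s)) =
     2 * (4 - (2 * cos t) * (2 * cos s)) / (2 * cos t - 2 * cos s)\<^sup>2" by (simp add: algebra_simps)
qed

lemma sq_kern_tendsto:
  assumes "x \<in> I" "y \<in> I" "x \<noteq> y"
  shows "(\<lambda>k. cheb_kernel (sq_coeff (radius k)) x y) \<longlonglongrightarrow> - ((4 - x * y) / (2 * (x - y)\<^sup>2))"
proof -
  obtain t s where ts: "x = 2 * cos t" "y = 2 * cos s" using assms by (metis I_cos)
  have ne: "2 * cos t \<noteq> 2 * cos s" using assms(3) unfolding ts .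
  have lim: "(\<lambda>k. sq_re (radius k) u) \<longlonglongrightarrow> sq_re 1 u" if "cos u \<noteq> 1" for u
  proof -
    have "rcis 1 u \<noteq> 1" using that by (auto simp: complex_eq_iff)
    then show ?thesis unfolding sq_re_def rcis_def
      by (intro tendsto_intros radius_tendsto) (auto simp: rcis_def)
  qed
  have half: "(- (1 / (2 * p)) + - (1 / (2 * q))) / 2 = - (1 / p + 1 / q) / 4" for p q :: real
    by (cases "p = 0"; cases "q = 0") (simp_all add: field_simps)
  have "(\<lambda>k. (sq_re (radius k) (t - s) + sq_re (radius k) (t + s)) / 2) \<longlonglongrightarrow> (sq_re 1 (t - s) + sq_re 1 (t + s)) / 2"
    by (intro tendsto_intros lim sum_inverse_one_minus_cos[OF ne]) simp
  also have "(sq_re 1 (t - s) + sq_re 1 (t + s)) / 2 = - (1 / (1 - cos (t - s)) + 1 / (1 - cos (t + s))) / 4"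
    unfolding sq_re_1[OF sum_inverse_one_minus_cos(2)[OF ne]] sq_re_1[OF sum_inverse_one_minus_cos(3)[OF ne]]
    by (rule half)
  also have "\<dots> = - ((4 - x * y) / (2 * (x - y)\<^sup>2))"
  proof -
    have "- (2 * a / b) / 4 = - (a / (2 * b))" for a b :: real by simp
    then show ?thesis unfolding sum_inverse_one_minus_cos(1)[OF ne] ts by blast
  qed
  finally show ?thesis unfolding ts by (subst sq_kern_eq) (auto simp: radius)
qed

lemma abs_sq_kern_le:
  assumes "x \<in> I" "y \<in> I" "x \<noteq> y"
  shows "\<bar>cheb_kernel (sq_coeff (radius k)) x y\<bar> \<le> (4 - x * y) / (x - y)\<^sup>2"
proof -
  obtain t s where ts: "x = 2 * cos t" "y = 2 * cos s" using assms by (metis I_cos)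
  have ne: "2 * cos t \<noteq> 2 * cos s" using assms(3) unfolding ts .
  have "\<bar>cheb_kernel (sq_coeff (radius k)) x y\<bar> = \<bar>sq_re (radius k) (t - s) + sq_re (radius k) (t + s)\<bar> / 2"
    unfolding ts by (subst sq_kern_eq) (auto simp: radius)
  also have "\<dots> \<le> (1 / (1 - cos (t - s)) + 1 / (1 - cos (t + s))) / 2"
    by (intro divide_right_mono order_trans[OF abs_triangle_ineq] add_mono abs_sq_re_le radius
        sum_inverse_one_minus_cos[OF ne]) simp
  also have "\<dots> = (4 - x * y) / (x - y)\<^sup>2"
  proof -
    have "2 * a / b / 2 = a / b" for a b :: real by simp
    then show ?thesis unfolding sum_inverse_one_minus_cos(1)[OF ne] ts by blast
  qed
  finally show ?thesis .
qed

definition lipschitz_I :: "real \<Rightarrow> (real \<Rightarrow> real) \<Rightarrow> bool" where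
  "lipschitz_I L f \<longleftrightarrow> 0 \<le> L \<and> (\<forall>x\<in>I. \<forall>y\<in>I. \<bar>f x - f y\<bar> \<le> L * \<bar>x - y\<bar>)"

lemma lipschitz_I_continuous: "lipschitz_I L f \<Longrightarrow> continuous_on I f"
  by (rule lipschitz_on_continuous_on[of L])
     (auto simp: lipschitz_I_def lipschitz_on_def dist_real_def)

lemma measurable_fst_snd_borel_I:
  fixes f :: "real \<Rightarrow> real"
  assumes "f \<in> borel_measurable borel_I"
  shows "(\<lambda>p. f (fst p)) \<in> borel_measurable (borel_I \<Otimes>\<^sub>M borel_I)"
    "(\<lambda>p. f (snd p)) \<in> borel_measurable (borel_I \<Otimes>\<^sub>M borel_I)"
  using assms by (auto intro: measurable_compose[OF measurable_fst] measurable_compose[OF measurable_snd])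

text \<open>The integrand of the bilinear form of \<open>\<omega>\<close>, a product of two difference quotients.\<close>

definition dquot :: "(real \<Rightarrow> real) \<Rightarrow> (real \<Rightarrow> real) \<Rightarrow> real \<times> real \<Rightarrow> real" where
  "dquot f g = (\<lambda>(x, y). (f x - f y) * (g x - g y) / (x - y)\<^sup>2)"

lemma measurable_dquot:
  assumes "continuous_on I f" "continuous_on I g"
  shows "dquot f g \<in> borel_measurable (borel_I \<Otimes>\<^sub>M borel_I)"
proof -
  note m = measurable_fst_snd_borel_I[OF borel_measurable_borel_I_continuous[OF assms(1)]]
    measurable_fst_snd_borel_I[OF borel_measurable_borel_I_continuous[OF assms(2)]]
    measurable_fst_snd_borel_I[OF borel_measurable_borel_I_continuous[OF continuous_on_id]]
  show ?thesis unfolding dquot_def case_prod_beta' using m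
    by (intro borel_measurable_divide borel_measurable_times borel_measurable_power borel_measurable_diff) auto
qed

lemma abs_dquot_le:
  assumes "lipschitz_I L f" "lipschitz_I M g" "x \<in> I" "y \<in> I"
  shows "\<bar>dquot f g (x, y)\<bar> \<le> L * M"
proof (cases "x = y")
  case False
  have "\<bar>f x - f y\<bar> * \<bar>g x - g y\<bar> \<le> (L * \<bar>x - y\<bar>) * (M * \<bar>x - y\<bar>)"
    using assms by (intro mult_mono) (auto simp: lipschitz_I_def)
  also have "\<dots> = L * M * (x - y)\<^sup>2" by (simp add: power2_eq_square[of "x - y"] abs_mult_self_eq mult_ac flip: abs_mult)
  finally show ?thesis using False by (simp add: dquot_def abs_mult pos_divide_le_eq)
qed (use assms in \<open>auto simp: dquot_def lipschitz_I_def\<close>)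

lemma sq_weight_dquot:
  assumes "lipschitz_I L f" "lipschitz_I M g"
  shows "integrable omega (dquot f g)"
    and "(\<integral>p. dquot f g p \<partial>omega) = (\<integral>(x, y). (4 - x * y) / 4 * dquot f g (x, y) \<partial>(arcsine \<Otimes>\<^sub>M arcsine))"
    and "integrable (arcsine \<Otimes>\<^sub>M arcsine) (\<lambda>(x, y). (4 - x * y) / 4 * dquot f g (x, y))"
    and "\<bar>\<integral>p. dquot f g p \<partial>omega\<bar> \<le> 2 * L * M"
proof -
  note c = lipschitz_I_continuous[OF assms(1)] lipschitz_I_continuous[OF assms(2)]
  note m = measurable_dquot[OF c]
  have m': "(\<lambda>(x, y). (4 - x * y) / 4 * dquot f g (x, y)) \<in> borel_measurable (borel_I \<Otimes>\<^sub>M borel_I)"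
  proof -
    have "(\<lambda>(x, y). (4 - x * y) / 4 :: real) \<in> borel_measurable (borel_I \<Otimes>\<^sub>M borel_I)"
      by (rule measurable_borel_I_pair) measurable
    from borel_measurable_times[OF this m] show ?thesis by (simp add: case_prod_beta')
  qed
  have LM: "0 \<le> L * M" using assms by (simp add: lipschitz_I_def)
  have b: "\<bar>(4 - x * y) / 4 * dquot f g (x, y)\<bar> \<le> 2 * (L * M)" if "x \<in> I" "y \<in> I" for x y
  proof -
    have "\<bar>(4 - x * y) / 4\<bar> * \<bar>dquot f g (x, y)\<bar> \<le> 2 * (L * M)"
      using omega_weight_nonneg[OF that] abs_dquot_le[OF assms that] LM by (intro mult_mono) auto
    then show ?thesis by (simp add: abs_mult)
  qed
  have AEb: "AE p in arcsine \<Otimes>\<^sub>M arcsine. norm (case p of (x, y) \<Rightarrow> (4 - x * y) / 4 * dquot f g (x, y)) \<le> 2 * (L * M)"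
    using b by (intro AE_I2) auto
  show int: "integrable (arcsine \<Otimes>\<^sub>M arcsine) (\<lambda>(x, y). (4 - x * y) / 4 * dquot f g (x, y))"
    by (rule arcsine_prod.integrable_const_bound[OF AEb]) (use m' in \<open>simp add: borel_measurable_arcsine_prod\<close>)
  then show "integrable omega (dquot f g)" by (simp add: omega_integral(1)[OF m])
  show eq: "(\<integral>p. dquot f g p \<partial>omega) = (\<integral>(x, y). (4 - x * y) / 4 * dquot f g (x, y) \<partial>(arcsine \<Otimes>\<^sub>M arcsine))"
    by (rule omega_integral(2)[OF m])
  have "\<bar>\<integral>p. dquot f g p \<partial>omega\<bar> \<le> (\<integral>p. \<bar>case p of (x, y) \<Rightarrow> (4 - x * y) / 4 * dquot f g (x, y)\<bar> \<partial>(arcsine \<Otimes>\<^sub>M arcsine))"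
    unfolding eq by (rule integral_abs_bound)
  also have "\<dots> \<le> (\<integral>p. 2 * (L * M) \<partial>(arcsine \<Otimes>\<^sub>M arcsine))"
    using int AEb by (intro integral_mono_AE) auto
  also have "\<dots> = 2 * (L * M)"
    using arcsine.emeasure_pair_measure_Times[of I arcsine I]
    by (simp add: measure_def emeasure_arcsine sets_restrict_space_iff)
  finally show "\<bar>\<integral>p. dquot f g p \<partial>omega\<bar> \<le> 2 * L * M" by simp
qed

text \<open>In \<open>(V x - V y) * (T m x - T m y)\<close>, integrated against the regularized kernel, the two products
  in a single variable vanish, as the kernel has coefficient 0 at \<open>n = 0\<close>; each mixed product
  gives the \<open>m\<close>-th moment of \<open>V\<close>. In the limit the kernel grows like \<open>1 / (x - y)\<^sup>2\<close>, which the two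
  differences compensate, so that dominated convergence applies.\<close>

lemma dquot_T_integral:
  assumes V: "lipschitz_I L V" and T: "lipschitz_I M (T m)"
  shows "(\<integral>p. dquot V (T m) p \<partial>omega) = m / 2 * (\<integral>x. V x * T m x \<partial>arcsine)"
proof -
  let ?AA = "arcsine \<Otimes>\<^sub>M arcsine"
  let ?k = "\<lambda>k x y. cheb_kernel (sq_coeff (radius k)) x y"
  let ?G = "\<lambda>x y. (V x - V y) * (T m x - T m y)"
  have cV: "continuous_on I V" by (rule lipschitz_I_continuous[OF V])
  have cT: "continuous_on I (T m)" by (rule lipschitz_I_continuous[OF T])
  note mV = borel_measurable_borel_I_continuous[OF cV] and mT = borel_measurable_borel_I_continuous[OF cT]
  have "bounded (V ` I)" by (intro compact_imp_bounded compact_continuous_image cV) auto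
  then obtain B where "\<forall>x\<in>I. \<bar>V x\<bar> \<le> B" by (auto simp: bounded_iff)
  then have B: "\<And>x. x \<in> I \<Longrightarrow> \<bar>V x\<bar> \<le> B" by blast
  have B0: "0 \<le> B" using B[of 0] by simp
  have mk: "(\<lambda>p. ?k k (fst p) (snd p)) \<in> borel_measurable (borel_I \<Otimes>\<^sub>M borel_I)" for k
    using measurable_borel_I_pair[OF measurable_kern] by (simp add: case_prod_beta')
  have int: "integrable ?AA (\<lambda>p. a p * b p * ?k k (fst p) (snd p))"
    if "a \<in> borel_measurable (borel_I \<Otimes>\<^sub>M borel_I)" "b \<in> borel_measurable (borel_I \<Otimes>\<^sub>M borel_I)"
      "\<And>p. p \<in> I \<times> I \<Longrightarrow> \<bar>a p\<bar> \<le> B" "\<And>p. p \<in> I \<times> I \<Longrightarrow> \<bar>b p\<bar> \<le> 1" for a b :: "real \<times> real \<Rightarrow> real" and k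
  proof (rule arcsine_prod.integrable_const_bound[where B="B * 1 * (\<Sum>n. \<bar>sq_coeff (radius k) n\<bar>)"])
    show "AE p in ?AA. norm (a p * b p * ?k k (fst p) (snd p)) \<le> B * 1 * (\<Sum>n. \<bar>sq_coeff (radius k) n\<bar>)"
      unfolding real_norm_def abs_mult using that B0
      by (intro AE_I2 mult_mono abs_kern_le summable_sq_coeff radius) auto
    show "(\<lambda>p. a p * b p * ?k k (fst p) (snd p)) \<in> borel_measurable ?AA"
      unfolding borel_measurable_arcsine_prod using that mk by (intro borel_measurable_times) auto
  qed
  have i: "integrable ?AA (\<lambda>p. V (fst p) * T m (fst p) * ?k k (fst p) (snd p))"
    "integrable ?AA (\<lambda>p. V (fst p) * T m (snd p) * ?k k (fst p) (snd p))"
    "integrable ?AA (\<lambda>p. V (snd p) * T m (fst p) * ?k k (fst p) (snd p))"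
    "integrable ?AA (\<lambda>p. V (snd p) * T m (snd p) * ?k k (fst p) (snd p))" for k
    using B abs_T_le by (intro int measurable_fst_snd_borel_I mV mT; auto)+
  have m0: "(\<integral>x. ?k k x y \<partial>arcsine) = 0" if "y \<in> I" for y k
    using kern_moment[OF summable_sq_coeff that, of "radius k" 0] radius[of k] by (simp add: sq_coeff_def[of _ 0])
  have m0': "(\<integral>y. ?k k x y \<partial>arcsine) = 0" if "x \<in> I" for x k
    using m0[OF that] by (subst kern_commute)
  have m1: "(\<integral>x. T m x * ?k k x y \<partial>arcsine) = sq_coeff (radius k) m / 2 * T m y" if "y \<in> I" for y k
    using kern_moment[OF summable_sq_coeff that, of "radius k" m] radius[of k] by (simp add: sq_coeff_def[of _ 0] mult.commute)
  have m1': "(\<integral>y. T m y * ?k k x y \<partial>arcsine) = sq_coeff (radius k) m / 2 * T m x" if "x \<in> I" for x k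
    using m1[OF that] by (subst kern_commute)
  let ?J = "\<integral>x. V x * T m x \<partial>arcsine"
  have step: "(\<integral>p. ?G (fst p) (snd p) * ?k k (fst p) (snd p) \<partial>?AA) = - (m * radius k ^ m * ?J)" for k
  proof -
    have e: "?G (fst p) (snd p) * ?k k (fst p) (snd p) =
      V (fst p) * T m (fst p) * ?k k (fst p) (snd p) - V (fst p) * T m (snd p) * ?k k (fst p) (snd p)
      - V (snd p) * T m (fst p) * ?k k (fst p) (snd p) + V (snd p) * T m (snd p) * ?k k (fst p) (snd p)" for p
      by (simp add: algebra_simps)
    have 1: "(\<integral>p. V (fst p) * T m (fst p) * ?k k (fst p) (snd p) \<partial>?AA) = 0"
    proof -
      have "(\<integral>p. V (fst p) * T m (fst p) * ?k k (fst p) (snd p) \<partial>?AA) =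
         (\<integral>x. \<integral>y. V x * T m x * ?k k x y \<partial>arcsine \<partial>arcsine)"
        using arcsine_pair.integral_fst'[OF i(1)] by simp
      also have "\<dots> = (\<integral>x. 0 \<partial>arcsine)"
        by (intro Bochner_Integration.integral_cong) (auto simp: m0')
      finally show ?thesis by simp
    qed
    have 2: "(\<integral>p. V (fst p) * T m (snd p) * ?k k (fst p) (snd p) \<partial>?AA) = sq_coeff (radius k) m / 2 * ?J"
    proof -
      have "(\<integral>p. V (fst p) * T m (snd p) * ?k k (fst p) (snd p) \<partial>?AA) =
         (\<integral>x. \<integral>y. V x * (T m y * ?k k x y) \<partial>arcsine \<partial>arcsine)"
        using arcsine_pair.integral_fst'[OF i(2)] by (simp add: mult.assoc)
      also have "\<dots> = (\<integral>x. sq_coeff (radius k) m / 2 * (V x * T m x) \<partial>arcsine)"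
        by (intro Bochner_Integration.integral_cong) (auto simp: m1')
      finally show ?thesis by simp
    qed
    have 3: "(\<integral>p. V (snd p) * T m (fst p) * ?k k (fst p) (snd p) \<partial>?AA) = sq_coeff (radius k) m / 2 * ?J"
    proof -
      have "(\<integral>p. V (snd p) * T m (fst p) * ?k k (fst p) (snd p) \<partial>?AA) =
         (\<integral>y. \<integral>x. V y * (T m x * ?k k x y) \<partial>arcsine \<partial>arcsine)"
        using arcsine_pair.integral_snd[of "\<lambda>x y. V y * T m x * ?k k x y"] i(3)
        by (simp add: mult.assoc case_prod_beta')
      also have "\<dots> = (\<integral>x. sq_coeff (radius k) m / 2 * (V x * T m x) \<partial>arcsine)"
        by (intro Bochner_Integration.integral_cong) (auto simp: m1)
      finally show ?thesis by simp
    qed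
    have 4: "(\<integral>p. V (snd p) * T m (snd p) * ?k k (fst p) (snd p) \<partial>?AA) = 0"
    proof -
      have "(\<integral>p. V (snd p) * T m (snd p) * ?k k (fst p) (snd p) \<partial>?AA) =
         (\<integral>y. \<integral>x. V y * T m y * ?k k x y \<partial>arcsine \<partial>arcsine)"
        using arcsine_pair.integral_snd[of "\<lambda>x y. V y * T m y * ?k k x y"] i(4)
        by (simp add: case_prod_beta')
      also have "\<dots> = (\<integral>y. 0 \<partial>arcsine)"
        by (intro Bochner_Integration.integral_cong) (auto simp: m0)
      finally show ?thesis by simp
    qed
    have "(\<integral>p. ?G (fst p) (snd p) * ?k k (fst p) (snd p) \<partial>?AA) = 0 - sq_coeff (radius k) m / 2 * ?J - sq_coeff (radius k) m / 2 * ?J + 0"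
      unfolding e using i by (simp only: Bochner_Integration.integral_add Bochner_Integration.integral_diff
          Bochner_Integration.integrable_diff 1 2 3 4)
    then show ?thesis by (simp add: sq_coeff_def)
  qed
  have mG: "(\<lambda>p. ?G (fst p) (snd p)) \<in> borel_measurable (borel_I \<Otimes>\<^sub>M borel_I)"
    by (intro borel_measurable_times borel_measurable_diff measurable_fst_snd_borel_I mV mT)
  have GL: "\<bar>?G x y\<bar> = \<bar>dquot V (T m) (x, y)\<bar> * (x - y)\<^sup>2" if "x \<noteq> y" for x y
    using that by (simp add: dquot_def abs_mult)
  have "(\<lambda>k. \<integral>p. ?G (fst p) (snd p) * ?k k (fst p) (snd p) \<partial>?AA) \<longlonglongrightarrow>
      (\<integral>p. - 2 * ((4 - fst p * snd p) / 4 * dquot V (T m) p) \<partial>?AA)"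
  proof (rule integral_dominated_convergence[where w="\<lambda>_. 8 * (L * M)"])
    show "AE p in ?AA. (\<lambda>k. ?G (fst p) (snd p) * ?k k (fst p) (snd p)) \<longlonglongrightarrow> - 2 * ((4 - fst p * snd p) / 4 * dquot V (T m) p)"
      using AE_arcsine_prod_neq AE_space
    proof eventually_elim
      case (elim p)
      then have "(\<lambda>k. ?G (fst p) (snd p) * ?k k (fst p) (snd p)) \<longlonglongrightarrow>
        ?G (fst p) (snd p) * (- ((4 - fst p * snd p) / (2 * (fst p - snd p)\<^sup>2)))"
        by (intro tendsto_mult tendsto_const sq_kern_tendsto) auto
      also have "?G (fst p) (snd p) * (- ((4 - fst p * snd p) / (2 * (fst p - snd p)\<^sup>2)))
         = - 2 * ((4 - fst p * snd p) / 4 * dquot V (T m) p)"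
        by (simp add: dquot_def case_prod_beta')
      finally show ?case .
    qed
    show "AE p in ?AA. norm (?G (fst p) (snd p) * ?k k (fst p) (snd p)) \<le> 8 * (L * M)" for k
      using AE_arcsine_prod_neq AE_space
    proof eventually_elim
      case (elim p)
      obtain x y where p: "p = (x, y)" by (cases p)
      with elim have xy: "x \<in> I" "y \<in> I" "x \<noteq> y" by auto
      have "\<bar>?G x y\<bar> * \<bar>?k k x y\<bar> \<le> (\<bar>dquot V (T m) (x, y)\<bar> * (x - y)\<^sup>2) * ((4 - x * y) / (x - y)\<^sup>2)"
        unfolding GL[OF xy(3)] using xy by (intro mult_left_mono abs_sq_kern_le) auto
      also have "\<dots> = \<bar>dquot V (T m) (x, y)\<bar> * (4 - x * y)" using xy by simp
      also have "\<dots> \<le> (L * M) * 8"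
        using omega_weight_nonneg[OF xy(1,2)] V T
        by (intro mult_mono abs_dquot_le[OF V T]) (use xy in \<open>auto simp: lipschitz_I_def\<close>)
      finally show ?case by (simp add: p abs_mult)
    qed
    show "(\<lambda>p. ?G (fst p) (snd p) * ?k k (fst p) (snd p)) \<in> borel_measurable ?AA" for k
      unfolding borel_measurable_arcsine_prod by (intro borel_measurable_times mG mk)
    show "(\<lambda>p. - 2 * ((4 - fst p * snd p) / 4 * dquot V (T m) p)) \<in> borel_measurable ?AA"
    proof -
      have "(\<lambda>p. (4 - fst p * snd p) / 4 * dquot V (T m) p) \<in> borel_measurable ?AA"
        using sq_weight_dquot(3)[OF V T] by (simp add: case_prod_beta' integrable_iff_bounded)
      from borel_measurable_times[OF borel_measurable_const[of "-2"] this] show ?thesis .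
    qed
  qed simp
  moreover have "(\<lambda>k. - (m * radius k ^ m * ?J)) \<longlonglongrightarrow> - (real m * 1 ^ m * ?J)"
    by (intro tendsto_intros radius_tendsto)
  ultimately have "(\<integral>p. - 2 * ((4 - fst p * snd p) / 4 * dquot V (T m) p) \<partial>?AA) = - (real m * 1 ^ m * ?J)"
    unfolding step by (rule LIMSEQ_unique)
  moreover have "(\<integral>p. - 2 * ((4 - fst p * snd p) / 4 * dquot V (T m) p) \<partial>?AA) = - 2 * (\<integral>p. dquot V (T m) p \<partial>omega)"
    unfolding sq_weight_dquot(2)[OF V T] by (subst integral_mult_right_zero[symmetric]) (simp add: case_prod_beta')
  ultimately show ?thesis by simp
qed

section \<open>Approximation by polynomials\<close>

lemma lipschitz_ID: "lipschitz_I L f \<Longrightarrow> x \<in> I \<Longrightarrow> y \<in> I \<Longrightarrow> \<bar>f x - f y\<bar> \<le> L * \<bar>x - y\<bar>"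
  by (simp add: lipschitz_I_def)

lemma lipschitz_I_if_derivative_bounded:
  assumes d: "\<And>x. x \<in> I \<Longrightarrow> (f has_vector_derivative f' x) (at x within I)"
    and b: "\<And>x. x \<in> I \<Longrightarrow> \<bar>f' x\<bar> \<le> L"
  shows "lipschitz_I L f"
proof -
  have "norm (f x - f y) \<le> L * norm (x - y)" if "x \<in> I" "y \<in> I" for x y
  proof (rule field_differentiable_bound[of I f f'])
    show "(f has_field_derivative f' z) (at z within I)" if "z \<in> I" for z
      using d[OF that] by (simp add: has_real_derivative_iff_has_vector_derivative)
  qed (use b that in auto)
  moreover have "0 \<le> L" using b[of 0] by simp
  ultimately show ?thesis by (auto simp: lipschitz_I_def)
qed

lemma continuous_on_I_bounded:
  fixes f :: "real \<Rightarrow> real"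
  assumes "continuous_on I f"
  obtains B where "\<And>x. x \<in> I \<Longrightarrow> \<bar>f x\<bar> \<le> B"
proof -
  have "bounded (f ` I)" by (intro compact_imp_bounded compact_continuous_image assms) auto
  then obtain B where "\<forall>x\<in>I. \<bar>f x\<bar> \<le> B" by (auto simp: bounded_iff)
  then show ?thesis using that by blast
qed

lemma lipschitz_I_if_C1:
  assumes "\<And>x. x \<in> I \<Longrightarrow> (f has_vector_derivative f' x) (at x within I)"
    and "continuous_on I f'"
  obtains L where "lipschitz_I L f"
proof -
  obtain B where "\<And>x. x \<in> I \<Longrightarrow> \<bar>f' x\<bar> \<le> B" by (rule continuous_on_I_bounded[OF assms(2)]) blast
  with assms(1) have "lipschitz_I B f" by (rule lipschitz_I_if_derivative_bounded)
  then show ?thesis by (rule that)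
qed

lemma poly_has_vector_derivative:
  "(poly p has_vector_derivative poly (pderiv p) x) (at x within S)" for x :: real
  unfolding has_real_derivative_iff_has_vector_derivative[symmetric]
  by (rule has_field_derivative_at_within[OF poly_DERIV])

lemma poly_lipschitz_I:
  obtains L where "lipschitz_I L (poly p)"
proof -
  have "continuous_on I (poly (pderiv p))" by (intro continuous_intros)
  from lipschitz_I_if_C1[OF poly_has_vector_derivative this] that show ?thesis by blast
qed

lemma pderiv_sum: "pderiv (sum f A) = (\<Sum>i\<in>A. pderiv (f i))" for f :: "'b \<Rightarrow> real poly"
  by (induction A rule: infinite_finite_induct) (simp_all add: pderiv_add)

lemma pderiv_surj: "\<exists>p. pderiv p = (q :: real poly)"
proof
  have "pderiv (\<Sum>i\<le>degree q. monom (coeff q i / real (Suc i)) (Suc i)) = (\<Sum>i\<le>degree q. monom (coeff q i) i)"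
    by (simp add: pderiv_sum pderiv_monom)
  then show "pderiv (\<Sum>i\<le>degree q. monom (coeff q i / real (Suc i)) (Suc i)) = q"
    by (simp add: poly_as_sum_of_monoms)
qed

lemma poly_approx_C0:
  assumes "continuous_on I f" "0 < e"
  obtains q where "\<And>x. x \<in> I \<Longrightarrow> \<bar>f x - poly q x\<bar> \<le> e"
proof -
  obtain g where g: "real_polynomial_function g" "\<And>x. x \<in> I \<Longrightarrow> \<bar>f x - g x\<bar> < e"
    using Stone_Weierstrass_real_polynomial_function[of I f e] assms by auto
  then obtain a n where "g = (\<lambda>x. \<Sum>i\<le>n. a i * x ^ i)"
    by (auto simp: real_polynomial_function_iff_sum)
  then have eq: "g = poly (\<Sum>i\<le>n. monom (a i) i)"
    by (simp add: fun_eq_iff poly_sum poly_monom)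
  show ?thesis by (rule that) (use g(2) in \<open>auto simp: eq intro: less_imp_le\<close>)
qed

text \<open>Integrating a uniform approximation of the derivative gives an approximation of the function
  in \<open>C\<^sup>1\<close>. Here \<open>p\<close> is normalized to agree with \<open>f\<close> at 0, the midpoint of \<open>I\<close>.\<close>

lemma poly_antiderivative_approx:
  assumes d: "\<And>x. x \<in> I \<Longrightarrow> (f has_vector_derivative f' x) (at x within I)"
    and q: "\<And>x. x \<in> I \<Longrightarrow> \<bar>f' x - poly q x\<bar> \<le> e"
  obtains p where "pderiv p = q" "lipschitz_I e (\<lambda>x. f x - poly p x)"
    "\<forall>x\<in>I. \<bar>f x - poly p x\<bar> \<le> 2 * e"
proof -
  obtain p0 where p0: "pderiv p0 = q" using pderiv_surj by blast
  define p where "p = p0 + [:f 0 - poly p0 0:]"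
  have p: "pderiv p = q" unfolding p_def pderiv_add p0 by (simp add: pderiv_pCons)
  have l: "lipschitz_I e (\<lambda>x. f x - poly p x)"
    by (rule lipschitz_I_if_derivative_bounded[of _ "\<lambda>x. f' x - poly q x"])
       (auto intro!: has_vector_derivative_diff d poly_has_vector_derivative[of p, unfolded p] q)
  have "\<bar>f x - poly p x\<bar> \<le> 2 * e" if "x \<in> I" for x
  proof -
    have "\<bar>(f x - poly p x) - (f 0 - poly p 0)\<bar> \<le> e * \<bar>x - 0\<bar>"
      by (rule lipschitz_ID[OF l]) (use that in auto)
    also have "\<dots> \<le> e * 2" using that l by (intro mult_left_mono) (auto simp: lipschitz_I_def)
    finally show ?thesis by (simp add: p_def mult.commute)
  qed
  then have "\<forall>x\<in>I. \<bar>f x - poly p x\<bar> \<le> 2 * e" by blast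
  with p l show ?thesis by (rule that)
qed

lemma eq_0_if_abs_le_mult:
  fixes a C :: real
  assumes "\<And>e. 0 < e \<Longrightarrow> \<bar>a\<bar> \<le> C * e"
  shows "a = 0"
proof (rule ccontr)
  assume "a \<noteq> 0"
  then have "0 < \<bar>a\<bar> / (2 * (\<bar>C\<bar> + 1))" by simp
  from assms[OF this] have "\<bar>a\<bar> \<le> \<bar>C\<bar> * (\<bar>a\<bar> / (2 * (\<bar>C\<bar> + 1)))"
    using \<open>a \<noteq> 0\<close> by (elim order_trans) (intro mult_right_mono, auto)
  also have "\<dots> < (2 * (\<bar>C\<bar> + 1)) * (\<bar>a\<bar> / (2 * (\<bar>C\<bar> + 1)))"
    using \<open>a \<noteq> 0\<close> by (intro mult_strict_right_mono) auto
  finally show False by simp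
qed

section \<open>The density of the solution\<close>

text \<open>The part of the density that depends on the external field, as a linear operator in its
  derivative \<open>P\<close>.\<close>

definition sol_op :: "(real \<Rightarrow> real) \<Rightarrow> real \<Rightarrow> real" where
  "sol_op P x = - (1/2 * (\<integral>y. y * P y \<partial>arcsine)) - x/2 * (\<integral>y. P y \<partial>arcsine)
     + (4 - x\<^sup>2)/2 * (\<integral>y. (P x - P y) / (x - y) \<partial>arcsine)"

lemma sol_density_sol_op: "sol_density V A x = A + sol_op (deriv_within I V) x"
  by (simp add: sol_density_def sol_op_def)

lemma abs_quotient_le:
  assumes "lipschitz_I K P" "x \<in> I" "y \<in> I"
  shows "\<bar>(P x - P y) / (x - y)\<bar> \<le> K"
  using assms by (cases "x = y") (auto simp: lipschitz_I_def pos_divide_le_eq)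

lemma measurable_quotient:
  assumes "continuous_on I P"
  shows "(\<lambda>(x, y). (P x - P y) / (x - y)) \<in> borel_measurable (borel_I \<Otimes>\<^sub>M borel_I)"
proof -
  note m = measurable_fst_snd_borel_I[OF borel_measurable_borel_I_continuous[OF assms]]
    measurable_fst_snd_borel_I[OF borel_measurable_borel_I_continuous[OF continuous_on_id]]
  show ?thesis unfolding case_prod_beta' using m
    by (intro borel_measurable_divide borel_measurable_diff) auto
qed

lemma integrable_quotient:
  assumes "lipschitz_I K P" "x \<in> I"
  shows "integrable arcsine (\<lambda>y. (P x - P y) / (x - y))"
proof (rule arcsine_integrable_bounded[OF _ abs_quotient_le[OF assms]])
  have "P \<in> borel_measurable borel_I"
    by (intro borel_measurable_borel_I_continuous lipschitz_I_continuous[OF assms(1)])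
  then show "(\<lambda>y. (P x - P y) / (x - y)) \<in> borel_measurable borel_I"
    by measurable
qed auto

lemma measurable_sol_op:
  assumes "lipschitz_I K P"
  shows "sol_op P \<in> borel_measurable borel_I"
proof -
  have "(\<lambda>(x, y). (P x - P y) / (x - y)) \<in> borel_measurable (borel_I \<Otimes>\<^sub>M arcsine)"
    using measurable_quotient[OF lipschitz_I_continuous[OF assms]]
    by (simp cong: measurable_cong_sets)
  then have "(\<lambda>x. \<integral>y. (P x - P y) / (x - y) \<partial>arcsine) \<in> borel_measurable borel_I"
    by (rule arcsine.borel_measurable_lebesgue_integral)
  then show ?thesis unfolding sol_op_def by measurable
qed

lemma abs_sol_op_le:
  assumes K: "lipschitz_I K P" and a: "\<And>x. x \<in> I \<Longrightarrow> \<bar>P x\<bar> \<le> a" and x: "x \<in> I"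
  shows "\<bar>sol_op P x\<bar> \<le> 2 * a + 2 * K"
proof -
  have a0: "0 \<le> a" using a[of 0] by simp
  have "\<bar>\<integral>y. y * P y \<partial>arcsine\<bar> \<le> 2 * a"
    by (rule arcsine_integral_bound) (auto simp: abs_mult intro!: mult_mono a)
  then have 1: "\<bar>1/2 * (\<integral>y. y * P y \<partial>arcsine)\<bar> \<le> a" by (simp add: abs_mult)
  have "\<bar>x/2\<bar> * \<bar>\<integral>y. P y \<partial>arcsine\<bar> \<le> 1 * a"
    using x by (intro mult_mono arcsine_integral_bound a) auto
  then have 2: "\<bar>x/2 * (\<integral>y. P y \<partial>arcsine)\<bar> \<le> a" by (simp add: abs_mult)
  have "0 \<le> 4 - x\<^sup>2" using x abs_le_square_iff[of x 2] by auto
  then have "\<bar>(4 - x\<^sup>2)/2\<bar> * \<bar>\<integral>y. (P x - P y) / (x - y) \<partial>arcsine\<bar> \<le> 2 * K"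
    using abs_quotient_le[OF K x] by (intro mult_mono arcsine_integral_bound) auto
  then have 3: "\<bar>(4 - x\<^sup>2)/2 * (\<integral>y. (P x - P y) / (x - y) \<partial>arcsine)\<bar> \<le> 2 * K"
    by (simp add: abs_mult)
  from 1 2 3 show ?thesis unfolding sol_op_def by linarith
qed

lemma integrable_sol_op:
  assumes "lipschitz_I K P" and "f \<in> borel_measurable borel_I" and "\<And>x. x \<in> I \<Longrightarrow> \<bar>f x\<bar> \<le> b"
  shows "integrable arcsine (\<lambda>x. f x * sol_op P x)"
proof -
  obtain a where a: "\<And>x. x \<in> I \<Longrightarrow> \<bar>P x\<bar> \<le> a"
    by (rule continuous_on_I_bounded[OF lipschitz_I_continuous[OF assms(1)]]) blast
  have b0: "0 \<le> b" using assms(3)[of 0] by simp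
  show ?thesis
  proof (rule arcsine_integrable_bounded)
    show "(\<lambda>x. f x * sol_op P x) \<in> borel_measurable borel_I"
      by (intro borel_measurable_times assms measurable_sol_op[OF assms(1)])
    show "\<bar>f x * sol_op P x\<bar> \<le> b * (2 * a + 2 * K)" if "x \<in> I" for x
      unfolding abs_mult using that b0 by (intro mult_mono assms(3) abs_sol_op_le[OF assms(1) a]) auto
  qed
qed

lemma sol_op_add:
  assumes P: "lipschitz_I K P" and Q: "lipschitz_I L Q" and x: "x \<in> I"
  shows "sol_op (\<lambda>x. P x + Q x) x = sol_op P x + sol_op Q x"
proof -
  note c = lipschitz_I_continuous[OF P] lipschitz_I_continuous[OF Q]
  have "(\<integral>y. (P x + Q x - (P y + Q y)) / (x - y) \<partial>arcsine) =
      (\<integral>y. (P x - P y) / (x - y) + (Q x - Q y) / (x - y) \<partial>arcsine)"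
    by (intro Bochner_Integration.integral_cong) (auto simp: add_divide_distrib[symmetric] algebra_simps)
  also have "\<dots> = (\<integral>y. (P x - P y) / (x - y) \<partial>arcsine) + (\<integral>y. (Q x - Q y) / (x - y) \<partial>arcsine)"
    by (rule Bochner_Integration.integral_add[OF integrable_quotient[OF P x] integrable_quotient[OF Q x]])
  finally have 1: "(\<integral>y. (P x + Q x - (P y + Q y)) / (x - y) \<partial>arcsine) =
    (\<integral>y. (P x - P y) / (x - y) \<partial>arcsine) + (\<integral>y. (Q x - Q y) / (x - y) \<partial>arcsine)" .
  have 2: "(\<integral>y. y * (P y + Q y) \<partial>arcsine) = (\<integral>y. y * P y \<partial>arcsine) + (\<integral>y. y * Q y \<partial>arcsine)"
    unfolding distrib_left using c
    by (intro Bochner_Integration.integral_add arcsine_integrable_continuous continuous_intros)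
  have 3: "(\<integral>y. P y + Q y \<partial>arcsine) = (\<integral>y. P y \<partial>arcsine) + (\<integral>y. Q y \<partial>arcsine)"
    using c by (intro Bochner_Integration.integral_add arcsine_integrable_continuous)
  show ?thesis unfolding sol_op_def 1 2 3 by (simp add: algebra_simps)
qed

lemma sol_op_cmult: "sol_op (\<lambda>x. c * P x) x = c * sol_op P x"
proof -
  have "(\<integral>y. (c * P x - c * P y) / (x - y) \<partial>arcsine) = (\<integral>y. c * ((P x - P y) / (x - y)) \<partial>arcsine)"
    by (intro Bochner_Integration.integral_cong) (auto simp: right_diff_distrib)
  also have "\<dots> = c * (\<integral>y. (P x - P y) / (x - y) \<partial>arcsine)" by (rule integral_mult_right_zero)
  finally have 1: "(\<integral>y. (c * P x - c * P y) / (x - y) \<partial>arcsine) = c * (\<integral>y. (P x - P y) / (x - y) \<partial>arcsine)" .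
  have 2: "(\<integral>y. y * (c * P y) \<partial>arcsine) = c * (\<integral>y. y * P y \<partial>arcsine)"
    unfolding mult.left_commute[of _ c] by (rule integral_mult_right_zero)
  have 3: "(\<integral>y. c * P y \<partial>arcsine) = c * (\<integral>y. P y \<partial>arcsine)" by (rule integral_mult_right_zero)
  show ?thesis unfolding sol_op_def 1 2 3 by (simp add: algebra_simps)
qed

text \<open>The Chebyshev polynomials of the second kind, rescaled to \<open>[-2, 2]\<close>:
  \<open>U n (2 cos t) = sin ((n + 1) t) / sin t\<close>. Up to constants they are the derivatives of the \<open>T n\<close>.\<close>

fun chebU :: "nat \<Rightarrow> real poly" where
  "chebU 0 = 1"
| "chebU (Suc 0) = [:0, 1:]"
| "chebU (Suc (Suc n)) = [:0, 1:] * chebU (Suc n) - chebU n"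

abbreviation U :: "nat \<Rightarrow> real \<Rightarrow> real" where
  "U n \<equiv> poly (chebU n)"

lemma T_eq_U_diff: "2 * T (Suc (Suc n)) x = U (Suc (Suc n)) x - U n x"
proof (induction n rule: cheb.induct)
  case (3 n)
  have "2 * T (Suc (Suc (Suc (Suc n)))) x = x * (2 * T (Suc (Suc (Suc n))) x) - 2 * T (Suc (Suc n)) x"
    by (simp del: cheb.simps add: cheb.simps(3)[of "Suc (Suc n)"])
  also have "\<dots> = x * (U (Suc (Suc (Suc n))) x - U (Suc n) x) - (U (Suc (Suc n)) x - U n x)"
    unfolding 3 ..
  also have "\<dots> = U (Suc (Suc (Suc (Suc n)))) x - U (Suc (Suc n)) x"
    by (simp del: chebU.simps add: chebU.simps(3)[of "Suc (Suc n)"] chebU.simps(3)[of n] algebra_simps)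
  finally show ?case .
qed (simp_all add: algebra_simps)

lemma poly_pderiv_cheb: "poly (pderiv (cheb (Suc n))) x = real (Suc n) / 2 * U n x"
proof (induction n rule: cheb.induct)
  case (3 n)
  have "poly (pderiv (cheb (Suc (Suc (Suc n))))) x =
     T (Suc (Suc n)) x + x * poly (pderiv (cheb (Suc (Suc n)))) x - poly (pderiv (cheb (Suc n))) x"
    by (simp del: cheb.simps add: cheb.simps(3)[of "Suc n"] pderiv_diff pderiv_mult pderiv_pCons)
  also have "\<dots> = T (Suc (Suc n)) x + x * (real (Suc (Suc n)) / 2 * U (Suc n) x) - real (Suc n) / 2 * U n x"
    unfolding 3 ..
  also have "T (Suc (Suc n)) x = (x * U (Suc n) x - 2 * U n x) / 2"
    using T_eq_U_diff[of n x] by simp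
  finally show ?case by (simp add: field_simps)
qed (simp_all add: pderiv_diff pderiv_mult pderiv_pCons)

lemma integral_U: "(\<integral>y. U n y \<partial>arcsine) = (if even n then 1 else 0)"
proof (induction n rule: cheb.induct)
  case 2
  have "(\<integral>y. U 1 y \<partial>arcsine) = (\<integral>y. 2 * T 1 y \<partial>arcsine)"
    by (intro Bochner_Integration.integral_cong) auto
  then show ?case using integral_T[of 1] by simp
next
  case (3 n)
  have "(\<integral>y. U (Suc (Suc n)) y \<partial>arcsine) = (\<integral>y. U n y + 2 * T (Suc (Suc n)) y \<partial>arcsine)"
    unfolding T_eq_U_diff by simp
  also have "\<dots> = (\<integral>y. U n y \<partial>arcsine) + 2 * (\<integral>y. T (Suc (Suc n)) y \<partial>arcsine)"
    by (subst Bochner_Integration.integral_add)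
       (auto simp del: cheb.simps intro!: arcsine_integrable_continuous continuous_intros)
  finally show ?case using 3 integral_T[of "Suc (Suc n)"] by simp
qed (simp add: measure_arcsine)

lemma integral_X_U: "(\<integral>y. y * U n y \<partial>arcsine) = (if even n then 0 else 2)"
proof (cases n)
  case 0
  have "(\<integral>y. y * U 0 y \<partial>arcsine) = (\<integral>y. U 1 y \<partial>arcsine)" by simp
  then show ?thesis using integral_U[of 1] 0 by simp
next
  case (Suc k)
  have "(\<integral>y. y * U n y \<partial>arcsine) = (\<integral>y. U (Suc n) y + U k y \<partial>arcsine)"
    by (simp add: Suc)
  also have "\<dots> = (\<integral>y. U (Suc n) y \<partial>arcsine) + (\<integral>y. U k y \<partial>arcsine)"
    by (intro Bochner_Integration.integral_add arcsine_integrable_continuous continuous_intros)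
  finally show ?thesis unfolding integral_U using Suc by simp
qed

text \<open>Difference quotients inherit the recursion of the \<open>U n\<close> up to an inhomogeneous term
  \<open>U (n + 1) y\<close>. In the operator this term cancels against the two other integrals, so both sides
  satisfy \<open>N (n + 2) = x * N (n + 1) - N n\<close>.\<close>

lemma sol_op_U:
  assumes x: "x \<in> I"
  shows "sol_op (U n) x = - T (Suc n) x"
proof -
  let ?q = "\<lambda>n. \<integral>y. (U n x - U n y) / (x - y) \<partial>arcsine"
  have i: "integrable arcsine (\<lambda>y. (U n x - U n y) / (x - y))" for n
  proof -
    obtain L where "lipschitz_I L (U n)" by (rule poly_lipschitz_I)
    then show ?thesis by (rule integrable_quotient[OF _ x])
  qed
  have rec: "?q (Suc (Suc n)) = x * ?q (Suc n) + (if even n then 0 else 1) - ?q n" for n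
  proof -
    have "?q (Suc (Suc n)) = (\<integral>y. x * ((U (Suc n) x - U (Suc n) y) / (x - y)) + U (Suc n) y - (U n x - U n y) / (x - y) \<partial>arcsine)"
    proof (rule integral_cong_AE)
      show "AE y in arcsine. (U (Suc (Suc n)) x - U (Suc (Suc n)) y) / (x - y) =
         x * ((U (Suc n) x - U (Suc n) y) / (x - y)) + U (Suc n) y - (U n x - U n y) / (x - y)"
        using AE_arcsine_neq[of x]
      proof eventually_elim
        case (elim y)
        have "U (Suc (Suc n)) x - U (Suc (Suc n)) y =
          x * (U (Suc n) x - U (Suc n) y) + U (Suc n) y * (x - y) - (U n x - U n y)"
          by (simp add: algebra_simps)
        moreover have "(x * a + b * d - c) / d = x * (a / d) + b - c / d" if "d \<noteq> 0" for a b c d :: real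
          using that by (simp add: field_simps)
        ultimately show ?case using elim by (simp only:)
      qed
    next
      show "(\<lambda>y. (U (Suc (Suc n)) x - U (Suc (Suc n)) y) / (x - y)) \<in> borel_measurable arcsine"
        by (rule borel_measurable_integrable[OF i])
      show "(\<lambda>y. x * ((U (Suc n) x - U (Suc n) y) / (x - y)) + U (Suc n) y - (U n x - U n y) / (x - y)) \<in> borel_measurable arcsine"
        by (intro borel_measurable_integrable Bochner_Integration.integrable_diff Bochner_Integration.integrable_add
            integrable_mult_right i arcsine_integrable_continuous continuous_intros)
    qed
    also have "\<dots> = x * ?q (Suc n) + (\<integral>y. U (Suc n) y \<partial>arcsine) - ?q n"
      using i by (simp add: arcsine_integrable_continuous continuous_intros del: chebU.simps times_divide_eq_right)
    finally show ?thesis unfolding integral_U by simp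
  qed
  have q0: "?q 0 = 0" by simp
  have q1: "?q (Suc 0) = 1"
  proof -
    have "?q (Suc 0) = (\<integral>y. 1 \<partial>arcsine)"
    proof (rule integral_cong_AE)
      show "AE y in arcsine. (U (Suc 0) x - U (Suc 0) y) / (x - y) = 1"
        using AE_arcsine_neq[of x] by eventually_elim simp
    qed (auto cong: measurable_cong_sets)
    then show ?thesis by (simp add: measure_arcsine)
  qed
  have N: "sol_op (U n) x = - (if even n then 0 else 1) - x/2 * (if even n then 1 else 0) + (4 - x\<^sup>2)/2 * ?q n" for n
    unfolding sol_op_def integral_U integral_X_U by simp
  show ?thesis
  proof (induction n rule: cheb.induct)
    case 1 show ?case unfolding N q0 by simp
  next
    case 2 show ?case unfolding N q1 by (simp add: field_simps power2_eq_square)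
  next
    case (3 n)
    have "sol_op (U (Suc (Suc n))) x = x * sol_op (U (Suc n)) x - sol_op (U n) x"
      unfolding N rec by (cases "even n") (simp_all add: field_simps power2_eq_square)
    also have "\<dots> = - T (Suc (Suc (Suc n))) x"
      unfolding 3 by (simp add: algebra_simps)
    finally show ?case .
  qed
qed

lemma sol_op_cheb:
  assumes x: "x \<in> I"
  shows "sol_op (poly (pderiv (cheb m))) x = - (m / 2 * T m x)"
proof (cases m)
  case 0
  then show ?thesis by (simp add: sol_op_def)
next
  case (Suc n)
  have "poly (pderiv (cheb m)) = (\<lambda>x. real (Suc n) / 2 * U n x)"
    unfolding Suc by (rule ext) (rule poly_pderiv_cheb)
  then show ?thesis using sol_op_U[OF x, of n] by (simp only: sol_op_cmult Suc)
qed

lemma sol_op_moment_poly: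
  "(\<integral>x. T n x * sol_op (poly (pderiv p)) x \<partial>arcsine) = - (n / 2 * (\<integral>x. poly p x * T n x \<partial>arcsine))"
proof (induction p rule: cheb_induct)
  case (cheb m)
  have "(\<integral>x. T n x * sol_op (poly (pderiv (cheb m))) x \<partial>arcsine) = (\<integral>x. - (m / 2) * (T m x * T n x) \<partial>arcsine)"
    by (intro Bochner_Integration.integral_cong) (auto simp: sol_op_cheb)
  also have "\<dots> = - (m / 2) * (\<integral>x. T m x * T n x \<partial>arcsine)" by (rule integral_mult_right_zero)
  finally show ?case by (simp add: integral_T_T)
next
  case (add p q)
  obtain K L where KL: "lipschitz_I K (poly (pderiv p))" "lipschitz_I L (poly (pderiv q))"
    by (metis poly_lipschitz_I)
  have i: "integrable arcsine (\<lambda>x. T n x * sol_op (poly (pderiv p)) x)" "integrable arcsine (\<lambda>x. T n x * sol_op (poly (pderiv q)) x)"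
    using KL by (auto intro!: integrable_sol_op[where b=1] abs_T_le)
  have "(\<integral>x. T n x * sol_op (poly (pderiv (p + q))) x \<partial>arcsine) =
     (\<integral>x. T n x * sol_op (poly (pderiv p)) x + T n x * sol_op (poly (pderiv q)) x \<partial>arcsine)"
  proof (rule Bochner_Integration.integral_cong)
    fix x assume "x \<in> space arcsine"
    then have "sol_op (\<lambda>x. poly (pderiv p) x + poly (pderiv q) x) x = sol_op (poly (pderiv p)) x + sol_op (poly (pderiv q)) x"
      by (intro sol_op_add[OF KL]) simp
    then show "T n x * sol_op (poly (pderiv (p + q))) x = T n x * sol_op (poly (pderiv p)) x + T n x * sol_op (poly (pderiv q)) x"
      by (simp add: pderiv_add poly_add[abs_def] distrib_left)
  qed simp
  also have "\<dots> = - (n / 2 * (\<integral>x. poly p x * T n x \<partial>arcsine)) + - (n / 2 * (\<integral>x. poly q x * T n x \<partial>arcsine))"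
    unfolding add[symmetric] by (rule Bochner_Integration.integral_add[OF i])
  also have "\<dots> = - (n / 2 * ((\<integral>x. poly p x * T n x \<partial>arcsine) + (\<integral>x. poly q x * T n x \<partial>arcsine)))"
    by (simp add: algebra_simps)
  also have "(\<integral>x. poly p x * T n x \<partial>arcsine) + (\<integral>x. poly q x * T n x \<partial>arcsine) = (\<integral>x. poly p x * T n x + poly q x * T n x \<partial>arcsine)"
    by (intro Bochner_Integration.integral_add[symmetric] arcsine_integrable_continuous continuous_intros)
  finally show ?case by (simp add: distrib_right)
next
  case (smult c p)
  have "poly (pderiv (smult c p)) = (\<lambda>x. c * poly (pderiv p) x)"
    by (simp add: fun_eq_iff pderiv_smult)
  then have "(\<integral>x. T n x * sol_op (poly (pderiv (smult c p))) x \<partial>arcsine) = (\<integral>x. c * (T n x * sol_op (poly (pderiv p)) x) \<partial>arcsine)"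
    by (simp only: sol_op_cmult mult.left_commute)
  also have "\<dots> = c * (\<integral>x. T n x * sol_op (poly (pderiv p)) x \<partial>arcsine)" by (rule integral_mult_right_zero)
  finally show ?case unfolding smult by (simp add: mult.assoc)
qed

text \<open>Both sides are continuous in \<open>V\<close> with respect to the \<open>C\<^sup>2\<close> norm: the operator is bounded by the
  supremum and the Lipschitz constant of \<open>V1\<close>. So the case of polynomials suffices.\<close>

lemma sol_op_moment:
  assumes V: "\<And>x. x \<in> I \<Longrightarrow> (V has_vector_derivative V1 x) (at x within I)"
    and V1: "\<And>x. x \<in> I \<Longrightarrow> (V1 has_vector_derivative V2 x) (at x within I)"
    and V2: "continuous_on I V2"
  shows "(\<integral>x. T n x * sol_op V1 x \<partial>arcsine) = - (n / 2 * (\<integral>x. V x * T n x \<partial>arcsine))"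
proof -
  let ?E = "(\<integral>x. T n x * sol_op V1 x \<partial>arcsine) + n / 2 * (\<integral>x. V x * T n x \<partial>arcsine)"
  obtain L1 where L1: "lipschitz_I L1 V1" using lipschitz_I_if_C1[OF V1 V2] .
  obtain L where L: "lipschitz_I L V"
    using lipschitz_I_if_C1[OF V lipschitz_I_continuous[OF L1]] .
  have "\<bar>?E\<bar> \<le> (6 + 2 * real n) * e" if e: "0 < e" for e :: real
  proof -
    obtain q where q: "\<And>x. x \<in> I \<Longrightarrow> \<bar>V2 x - poly q x\<bar> \<le> e"
      by (rule poly_approx_C0[OF V2 e]) blast
    obtain p1 where p1: "pderiv p1 = q" "lipschitz_I e (\<lambda>x. V1 x - poly p1 x)"
      and "\<forall>x\<in>I. \<bar>V1 x - poly p1 x\<bar> \<le> 2 * e"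
      by (rule poly_antiderivative_approx[OF V1 q])
    then have p1': "\<And>x. x \<in> I \<Longrightarrow> \<bar>V1 x - poly p1 x\<bar> \<le> 2 * e" by blast
    obtain p where p: "pderiv p = p1" and "\<forall>x\<in>I. \<bar>V x - poly p x\<bar> \<le> 2 * (2 * e)"
      by (rule poly_antiderivative_approx[OF V p1'])
    then have p': "\<And>x. x \<in> I \<Longrightarrow> \<bar>V x - poly p x\<bar> \<le> 2 * (2 * e)" by blast
    obtain K where K: "lipschitz_I K (poly p1)" by (rule poly_lipschitz_I)
    let ?D = "\<lambda>x. V1 x - poly p1 x"
    have "(\<integral>x. T n x * sol_op V1 x \<partial>arcsine) = (\<integral>x. T n x * sol_op ?D x + T n x * sol_op (poly p1) x \<partial>arcsine)"
    proof (rule Bochner_Integration.integral_cong)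
      fix x assume "x \<in> space arcsine"
      then show "T n x * sol_op V1 x = T n x * sol_op ?D x + T n x * sol_op (poly p1) x"
        using sol_op_add[OF p1(2) K, of x] by (simp add: distrib_left[symmetric])
    qed simp
    also have "\<dots> = (\<integral>x. T n x * sol_op ?D x \<partial>arcsine) + (\<integral>x. T n x * sol_op (poly p1) x \<partial>arcsine)"
      using K p1 by (intro Bochner_Integration.integral_add integrable_sol_op[where b=1] abs_T_le) auto
    also have "(\<integral>x. T n x * sol_op (poly p1) x \<partial>arcsine) = - (n / 2 * (\<integral>x. poly p x * T n x \<partial>arcsine))"
      using sol_op_moment_poly[of n p] p by simp
    finally have "?E = (\<integral>x. T n x * sol_op ?D x \<partial>arcsine) +
        n / 2 * ((\<integral>x. V x * T n x \<partial>arcsine) - (\<integral>x. poly p x * T n x \<partial>arcsine))"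
      by (simp add: algebra_simps)
    also have "(\<integral>x. V x * T n x \<partial>arcsine) - (\<integral>x. poly p x * T n x \<partial>arcsine) = (\<integral>x. (V x - poly p x) * T n x \<partial>arcsine)"
      unfolding left_diff_distrib using lipschitz_I_continuous[OF L]
      by (intro Bochner_Integration.integral_diff[symmetric] arcsine_integrable_continuous continuous_intros)
    finally have E: "?E = (\<integral>x. T n x * sol_op ?D x \<partial>arcsine) + n / 2 * (\<integral>x. (V x - poly p x) * T n x \<partial>arcsine)" .
    have "\<bar>\<integral>x. T n x * sol_op ?D x \<partial>arcsine\<bar> \<le> 1 * (2 * (2 * e) + 2 * e)"
      by (rule arcsine_integral_bound, unfold abs_mult, intro mult_mono abs_T_le abs_sol_op_le[OF p1(2)] p1') auto
    then have 1: "\<bar>\<integral>x. T n x * sol_op ?D x \<partial>arcsine\<bar> \<le> 6 * e" by simp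
    have "\<bar>\<integral>x. (V x - poly p x) * T n x \<partial>arcsine\<bar> \<le> (2 * (2 * e)) * 1"
      by (rule arcsine_integral_bound, unfold abs_mult, intro mult_mono abs_T_le p') (use e in auto)
    then have "\<bar>n / 2\<bar> * \<bar>\<integral>x. (V x - poly p x) * T n x \<partial>arcsine\<bar> \<le> n / 2 * ((2 * (2 * e)) * 1)"
      by (intro mult_mono) auto
    then have 2: "\<bar>n / 2 * (\<integral>x. (V x - poly p x) * T n x \<partial>arcsine)\<bar> \<le> 2 * real n * e"
      by (simp add: abs_mult mult_ac)
    have "\<bar>?E\<bar> \<le> 6 * e + 2 * real n * e" unfolding E
      by (rule order_trans[OF abs_triangle_ineq add_mono[OF 1 2]])
    then show ?thesis by (simp add: algebra_simps)
  qed
  then have "?E = 0" by (rule eq_0_if_abs_le_mult)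
  then show ?thesis by linarith
qed

lemma dquot_linear:
  assumes "lipschitz_I L V" "lipschitz_I K f" "lipschitz_I M g"
  shows "(\<integral>p. dquot V (\<lambda>x. f x + g x) p \<partial>omega) = (\<integral>p. dquot V f p \<partial>omega) + (\<integral>p. dquot V g p \<partial>omega)"
    and "(\<integral>p. dquot V (\<lambda>x. c * f x) p \<partial>omega) = c * (\<integral>p. dquot V f p \<partial>omega)"
proof -
  have "dquot V (\<lambda>x. f x + g x) = (\<lambda>p. dquot V f p + dquot V g p)"
    by (auto simp: dquot_def fun_eq_iff add_divide_distrib[symmetric] algebra_simps)
  then show "(\<integral>p. dquot V (\<lambda>x. f x + g x) p \<partial>omega) = (\<integral>p. dquot V f p \<partial>omega) + (\<integral>p. dquot V g p \<partial>omega)"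
    using assms by (simp add: sq_weight_dquot)
  have "dquot V (\<lambda>x. c * f x) = (\<lambda>p. c * dquot V f p)"
    by (auto simp: dquot_def fun_eq_iff algebra_simps)
  then show "(\<integral>p. dquot V (\<lambda>x. c * f x) p \<partial>omega) = c * (\<integral>p. dquot V f p \<partial>omega)"
    by simp
qed

text \<open>For \<open>\<phi> = T n\<close> both sides equal \<open>- n / 2\<close> times the \<open>n\<close>-th moment of \<open>V\<close>. They are linear in \<open>\<phi>\<close>, and
  continuous in the \<open>C\<^sup>1\<close> norm.\<close>

lemma sol_op_integral_eq_dquot:
  assumes V: "\<And>x. x \<in> I \<Longrightarrow> (V has_vector_derivative V1 x) (at x within I)"
    and V1: "\<And>x. x \<in> I \<Longrightarrow> (V1 has_vector_derivative V2 x) (at x within I)"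
    and V2: "continuous_on I V2"
    and \<phi>: "\<And>x. x \<in> I \<Longrightarrow> (\<phi> has_vector_derivative \<phi>' x) (at x within I)"
    and \<phi>': "continuous_on I \<phi>'"
  shows "(\<integral>x. \<phi> x * sol_op V1 x \<partial>arcsine) = - (\<integral>p. dquot V \<phi> p \<partial>omega)"
proof -
  obtain L1 where L1: "lipschitz_I L1 V1" using lipschitz_I_if_C1[OF V1 V2] .
  obtain L where L: "lipschitz_I L V"
    using lipschitz_I_if_C1[OF V lipschitz_I_continuous[OF L1]] .
  obtain a where a: "\<And>x. x \<in> I \<Longrightarrow> \<bar>V1 x\<bar> \<le> a"
    by (rule continuous_on_I_bounded[OF lipschitz_I_continuous[OF L1]]) blast
  let ?B = "2 * a + 2 * L1"
  have B: "\<bar>sol_op V1 x\<bar> \<le> ?B" if "x \<in> I" for x by (rule abs_sol_op_le[OF L1 a that])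
  have B0: "0 \<le> ?B" using B[of 0] by simp
  have iN: "integrable arcsine (\<lambda>x. f x * sol_op V1 x)" if f: "continuous_on I f" for f
  proof -
    obtain b where "\<And>x. x \<in> I \<Longrightarrow> \<bar>f x\<bar> \<le> b" by (rule continuous_on_I_bounded[OF f]) blast
    then show ?thesis by (intro integrable_sol_op[OF L1 borel_measurable_borel_I_continuous[OF f]])
  qed
  have poly: "(\<integral>x. poly p x * sol_op V1 x \<partial>arcsine) = - (\<integral>z. dquot V (poly p) z \<partial>omega)" for p
  proof (induction p rule: cheb_induct)
    case (cheb n)
    obtain M where "lipschitz_I M (T n)" by (rule poly_lipschitz_I)
    have "(\<integral>x. T n x * sol_op V1 x \<partial>arcsine) = - (n / 2 * (\<integral>x. V x * T n x \<partial>arcsine))"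
      using V V1 V2 by (rule sol_op_moment)
    with dquot_T_integral[OF L \<open>lipschitz_I M (T n)\<close>] show ?case by linarith
  next
    case (add p q)
    obtain K M where KM: "lipschitz_I K (poly p)" "lipschitz_I M (poly q)" by (metis poly_lipschitz_I)
    have "(\<integral>x. poly (p + q) x * sol_op V1 x \<partial>arcsine) = (\<integral>x. poly p x * sol_op V1 x + poly q x * sol_op V1 x \<partial>arcsine)"
      by (simp add: distrib_right)
    also have "\<dots> = (\<integral>x. poly p x * sol_op V1 x \<partial>arcsine) + (\<integral>x. poly q x * sol_op V1 x \<partial>arcsine)"
      by (intro Bochner_Integration.integral_add iN continuous_intros)
    also have "\<dots> = - (\<integral>z. dquot V (\<lambda>x. poly p x + poly q x) z \<partial>omega)"
      unfolding add dquot_linear(1)[OF L KM] by simp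
    finally show ?case by (simp add: poly_add[abs_def])
  next
    case (smult c p)
    obtain K where K: "lipschitz_I K (poly p)" by (rule poly_lipschitz_I)
    have "(\<integral>x. poly (smult c p) x * sol_op V1 x \<partial>arcsine) = c * (\<integral>x. poly p x * sol_op V1 x \<partial>arcsine)"
      by (simp add: mult.assoc)
    also have "\<dots> = - (\<integral>z. dquot V (\<lambda>x. c * poly p x) z \<partial>omega)"
      unfolding smult dquot_linear(2)[OF L K K] by simp
    also have "(\<lambda>x. c * poly p x) = poly (smult c p)" by (simp add: fun_eq_iff)
    finally show ?case .
  qed
  let ?E = "(\<integral>x. \<phi> x * sol_op V1 x \<partial>arcsine) + (\<integral>p. dquot V \<phi> p \<partial>omega)"
  have "\<bar>?E\<bar> \<le> (2 * ?B + 2 * L) * e" if e: "0 < e" for e :: real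
  proof -
    obtain q where q: "\<And>x. x \<in> I \<Longrightarrow> \<bar>\<phi>' x - poly q x\<bar> \<le> e"
      by (rule poly_approx_C0[OF \<phi>' e]) blast
    obtain p where p: "lipschitz_I e (\<lambda>x. \<phi> x - poly p x)"
      and "\<forall>x\<in>I. \<bar>\<phi> x - poly p x\<bar> \<le> 2 * e"
      by (rule poly_antiderivative_approx[OF \<phi> q])
    then have p': "\<And>x. x \<in> I \<Longrightarrow> \<bar>\<phi> x - poly p x\<bar> \<le> 2 * e" by blast
    obtain K where K: "lipschitz_I K (poly p)" by (rule poly_lipschitz_I)
    let ?D = "\<lambda>x. \<phi> x - poly p x"
    have "(\<integral>x. \<phi> x * sol_op V1 x \<partial>arcsine) = (\<integral>x. ?D x * sol_op V1 x + poly p x * sol_op V1 x \<partial>arcsine)"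
      by (simp add: left_diff_distrib)
    also have "\<dots> = (\<integral>x. ?D x * sol_op V1 x \<partial>arcsine) + (\<integral>x. poly p x * sol_op V1 x \<partial>arcsine)"
      by (intro Bochner_Integration.integral_add iN lipschitz_I_continuous[OF p] continuous_intros)
    finally have 1: "(\<integral>x. \<phi> x * sol_op V1 x \<partial>arcsine) = (\<integral>x. ?D x * sol_op V1 x \<partial>arcsine) - (\<integral>z. dquot V (poly p) z \<partial>omega)"
      unfolding poly by simp
    have "(\<integral>z. dquot V \<phi> z \<partial>omega) = (\<integral>z. dquot V ?D z \<partial>omega) + (\<integral>z. dquot V (poly p) z \<partial>omega)"
      using dquot_linear(1)[OF L p K] by simp
    with 1 have E: "?E = (\<integral>x. ?D x * sol_op V1 x \<partial>arcsine) + (\<integral>z. dquot V ?D z \<partial>omega)" by simp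
    have 2: "\<bar>\<integral>x. ?D x * sol_op V1 x \<partial>arcsine\<bar> \<le> (2 * e) * ?B"
      by (rule arcsine_integral_bound, unfold abs_mult, intro mult_mono p' B) (use e in auto)
    have 3: "\<bar>\<integral>z. dquot V ?D z \<partial>omega\<bar> \<le> 2 * L * e" by (rule sq_weight_dquot(4)[OF L p])
    have "\<bar>?E\<bar> \<le> (2 * e) * ?B + 2 * L * e" unfolding E using 2 3 by linarith
    then show ?thesis by (simp add: algebra_simps)
  qed
  then have "?E = 0" by (rule eq_0_if_abs_le_mult)
  then show ?thesis by linarith
qed

section \<open>Measures determined by their Chebyshev moments\<close>

text \<open>The moments determine the integrals of polynomials, hence of continuous functions by
  Weierstrass, hence the measures of half-lines, whose indicators are limits of ramps.\<close>

lemma measure_eqI_moments: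
  assumes M: "finite_measure M" "sets M = sets borel_I" and N: "finite_measure N" "sets N = sets borel_I"
    and eq: "\<And>n. (\<integral>x. T n x \<partial>M) = (\<integral>x. T n x \<partial>N)"
  shows "M = N"
proof -
  interpret M: finite_measure M by fact
  interpret N: finite_measure N by fact
  have sM: "space M = I" and sN: "space N = I"
    using sets_eq_imp_space_eq[OF M(2)] sets_eq_imp_space_eq[OF N(2)] by (simp_all add: space_restrict_space)
  note iM = integrable_finite_continuous[OF M] and iN = integrable_finite_continuous[OF N]
  have poly: "(\<integral>x. poly p x \<partial>M) = (\<integral>x. poly p x \<partial>N)" for p
  proof (induction p rule: cheb_induct)
    case (add p q)
    have "integrable M (poly p)" "integrable M (poly q)" "integrable N (poly p)" "integrable N (poly q)"
      by (intro iM iN continuous_intros)+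
    with add show ?case by simp
  qed (simp_all add: eq)
  have cont: "(\<integral>x. f x \<partial>M) = (\<integral>x. f x \<partial>N)" if f: "continuous_on I f" for f :: "real \<Rightarrow> real"
  proof -
    have "\<bar>(\<integral>x. f x \<partial>M) - (\<integral>x. f x \<partial>N)\<bar> \<le> (measure M I + measure N I) * e" if e: "0 < e" for e :: real
    proof -
      obtain q where q: "\<And>x. x \<in> I \<Longrightarrow> \<bar>f x - poly q x\<bar> \<le> e"
        by (rule poly_approx_C0[OF f e]) blast
      have c: "continuous_on I (\<lambda>x. f x - poly q x)" "continuous_on I (poly q)"
        by (intro continuous_intros f)+
      have b: "\<bar>\<integral>x. f x - poly q x \<partial>K\<bar> \<le> measure K I * e"
        if K: "finite_measure K" "sets K = sets borel_I" "space K = I" for K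
      proof -
        interpret K: finite_measure K by fact
        note i = integrable_finite_continuous[OF K(1,2) c(1)]
        have "\<bar>\<integral>x. f x - poly q x \<partial>K\<bar> \<le> (\<integral>x. \<bar>f x - poly q x\<bar> \<partial>K)" by (rule integral_abs_bound)
        also have "\<dots> \<le> (\<integral>x. e \<partial>K)"
          using q K(3) i by (intro integral_mono integrable_abs) auto
        finally show ?thesis by (simp add: K(3))
      qed
      have "(\<integral>x. f x \<partial>M) - (\<integral>x. f x \<partial>N) = (\<integral>x. f x - poly q x \<partial>M) - (\<integral>x. f x - poly q x \<partial>N)"
        using iM[OF f] iM[OF c(2)] iN[OF f] iN[OF c(2)] by (simp add: poly)
      then show ?thesis using b[OF M sM] b[OF N sN] by (simp add: algebra_simps)
    qed
    then have "(\<integral>x. f x \<partial>M) - (\<integral>x. f x \<partial>N) = 0" by (rule eq_0_if_abs_le_mult)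
    then show ?thesis by simp
  qed
  let ?M = "distr M borel (\<lambda>x. x)" and ?N = "distr N borel (\<lambda>x. x)"
  have id: "(\<lambda>x. x) \<in> K \<rightarrow>\<^sub>M borel" if "sets K = sets borel_I" for K :: "real measure"
  proof -
    have "(\<lambda>x. x) \<in> borel_measurable borel_I" by (rule measurable_restrict_space1) simp
    then show ?thesis using that by (simp cong: measurable_cong_sets)
  qed
  let ?f = "\<lambda>a k x. min 1 (max 0 (real k * (x - a)))"
  have lim: "(\<lambda>k. \<integral>x. ?f a k x \<partial>K) \<longlonglongrightarrow> measure K ({a<..} \<inter> I)"
    if K: "finite_measure K" "sets K = sets borel_I" "space K = I" for K and a :: real
  proof -
    interpret K: finite_measure K by fact
    have A: "{a<..} \<inter> I \<in> sets K" unfolding K(2) by (auto simp: sets_restrict_space)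
    have "(\<lambda>k. \<integral>x. ?f a k x \<partial>K) \<longlonglongrightarrow> (\<integral>x. indicator ({a<..} \<inter> I) x \<partial>K)"
    proof (rule integral_dominated_convergence[where w="\<lambda>_. 1"])
      show "AE x in K. (\<lambda>k. ?f a k x) \<longlonglongrightarrow> indicator ({a<..} \<inter> I) x"
      proof (rule AE_I2)
        fix x assume "x \<in> space K"
        then have x: "x \<in> I" by (simp add: K(3))
        show "(\<lambda>k. ?f a k x) \<longlonglongrightarrow> indicator ({a<..} \<inter> I) x"
        proof (cases "a < x")
          case True
          obtain n where n: "1 / (x - a) < real n" using reals_Archimedean2 by blast
          have "?f a k x = 1" if "k \<ge> n" for k
          proof -
            have "1 \<le> real n * (x - a)" using n True by (simp add: field_simps)
            also have "\<dots> \<le> real k * (x - a)" using that True by (intro mult_right_mono) auto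
            finally show ?thesis by simp
          qed
          then have "eventually (\<lambda>k. ?f a k x = 1) sequentially"
            by (auto simp: eventually_sequentially)
          then have "(\<lambda>k. ?f a k x) \<longlonglongrightarrow> 1" by (rule tendsto_eventually)
          then show ?thesis using True x by simp
        next
          case False
          then have "?f a k x = 0" for k by (simp add: mult_nonneg_nonpos)
          then show ?thesis using False by simp
        qed
      qed
      show "?f a k \<in> borel_measurable K" for k
        by (intro borel_measurable_integrable integrable_finite_continuous K continuous_intros)
      show "(indicator ({a<..} \<inter> I) :: real \<Rightarrow> real) \<in> borel_measurable K" using A by simp
    qed auto
    then show ?thesis using A by simp
  qed
  have m: "measure M ({a<..} \<inter> I) = measure N ({a<..} \<inter> I)" for a
  proof (rule LIMSEQ_unique[OF lim[OF M sM]])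
    have "(\<integral>x. ?f a k x \<partial>M) = (\<integral>x. ?f a k x \<partial>N)" for k
      by (intro cont continuous_intros)
    then show "(\<lambda>k. \<integral>x. ?f a k x \<partial>M) \<longlonglongrightarrow> measure N ({a<..} \<inter> I)"
      using lim[OF N sN, of a] by simp
  qed
  have e: "emeasure (distr K borel (\<lambda>x. x)) A = emeasure K (A \<inter> I)"
    if K: "sets K = sets borel_I" "space K = I" and A: "A \<in> sets borel" for K A
    using emeasure_distr[OF id[OF K(1)] A] by (simp add: K(2) vimage_def)
  have "?M = ?N"
  proof (rule measure_eqI_lessThan)
    fix a
    show "emeasure ?M {a<..} < \<infinity>"
      by (simp add: e[OF M(2) sM] less_top[symmetric])
    show "emeasure ?M {a<..} = emeasure ?N {a<..}"
      by (simp add: e[OF M(2) sM] e[OF N(2) sN] M.emeasure_eq_measure N.emeasure_eq_measure m)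
  qed simp_all
  show "M = N"
  proof (rule measure_eqI)
    show "sets M = sets N" using M N by simp
    fix A assume "A \<in> sets M"
    then have A: "A \<in> sets borel" "A \<inter> I = A" using M(2) by (auto simp: sets_restrict_space_iff)
    show "emeasure M A = emeasure N A"
      using e[OF M(2) sM A(1)] e[OF N(2) sN A(1)] \<open>?M = ?N\<close> A(2) by simp
  qed
qed

text \<open>The positive part of the signed measure with density \<open>u\<close>; the negative part is
  \<open>density_pos (\<lambda>x. - u x)\<close>.\<close>

definition density_pos :: "(real \<Rightarrow> real) \<Rightarrow> real measure" where
  "density_pos u = density arcsine (\<lambda>x. ennreal (max 0 (u x)))"

lemma sets_density_pos [simp]: "sets (density_pos u) = sets borel_I"
  by (simp add: density_pos_def)

lemma integral_density_pos:
  assumes u: "integrable arcsine u" and f: "f \<in> borel_measurable borel_I"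
    and uf: "integrable arcsine (\<lambda>x. u x * f x)"
  shows "integrable (density_pos u) f" "integral\<^sup>L (density_pos u) f = (\<integral>x. max 0 (u x) * f x \<partial>arcsine)"
    "integrable arcsine (\<lambda>x. max 0 (u x) * f x)"
proof -
  have m: "f \<in> borel_measurable arcsine" using f by (simp cong: measurable_cong_sets)
  have mu: "(\<lambda>x. max 0 (u x)) \<in> borel_measurable arcsine" using u by simp
  have nn: "AE x in arcsine. 0 \<le> max 0 (u x)" by simp
  show i: "integrable arcsine (\<lambda>x. max 0 (u x) * f x)"
  proof (rule Bochner_Integration.integrable_bound[OF uf])
    show "AE x in arcsine. norm (max 0 (u x) * f x) \<le> norm (u x * f x)"
      by (intro AE_I2) (auto simp: abs_mult intro: mult_right_mono)
  qed (intro borel_measurable_times m mu)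
  show "integrable (density_pos u) f" unfolding density_pos_def integrable_density[OF m mu nn] using i by simp
  show "integral\<^sup>L (density_pos u) f = (\<integral>x. max 0 (u x) * f x \<partial>arcsine)"
    unfolding density_pos_def integral_density[OF m mu nn] by simp
qed

lemma integral_density_diff:
  assumes u: "integrable arcsine u" and f: "f \<in> borel_measurable borel_I"
    and uf: "integrable arcsine (\<lambda>x. u x * f x)"
  shows "integral\<^sup>L (density_pos u) f - integral\<^sup>L (density_pos (\<lambda>x. - u x)) f = (\<integral>x. u x * f x \<partial>arcsine)"
proof -
  have u': "integrable arcsine (\<lambda>x. - u x)" using u by simp
  have uf': "integrable arcsine (\<lambda>x. - u x * f x)" using uf by simp
  have "(\<integral>x. max 0 (u x) * f x \<partial>arcsine) - (\<integral>x. max 0 (- u x) * f x \<partial>arcsine) =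
     (\<integral>x. max 0 (u x) * f x - max 0 (- u x) * f x \<partial>arcsine)"
    by (intro Bochner_Integration.integral_diff[symmetric] integral_density_pos(3)[OF u f uf] integral_density_pos(3)[OF u' f uf'])
  also have "\<dots> = (\<integral>x. u x * f x \<partial>arcsine)"
    by (intro Bochner_Integration.integral_cong) (auto simp: max_def)
  finally show ?thesis
    unfolding integral_density_pos(2)[OF u f uf] integral_density_pos(2)[OF u' f uf'] .
qed

lemma finite_density_pos:
  assumes u: "integrable arcsine u"
  shows "finite_measure (density_pos u)"
proof (rule finite_measureI)
  have "integrable arcsine (\<lambda>x. max 0 (u x))" using u by simp
  then have "(\<integral>\<^sup>+x. ennreal (max 0 (u x)) \<partial>arcsine) \<noteq> \<infinity>"
    by (subst nn_integral_eq_integral) auto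
  moreover have "emeasure (density_pos u) I = (\<integral>\<^sup>+x. ennreal (max 0 (u x)) * indicator I x \<partial>arcsine)"
    unfolding density_pos_def using u
    by (intro emeasure_density) (auto simp: sets_restrict_space_iff)
  moreover have "\<dots> = (\<integral>\<^sup>+x. ennreal (max 0 (u x)) \<partial>arcsine)"
    by (intro nn_integral_cong) simp
  moreover have "space (density_pos u) = I" by (simp add: density_pos_def)
  ultimately show "emeasure (density_pos u) (space (density_pos u)) \<noteq> \<infinity>"
    by metis
qed

lemma measure_density_diff:
  assumes u: "integrable arcsine u" and B: "B \<in> sets borel_I"
  shows "measure (density_pos u) B - measure (density_pos (\<lambda>x. - u x)) B = (LINT x:B|arcsine. u x)"
proof -
  have f: "(indicator B :: real \<Rightarrow> real) \<in> borel_measurable borel_I" using B by simp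
  have "integrable arcsine (\<lambda>x. u x * indicator B x)"
    using u B by (intro integrable_real_mult_indicator) auto
  from integral_density_diff[OF u f this] show ?thesis
    using B by (simp add: set_lebesgue_integral_def mult.commute)
qed

lemma integrable_T_mult:
  assumes g: "integrable arcsine g"
  shows "integrable arcsine (\<lambda>x. T n x * g x)"
proof (rule Bochner_Integration.integrable_bound[OF g])
  show "AE x in arcsine. norm (T n x * g x) \<le> norm (g x)"
    using abs_T_le by (intro AE_I2) (auto simp: abs_mult intro: mult_left_le_one_le)
  have "T n \<in> borel_measurable arcsine"
    by (intro borel_measurable_integrable arcsine_integrable_continuous continuous_intros)
  then show "(\<lambda>x. T n x * g x) \<in> borel_measurable arcsine"
    by (intro borel_measurable_times borel_measurable_integrable[OF g])
qed

text \<open>The positive and the negative part of \<open>g\<close> define measures with equal moments.\<close>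

lemma AE_0_if_moments_0:
  assumes g: "integrable arcsine g" and m: "\<And>n. (\<integral>x. g x * T n x \<partial>arcsine) = 0"
  shows "AE x in arcsine. g x = 0"
proof -
  have g': "integrable arcsine (\<lambda>x. - g x)" using g by simp
  have "density_pos g = density_pos (\<lambda>x. - g x)"
  proof (rule measure_eqI_moments)
    fix n
    have "integrable arcsine (\<lambda>x. g x * T n x)"
      using integrable_T_mult[OF g, of n] by (simp add: mult.commute)
    from integral_density_diff[OF g measurable_borel_I[OF borel_measurable_T] this] m[of n]
    show "(\<integral>x. T n x \<partial>density_pos g) = (\<integral>x. T n x \<partial>density_pos (\<lambda>x. - g x))" by simp
  qed (simp_all add: finite_density_pos g g')
  then have "AE x in arcsine. ennreal (max 0 (g x)) = ennreal (max 0 (- g x))"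
    unfolding density_pos_def using g g' by (subst (asm) arcsine.density_unique_iff) auto
  then show ?thesis
    by eventually_elim (auto simp: max_def split: if_splits)
qed

section \<open>Solutions of the integral equation\<close>

lemma Ck_on_Suc_derivative:
  assumes "Ck_on (Suc k) f I"
  shows "\<And>x. x \<in> I \<Longrightarrow> (f has_vector_derivative deriv_within I f x) (at x within I)"
    and "Ck_on k (deriv_within I f) I"
  using assms by (auto simp: differentiable_on_def vector_derivative_works[symmetric])

lemma Ck_on_continuous: "Ck_on k f I \<Longrightarrow> continuous_on I f"
  by (cases k) (auto intro: differentiable_imp_continuous_on)

lemma log_potential_diff_moment:
  assumes P: "finite_measure P" "sets P = sets borel_I" and N: "finite_measure N" "sets N = sets borel_I"
  defines "F \<equiv> \<lambda>x. 2 * ((\<integral>y. ln \<bar>x - y\<bar> \<partial>P) - (\<integral>y. ln \<bar>x - y\<bar> \<partial>N))"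
  shows "integrable arcsine F"
    and "(\<integral>x. T n x * F x \<partial>arcsine) = - (2 / n) * ((\<integral>y. T n y \<partial>P) - (\<integral>y. T n y \<partial>N))"
proof -
  note p = log_potential_moment(1,3)[OF P] and q = log_potential_moment(1,3)[OF N]
  show "integrable arcsine F" unfolding F_def using p(1) q(1) by simp
  have "(\<integral>x. T n x * F x \<partial>arcsine) =
      (\<integral>x. 2 * (T n x * (\<integral>y. ln \<bar>x - y\<bar> \<partial>P) - T n x * (\<integral>y. ln \<bar>x - y\<bar> \<partial>N)) \<partial>arcsine)"
    unfolding F_def by (intro Bochner_Integration.integral_cong) (simp_all add: algebra_simps)
  also have "\<dots> = 2 * ((\<integral>x. T n x * (\<integral>y. ln \<bar>x - y\<bar> \<partial>P) \<partial>arcsine) - (\<integral>x. T n x * (\<integral>y. ln \<bar>x - y\<bar> \<partial>N) \<partial>arcsine))"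
    unfolding integral_mult_right_zero
    by (subst Bochner_Integration.integral_diff[OF integrable_T_mult[OF p(1)] integrable_T_mult[OF q(1)]]) simp
  also have "\<dots> = - (2 / n) * ((\<integral>y. T n y \<partial>P) - (\<integral>y. T n y \<partial>N))"
    unfolding p(2) q(2) by (simp add: diff_divide_distrib algebra_simps)
  finally show "(\<integral>x. T n x * F x \<partial>arcsine) = - (2 / n) * ((\<integral>y. T n y \<partial>P) - (\<integral>y. T n y \<partial>N))" .
qed

text \<open>The equation is integrated against \<open>T n\<close> and the arcsine law. For \<open>n = 0\<close> the left-hand side
  vanishes, which fixes \<open>C\<close> and leaves the moment to be determined by the total mass.\<close>

lemma solution_moments:
  assumes \<mu>: "finite_signed_measure borel_I \<mu>" and sol: "solves V A C \<mu>" and V: "continuous_on I V"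
  shows "C = - (\<integral>x. V x \<partial>arcsine)"
    and "signed_integral borel_I \<mu> (T n) = (if n = 0 then A else - (n / 2 * (\<integral>x. V x * T n x \<partial>arcsine)))"
proof -
  let ?P = "pos_part_measure borel_I \<mu>" and ?N = "neg_part_measure borel_I \<mu>"
  note P = Jordan_decomposition(1)[OF \<mu>] sets_signed_parts(2)[of borel_I \<mu>]
    and N = Jordan_decomposition(2)[OF \<mu>] sets_signed_parts(3)[of borel_I \<mu>]
  let ?F = "\<lambda>x. 2 * ((\<integral>y. ln \<bar>x - y\<bar> \<partial>?P) - (\<integral>y. ln \<bar>x - y\<bar> \<partial>?N))"
  have iV: "integrable arcsine V" by (rule arcsine_integrable_continuous[OF V])
  have eq: "AE x in arcsine. ?F x = V x + C"
    using sol unfolding solves_def signed_integral_def AE_arcsine_iff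
    by (auto elim: eventually_mono)
  have mom: "- (2 / n) * ((\<integral>y. T n y \<partial>?P) - (\<integral>y. T n y \<partial>?N)) = (\<integral>x. V x * T n x \<partial>arcsine) + C * (if n = 0 then 1 else 0)" for n
  proof -
    have "(\<integral>x. T n x * ?F x \<partial>arcsine) = (\<integral>x. T n x * (V x + C) \<partial>arcsine)"
    proof (rule integral_cong_AE)
      show "AE x in arcsine. T n x * ?F x = T n x * (V x + C)"
        using eq by eventually_elim simp
      show "(\<lambda>x. T n x * ?F x) \<in> borel_measurable arcsine"
        by (intro borel_measurable_integrable integrable_T_mult log_potential_diff_moment P N)
      show "(\<lambda>x. T n x * (V x + C)) \<in> borel_measurable arcsine"
        by (intro borel_measurable_integrable arcsine_integrable_continuous continuous_intros V)
    qed
    also have "\<dots> = (\<integral>x. V x * T n x + C * T n x \<partial>arcsine)"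
      by (simp add: algebra_simps)
    also have "\<dots> = (\<integral>x. V x * T n x \<partial>arcsine) + (\<integral>x. C * T n x \<partial>arcsine)"
      by (intro Bochner_Integration.integral_add arcsine_integrable_continuous continuous_intros V)
    also have "(\<integral>x. C * T n x \<partial>arcsine) = C * (if n = 0 then 1 else 0)"
      by (simp add: integral_T)
    finally show ?thesis unfolding log_potential_diff_moment(2)[OF P N] .
  qed
  \<comment> \<open>In the case \<open>n = 0\<close> the factor \<open>2 / n\<close> is 0.\<close>
  show "C = - (\<integral>x. V x \<partial>arcsine)" using mom[of 0] by simp
  show "signed_integral borel_I \<mu> (T n) = (if n = 0 then A else - (n / 2 * (\<integral>x. V x * T n x \<partial>arcsine)))"
  proof (cases "n = 0")
    case True
    have "\<mu> I = A" using sol by (simp add: solves_def)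
    moreover have "\<mu> I = measure ?P I - measure ?N I"
      by (rule Jordan_decomposition(3)[OF \<mu>]) (simp add: sets_restrict_space_iff)
    moreover have "T 0 = (\<lambda>_. 1)" by (simp add: fun_eq_iff)
    ultimately show ?thesis using True
      by (simp add: signed_integral_def space_restrict_space del: cheb.simps)
  next
    case False
    then show ?thesis using mom[of n] by (simp add: signed_integral_def field_simps)
  qed
qed

text \<open>The moments are compared as moments of honest measures, by moving the negative parts to the
  other side.\<close>

lemma signed_measure_eq_density:
  assumes \<mu>: "finite_signed_measure borel_I \<mu>" and u: "integrable arcsine u"
    and mom: "\<And>n. signed_integral borel_I \<mu> (T n) = (\<integral>x. u x * T n x \<partial>arcsine)"
    and B: "B \<in> sets borel_I"
  shows "\<mu> B = (LINT x:B|arcsine. u x)"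
proof -
  let ?p = "pos_part_measure borel_I \<mu>" and ?n = "neg_part_measure borel_I \<mu>"
  let ?P = "density_pos u" and ?N = "density_pos (\<lambda>x. - u x)"
  have u': "integrable arcsine (\<lambda>x. - u x)" using u by simp
  note p = Jordan_decomposition(1)[OF \<mu>] and n = Jordan_decomposition(2)[OF \<mu>]
    and P = finite_density_pos[OF u] and N = finite_density_pos[OF u']
  interpret p: finite_measure ?p by (rule p)
  interpret n: finite_measure ?n by (rule n)
  interpret P: finite_measure ?P by (rule P)
  interpret N: finite_measure ?N by (rule N)
  have fin: "finite_measure (add_measure K L)"
    if "finite_measure K" "finite_measure L" "sets K = sets borel_I" "sets L = sets borel_I" for K L
  proof (rule finite_measureI)
    have "emeasure (add_measure K L) (space K) = emeasure K (space K) + emeasure L (space K)"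
      using that by (intro emeasure_add_measure sets.top) simp
    then show "emeasure (add_measure K L) (space (add_measure K L)) \<noteq> \<infinity>"
      using finite_measure.emeasure_finite[OF that(1)] finite_measure.emeasure_finite[OF that(2)]
      by simp
  qed
  have T: "continuous_on I (T m)" for m by (intro continuous_intros)
  have "add_measure ?p ?N = add_measure ?n ?P"
  proof (rule measure_eqI_moments)
    fix m
    have "integral\<^sup>L ?p (T m) - integral\<^sup>L ?n (T m) = integral\<^sup>L ?P (T m) - integral\<^sup>L ?N (T m)"
      using mom[of m] integral_density_diff[OF u measurable_borel_I[OF borel_measurable_T], of m]
        integrable_T_mult[OF u, of m] by (simp add: signed_integral_def mult.commute)
    then show "integral\<^sup>L (add_measure ?p ?N) (T m) = integral\<^sup>L (add_measure ?n ?P) (T m)"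
      using integrable_finite_continuous[OF p _ T] integrable_finite_continuous[OF n _ T]
        integrable_finite_continuous[OF P _ T] integrable_finite_continuous[OF N _ T]
      by (simp add: integral_add_measure(2))
  qed (simp_all add: fin p n P N)
  then have "emeasure (add_measure ?p ?N) B = emeasure (add_measure ?n ?P) B" by simp
  then have "ennreal (measure ?p B + measure ?N B) = ennreal (measure ?n B + measure ?P B)"
    using B by (simp add: emeasure_add_measure p.emeasure_eq_measure n.emeasure_eq_measure
        P.emeasure_eq_measure N.emeasure_eq_measure)
  then have "measure ?p B + measure ?N B = measure ?n B + measure ?P B"
    by (subst (asm) ennreal_inj) auto
  then show ?thesis
    using Jordan_decomposition(3)[OF \<mu> B] measure_density_diff[OF u B] by simp
qed

theorem theorem1:
  fixes V :: "real \<Rightarrow> real" and A :: real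
  assumes "Ck_on 3 V I"
  shows "(\<exists>!\<mu>. finite_signed_measure borel_I \<mu> \<and> (\<exists>C. solves V A C \<mu>)) \<and>
    (\<forall>\<mu> C. finite_signed_measure borel_I \<mu> \<and> solves V A C \<mu> \<longrightarrow>
       (integrable arcsine (\<lambda>y. y * deriv_within I V y) \<and>
        integrable arcsine (deriv_within I V) \<and>
        (\<forall>x\<in>I. integrable arcsine
           (\<lambda>y. (deriv_within I V x - deriv_within I V y) / (x - y))) \<and>
        integrable arcsine (sol_density V A) \<and>
        (\<forall>B\<in>sets borel_I. \<mu> B = (LINT x:B|arcsine. sol_density V A x))) \<and>
       (integrable arcsine V \<and> C = - (\<integral>x. V x \<partial>arcsine)) \<and>
       (\<forall>\<phi>. Ck_on 1 \<phi> I \<longrightarrow>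
          signed_integrable borel_I \<mu> \<phi> \<and>
          integrable arcsine \<phi> \<and>
          integrable omega (\<lambda>(x, y). (V x - V y) * (\<phi> x - \<phi> y) / (x - y)\<^sup>2) \<and>
          signed_integral borel_I \<mu> \<phi> =
            A * (\<integral>x. \<phi> x \<partial>arcsine)
            - (\<integral>(x, y). (V x - V y) * (\<phi> x - \<phi> y) / (x - y)\<^sup>2 \<partial>omega)))"
proof -
  let ?V1 = "deriv_within I V" and ?V2 = "deriv_within I (deriv_within I V)"
  let ?u = "sol_density V A"
  have "Ck_on (Suc (Suc (Suc 0))) V I" using assms by (simp only: numeral_3_eq_3)
  note C3 = Ck_on_Suc_derivative[OF this]
  note C2 = Ck_on_Suc_derivative[OF C3(2)]
  note dV = C3(1) C2(1) Ck_on_continuous[OF C2(2)]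
  obtain L1 where L1: "lipschitz_I L1 ?V1" using lipschitz_I_if_C1[OF dV(2,3)] .
  obtain L where L: "lipschitz_I L V"
    using lipschitz_I_if_C1[OF dV(1) lipschitz_I_continuous[OF L1]] .
  have cV: "continuous_on I V" and cV1: "continuous_on I ?V1"
    using L L1 by (auto intro: lipschitz_I_continuous)
  have u_eq: "?u = (\<lambda>x. A + sol_op ?V1 x)" by (rule ext) (rule sol_density_sol_op)
  have iN: "integrable arcsine (\<lambda>x. f x * sol_op ?V1 x)" if f: "continuous_on I f" for f
  proof -
    obtain b where "\<And>x. x \<in> I \<Longrightarrow> \<bar>f x\<bar> \<le> b" by (rule continuous_on_I_bounded[OF f]) blast
    then show ?thesis by (intro integrable_sol_op[OF L1 borel_measurable_borel_I_continuous[OF f]])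
  qed
  have iuf: "integrable arcsine (\<lambda>x. ?u x * f x)"
    and uf: "(\<integral>x. ?u x * f x \<partial>arcsine) = A * (\<integral>x. f x \<partial>arcsine) + (\<integral>x. f x * sol_op ?V1 x \<partial>arcsine)"
    if f: "continuous_on I f" for f
  proof -
    have eq: "(\<lambda>x. ?u x * f x) = (\<lambda>x. A * f x + f x * sol_op ?V1 x)"
      unfolding u_eq by (simp add: fun_eq_iff algebra_simps)
    have i: "integrable arcsine (\<lambda>x. A * f x)"
      by (intro integrable_mult_right arcsine_integrable_continuous f)
    show "integrable arcsine (\<lambda>x. ?u x * f x)"
      unfolding eq by (rule Bochner_Integration.integrable_add[OF i iN[OF f]])
    show "(\<integral>x. ?u x * f x \<partial>arcsine) = A * (\<integral>x. f x \<partial>arcsine) + (\<integral>x. f x * sol_op ?V1 x \<partial>arcsine)"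
      unfolding eq by (subst Bochner_Integration.integral_add[OF i iN[OF f]]) simp
  qed
  have iu: "integrable arcsine ?u" using iuf[of "\<lambda>_. 1"] by simp
  then have iu': "integrable arcsine (\<lambda>x. - ?u x)" by simp
  have u_mom: "(\<integral>x. ?u x * T n x \<partial>arcsine) = (if n = 0 then A else - (n / 2 * (\<integral>x. V x * T n x \<partial>arcsine)))" for n
  proof -
    have "(\<integral>x. T n x * sol_op ?V1 x \<partial>arcsine) = - (n / 2 * (\<integral>x. V x * T n x \<partial>arcsine))"
      using dV by (rule sol_op_moment)
    moreover have "continuous_on I (T n)" by (intro continuous_intros)
    ultimately show ?thesis by (simp add: uf integral_T)
  qed
  let ?P = "density_pos ?u" and ?N = "density_pos (\<lambda>x. - ?u x)"
  note P = finite_density_pos[OF iu] and N = finite_density_pos[OF iu']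
  have sol_eq: "\<mu> B = (LINT x:B|arcsine. ?u x)"
    if "finite_signed_measure borel_I \<mu>" "solves V A C \<mu>" "B \<in> sets borel_I" for \<mu> C B
    using that(1) iu _ that(3)
    by (rule signed_measure_eq_density) (simp add: solution_moments(2)[OF that(1,2) cV] u_mom)
  define \<nu> where "\<nu> B = (if B \<in> sets borel_I then LINT x:B|arcsine. ?u x else 0)" for B
  define K where "K = - (\<integral>x. V x \<partial>arcsine)"
  have \<nu>_diff: "\<nu> B = measure ?P B - measure ?N B" if "B \<in> sets borel_I" for B
    using measure_density_diff[OF iu that] that by (simp add: \<nu>_def)
  have \<nu>: "finite_signed_measure borel_I \<nu>"
    using P _ N _ \<nu>_diff by (rule finite_signed_measure_diff) (simp_all add: \<nu>_def)
  have \<nu>_sol: "solves V A K \<nu>"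
  proof -
    let ?F = "\<lambda>x. 2 * ((\<integral>y. ln \<bar>x - y\<bar> \<partial>?P) - (\<integral>y. ln \<bar>x - y\<bar> \<partial>?N))"
    note F = log_potential_diff_moment[OF P sets_density_pos N sets_density_pos]
    have iV: "integrable arcsine V" by (rule arcsine_integrable_continuous[OF cV])
    \<comment> \<open>Identifying the potential of the candidate through its moments avoids any pointwise
      convergence of Chebyshev series.\<close>
    have "AE x in arcsine. ?F x - (V x + K) = 0"
    proof (rule AE_0_if_moments_0)
      show "integrable arcsine (\<lambda>x. ?F x - (V x + K))" using F(1) iV by simp
      fix n
      have cT: "continuous_on I (T n)" by (intro continuous_intros)
      have iVT: "integrable arcsine (\<lambda>x. V x * T n x)" "integrable arcsine (\<lambda>x. K * T n x)"
        by (intro arcsine_integrable_continuous continuous_intros cV)+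
      have "(\<integral>x. (?F x - (V x + K)) * T n x \<partial>arcsine) = (\<integral>x. T n x * ?F x - (V x * T n x + K * T n x) \<partial>arcsine)"
        by (intro Bochner_Integration.integral_cong) (simp_all add: algebra_simps)
      also have "\<dots> = (\<integral>x. T n x * ?F x \<partial>arcsine) - ((\<integral>x. V x * T n x \<partial>arcsine) + (\<integral>x. K * T n x \<partial>arcsine))"
        using Bochner_Integration.integral_diff[OF integrable_T_mult[OF F(1)] Bochner_Integration.integrable_add[OF iVT]]
          Bochner_Integration.integral_add[OF iVT] by simp
      also have "(\<integral>x. K * T n x \<partial>arcsine) = (if n = 0 then K else 0)"
        by (simp add: integral_T)
      also have "(\<integral>x. T n x * ?F x \<partial>arcsine) = - (2 / n) * (\<integral>x. ?u x * T n x \<partial>arcsine)"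
        unfolding F(2) integral_density_diff[OF iu measurable_borel_I[OF borel_measurable_T] iuf[OF cT]] ..
      also have "\<dots> - ((\<integral>x. V x * T n x \<partial>arcsine) + (if n = 0 then K else 0)) = 0"
        unfolding u_mom by (simp add: K_def)
      finally show "(\<integral>x. (?F x - (V x + K)) * T n x \<partial>arcsine) = 0" .
    qed
    moreover note log_potential_moment(2)[OF P sets_density_pos] log_potential_moment(2)[OF N sets_density_pos]
    ultimately have "AE x in arcsine. signed_integrable borel_I \<nu> (\<lambda>y. ln \<bar>x - y\<bar>) \<and>
        2 * signed_integral borel_I \<nu> (\<lambda>y. ln \<bar>x - y\<bar>) = V x + K"
    proof eventually_elim
      case (elim x)
      note s = signed_integral_eqI[OF \<nu> P sets_density_pos N sets_density_pos \<nu>_diff elim(2,3)]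
      show ?case using s elim(1) by simp
    qed
    moreover have "\<nu> I = A"
    proof -
      have I: "I \<in> sets borel_I" by (simp add: sets_restrict_space_iff)
      have "\<nu> I = (\<integral>x. ?u x * T 0 x \<partial>arcsine)"
        using I by (auto simp: \<nu>_def set_lebesgue_integral_def intro!: Bochner_Integration.integral_cong)
      then show ?thesis unfolding u_mom by simp
    qed
    ultimately show ?thesis unfolding solves_def AE_arcsine_iff by blast
  qed
  have ex1: "\<exists>!\<mu>. finite_signed_measure borel_I \<mu> \<and> (\<exists>C. solves V A C \<mu>)"
  proof (rule ex1I[of _ \<nu>])
    show "finite_signed_measure borel_I \<nu> \<and> (\<exists>C. solves V A C \<nu>)" using \<nu> \<nu>_sol by blast
    fix \<mu> assume \<mu>: "finite_signed_measure borel_I \<mu> \<and> (\<exists>C. solves V A C \<mu>)"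
    show "\<mu> = \<nu>"
    proof
      fix B
      show "\<mu> B = \<nu> B"
      proof (cases "B \<in> sets borel_I")
        case True
        then show ?thesis using \<mu> sol_eq by (auto simp: \<nu>_def)
      next
        case False
        then show ?thesis using \<mu> by (simp add: \<nu>_def finite_signed_measure_def signed_measure_def)
      qed
    qed
  qed
  have \<phi>_formula: "signed_integrable borel_I \<mu> \<phi> \<and> integrable arcsine \<phi> \<and>
      integrable omega (\<lambda>(x, y). (V x - V y) * (\<phi> x - \<phi> y) / (x - y)\<^sup>2) \<and>
      signed_integral borel_I \<mu> \<phi> = A * (\<integral>x. \<phi> x \<partial>arcsine)
        - (\<integral>(x, y). (V x - V y) * (\<phi> x - \<phi> y) / (x - y)\<^sup>2 \<partial>omega)"
    if \<mu>: "finite_signed_measure borel_I \<mu>" "solves V A C \<mu>" and \<phi>: "Ck_on 1 \<phi> I" for \<mu> C \<phi>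
  proof -
    have "Ck_on (Suc 0) \<phi> I" using \<phi> by simp
    note d\<phi> = Ck_on_Suc_derivative[OF this]
    have c\<phi>': "continuous_on I (deriv_within I \<phi>)" using d\<phi>(2) by simp
    obtain M where M: "lipschitz_I M \<phi>" using lipschitz_I_if_C1[OF d\<phi>(1) c\<phi>'] .
    have c\<phi>: "continuous_on I \<phi>" by (rule lipschitz_I_continuous[OF M])
    have diff: "\<mu> B = measure ?P B - measure ?N B" if "B \<in> sets borel_I" for B
      unfolding measure_density_diff[OF iu that] by (rule sol_eq[OF \<mu> that])
    note s = signed_integral_eqI[OF \<mu>(1) P sets_density_pos N sets_density_pos diff
        integrable_finite_continuous[OF P sets_density_pos c\<phi>]
        integrable_finite_continuous[OF N sets_density_pos c\<phi>]]
    have "signed_integral borel_I \<mu> \<phi> = (\<integral>x. ?u x * \<phi> x \<partial>arcsine)"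
      using s(2) integral_density_diff[OF iu borel_measurable_borel_I_continuous[OF c\<phi>] iuf[OF c\<phi>]] by simp
    also have "\<dots> = A * (\<integral>x. \<phi> x \<partial>arcsine) - (\<integral>p. dquot V \<phi> p \<partial>omega)"
      unfolding uf[OF c\<phi>] using sol_op_integral_eq_dquot[OF dV d\<phi>(1) c\<phi>'] by simp
    finally show ?thesis
      using s(1) arcsine_integrable_continuous[OF c\<phi>] sq_weight_dquot(1)[OF L M]
      unfolding dquot_def by blast
  qed
  have int: "integrable arcsine (\<lambda>y. y * ?V1 y)" "integrable arcsine ?V1" "integrable arcsine V"
    by (intro arcsine_integrable_continuous continuous_intros cV cV1)+
  note parts = \<phi>_formula[THEN conjunct1] \<phi>_formula[THEN conjunct2, THEN conjunct1]
    \<phi>_formula[THEN conjunct2, THEN conjunct2, THEN conjunct1]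
    \<phi>_formula[THEN conjunct2, THEN conjunct2, THEN conjunct2]
  show ?thesis
    by (intro conjI allI impI ballI ex1 int iu integrable_quotient[OF L1]; (elim conjE)?)
       (assumption | rule sol_eq solution_moments(1)[OF _ _ cV] parts)+
qed

end
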